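(* Let $\Psi$ be a quasi-complete bornological nuclear space and $\Phi$ a complete barrelled nuclear space. Then the spaces $\mathcal L(\Psi,b\mathcal P(\Phi))$, $\mathcal L(\Psi,\mathcal L_b(\Phi',b\mathcal P))$, $b\mathcal P(\Psi,\Phi)$ and $b\mathcal P(\Phi',\Psi')$ are isomorphic as linear spaces. In particular, the map $R\mapsto\widetilde R$ from $b\mathcal P(\Phi',\Psi')$ to $\mathcal L(\Psi,b\mathcal P(\Phi))$ is a linear isomorphism, where $\widetilde R$ is the element of $\mathcal L(\Psi,b\mathcal P(\Phi))$ defined by $\widetilde R:\psi\mapsto R'\psi=(R(t,\omega)'\psi:t\ge0,\omega\in\Omega)\in b\mathcal P(\Phi)$.
   Context: $(\Omega,\mathscr F,\mathbb P)$ is a complete probability space with a filtration $(\mathcal F_t)_{t\ge 0}$ satisfying the usual conditions. $b\mathcal P$ is the Banach space of bounded real predictable processes $h:\mathbb R_+\times\Omega\to\mathbb R$ with the uniform norm. All locally convex spaces are real; $\Phi'$ denotes the topological dual with the strong topology, $\langle\cdot,\cdot\rangle$ the duality pairing. $\mathcal L(E,F)$ is the space of continuous linear operators from $E$ to $F$, and $\mathcal L_b(E,F)$ is this space with the topology of uniform convergence on bounded subsets of $E$. Under the hypotheses, $\Phi$ and $\Psi$ are reflexive, so the dual operator of $A\in\mathcal L(\Phi',\Psi')$ is an element $A'\in\mathcal L(\Psi,\Phi)$, with $\langle f,A'\psi\rangle=\langle Af,\psi\rangle$. $b\mathcal P(\Phi)$ is the space of $\Phi$-valued processes $H=(H(t,\omega))$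 with $\langle f,H\rangle\in b\mathcal P$ for all $f\in\Phi'$, topologized by the seminorms $H\mapsto\sup_{(t,\omega)}p(H(t,\omega))$, $p$ ranging over continuous seminorms on $\Phi$. For locally convex spaces $E,F$, $b\mathcal P(E,F)$ is the linear space of mappings $R:\mathbb R_+\times\Omega\to\mathcal L(E,F)$ that are (i) weakly predictable: for all $g\in F'$, $e\in E$ the map $(t,\omega)\mapsto\langle g,R(t,\omega)e\rangle$ is predictable; and (ii) weakly bounded: for every bounded $B\subseteq E$ and every $g\in F'$, $\sup_{e\in B}\sup_{(t,\omega)}|\langle g,R(t,\omega)e\rangle|<\infty$. *)

theory Defs
  imports "HOL-Probability.Probability" "HOL-Library.Function_Algebras"
begin

section \<open>Locally convex spaces\<close>

text \<open>
  All spaces occurring below (duals, operator spaces, spaces of processes) are linear subspaces of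
  function types, with the pointwise linear structure.
\<close>

instantiation "fun" :: (type, real_vector) real_vector
begin

definition scaleR_fun :: "real \<Rightarrow> ('a \<Rightarrow> 'b) \<Rightarrow> 'a \<Rightarrow> 'b" where
  "scaleR_fun r f = (\<lambda>x. r *\<^sub>R f x)"

instance
  by standard (simp_all add: scaleR_fun_def fun_eq_iff algebra_simps)

end

text \<open>
  A locally convex space is given by a topology \<open>E\<close> on a linear subspace \<open>topspace E\<close> of a real
  vector space type. As usual in duality theory, locally convex spaces are Hausdorff.
\<close>

definition locally_convex_space :: "'a::real_vector topology \<Rightarrow> bool" where
  "locally_convex_space E \<longleftrightarrow>
     subspace (topspace E) \<and>
     continuous_map (prod_topology E E) E (\<lambda>(x, y). x + y) \<and>
     continuous_map (prod_topology euclideanreal E) E (\<lambda>(r, x). r *\<^sub>R x) \<and>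
     (\<forall>U. openin E U \<and> 0 \<in> U \<longrightarrow> (\<exists>V. openin E V \<and> 0 \<in> V \<and> convex V \<and> V \<subseteq> U)) \<and>
     Hausdorff_space E"

definition zero_nhd :: "'a::real_vector topology \<Rightarrow> 'a set \<Rightarrow> bool" where
  "zero_nhd E U \<longleftrightarrow> U \<subseteq> topspace E \<and> (\<exists>W. openin E W \<and> 0 \<in> W \<and> W \<subseteq> U)"

definition absolutely_convex :: "'a::real_vector set \<Rightarrow> bool" where
  "absolutely_convex D \<longleftrightarrow> convex D \<and> (\<forall>x\<in>D. \<forall>c. \<bar>c\<bar> \<le> 1 \<longrightarrow> c *\<^sub>R x \<in> D)"

definition absorbs :: "'a::real_vector set \<Rightarrow> 'a set \<Rightarrow> bool" where
  "absorbs D B \<longleftrightarrow> (\<exists>r>0. \<forall>s. \<bar>s\<bar> \<ge> r \<longrightarrow> B \<subseteq> (\<lambda>x. s *\<^sub>R x) ` D)"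

definition bounded_in :: "'a::real_vector topology \<Rightarrow> 'a set \<Rightarrow> bool" where
  "bounded_in E B \<longleftrightarrow> B \<subseteq> topspace E \<and> (\<forall>U. zero_nhd E U \<longrightarrow> absorbs U B)"

definition bornological :: "'a::real_vector topology \<Rightarrow> bool" where
  "bornological E \<longleftrightarrow>
     (\<forall>D\<subseteq>topspace E. absolutely_convex D \<and> (\<forall>B. bounded_in E B \<longrightarrow> absorbs D B) \<longrightarrow> zero_nhd E D)"

definition barrelled :: "'a::real_vector topology \<Rightarrow> bool" where
  "barrelled E \<longleftrightarrow>
     (\<forall>D. closedin E D \<and> absolutely_convex D \<and> (\<forall>x\<in>topspace E. absorbs D {x}) \<longrightarrow> zero_nhd E D)"

definition Cauchy_filter_in :: "'a::real_vector topology \<Rightarrow> 'a filter \<Rightarrow> bool" where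
  "Cauchy_filter_in E \<F> \<longleftrightarrow>
     (\<forall>U. zero_nhd E U \<longrightarrow> (\<exists>A. eventually (\<lambda>x. x \<in> A) \<F> \<and> (\<forall>x\<in>A. \<forall>y\<in>A. x - y \<in> U)))"

definition complete_in :: "'a::real_vector topology \<Rightarrow> 'a set \<Rightarrow> bool" where
  "complete_in E S \<longleftrightarrow>
     (\<forall>\<F>. \<F> \<noteq> bot \<and> \<F> \<le> principal S \<and> Cauchy_filter_in E \<F> \<longrightarrow> (\<exists>x\<in>S. limitin E (\<lambda>y. y) x \<F>))"

definition complete_lcs :: "'a::real_vector topology \<Rightarrow> bool" where
  "complete_lcs E \<longleftrightarrow> complete_in E (topspace E)"

definition quasi_complete :: "'a::real_vector topology \<Rightarrow> bool" where
  "quasi_complete E \<longleftrightarrow> (\<forall>B. closedin E B \<and> bounded_in E B \<longrightarrow> complete_in E B)"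


section \<open>Seminorms, operators and duals\<close>

definition seminorm_on :: "'a::real_vector set \<Rightarrow> ('a \<Rightarrow> real) \<Rightarrow> bool" where
  "seminorm_on S p \<longleftrightarrow>
     (\<forall>x\<in>S. \<forall>y\<in>S. p (x + y) \<le> p x + p y) \<and> (\<forall>x\<in>S. \<forall>c. p (c *\<^sub>R x) = \<bar>c\<bar> * p x)"

definition continuous_seminorm :: "'a::real_vector topology \<Rightarrow> ('a \<Rightarrow> real) \<Rightarrow> bool" where
  "continuous_seminorm E p \<longleftrightarrow> seminorm_on (topspace E) p \<and> continuous_map E euclideanreal p"

definition seminorm_topology :: "'a::real_vector set \<Rightarrow> ('a \<Rightarrow> real) set \<Rightarrow> 'a topology" where
  "seminorm_topology S P = topology (\<lambda>W. W \<subseteq> S \<and>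
     (\<forall>x\<in>W. \<exists>Q e. finite Q \<and> Q \<subseteq> P \<and> e > 0 \<and> {y\<in>S. \<forall>p\<in>Q. p (y - x) < e} \<subseteq> W))"

lemma openin_seminorm_topology:
  "openin (seminorm_topology S P) W \<longleftrightarrow> W \<subseteq> S \<and>
     (\<forall>x\<in>W. \<exists>Q e. finite Q \<and> Q \<subseteq> P \<and> e > 0 \<and> {y\<in>S. \<forall>p\<in>Q. p (y - x) < e} \<subseteq> W)"
proof -
  define N where "N x Q e = {y\<in>S. \<forall>p\<in>Q. p (y - x) < e}" for x Q and e :: real
  define nb where "nb W x \<longleftrightarrow> (\<exists>Q e. finite Q \<and> Q \<subseteq> P \<and> e > 0 \<and> N x Q e \<subseteq> W)" for W x
  have N_Int: "N x (Q \<union> Q') (min e e') \<subseteq> N x Q e \<inter> N x Q' e'" for x Q Q' e e'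
    by (auto simp: N_def)
  have int: "nb (A \<inter> B) x" if "nb A x" "nb B x" for A B x
  proof -
    obtain Q e where 1: "finite Q" "Q \<subseteq> P" "e > 0" "N x Q e \<subseteq> A"
      using \<open>nb A x\<close> unfolding nb_def by blast
    obtain Q' e' where 2: "finite Q'" "Q' \<subseteq> P" "e' > 0" "N x Q' e' \<subseteq> B"
      using \<open>nb B x\<close> unfolding nb_def by blast
    have "N x (Q \<union> Q') (min e e') \<subseteq> A \<inter> B"
      using N_Int[of x Q Q' e e'] 1(4) 2(4) by blast
    moreover have "finite (Q \<union> Q')" "Q \<union> Q' \<subseteq> P" "min e e' > 0"
      using 1 2 by simp_all
    ultimately show ?thesis
      unfolding nb_def by (intro exI[of _ "Q \<union> Q'"] exI[of _ "min e e'"] conjI)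
  qed
  have mono: "nb B x" if "nb A x" "A \<subseteq> B" for A B x
    using that unfolding nb_def by (meson subset_trans)
  define op where "op W \<longleftrightarrow> W \<subseteq> S \<and> (\<forall>x\<in>W. nb W x)" for W
  have "op (A \<inter> B)" if "op A" "op B" for A B
    using that by (simp add: op_def int le_infI1)
  moreover have "op (\<Union>\<K>)" if *: "\<forall>K\<in>\<K>. op K" for \<K>
    unfolding op_def
  proof (intro conjI ballI)
    show "\<Union>\<K> \<subseteq> S"
      using * by (auto simp: op_def)
    fix x assume "x \<in> \<Union>\<K>"
    then obtain K where K: "K \<in> \<K>" "x \<in> K" by blast
    with * have "nb K x" by (simp add: op_def)
    then show "nb (\<Union>\<K>) x"
      by (rule mono) (use K in blast)
  qed
  ultimately have "istopology op"
    by (simp add: istopology_def)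
  then have "openin (topology op) W \<longleftrightarrow> op W"
    by (simp only: topology_inverse')
  then show ?thesis
    unfolding op_def[abs_def] nb_def N_def seminorm_topology_def .
qed

lemma topspace_seminorm_topology [simp]: "topspace (seminorm_topology S P) = S"
proof
  show "topspace (seminorm_topology S P) \<subseteq> S"
    using openin_topspace[of "seminorm_topology S P"] by (simp only: openin_seminorm_topology)
  have "openin (seminorm_topology S P) S"
    unfolding openin_seminorm_topology by (auto intro!: exI[of _ "{}"] exI[of _ "1::real"])
  then show "S \<subseteq> topspace (seminorm_topology S P)"
    by (rule openin_subset)
qed

definition linear_betw :: "('a::real_vector \<Rightarrow> 'b::real_vector) \<Rightarrow> 'a set \<Rightarrow> 'b set \<Rightarrow> bool" where
  "linear_betw f S T \<longleftrightarrow> subspace S \<and> subspace T \<and> f ` S \<subseteq> T \<and>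
     (\<forall>x\<in>S. \<forall>y\<in>S. f (x + y) = f x + f y) \<and> (\<forall>x\<in>S. \<forall>c. f (c *\<^sub>R x) = c *\<^sub>R f x)"

text \<open>
  Operators are total functions normalised to be \<open>0\<close> outside the domain, so that equality of
  functions is equality of operators and the linear structure is the one of the function type.
\<close>

definition continuous_operators ::
    "'a::real_vector topology \<Rightarrow> 'b::real_vector topology \<Rightarrow> ('a \<Rightarrow> 'b) set" where
  "continuous_operators E F =
     {A. linear_betw A (topspace E) (topspace F) \<and> continuous_map E F A \<and> (\<forall>x. x \<notin> topspace E \<longrightarrow> A x = 0)}"

text \<open>
  The restriction to \<open>B \<noteq> {}\<close> only avoids the unspecified supremum of the empty set of reals.
\<close>

definition Lb :: "'a::real_vector topology \<Rightarrow> 'b::real_vector topology \<Rightarrow> ('a \<Rightarrow> 'b) topology" where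
  "Lb E F = seminorm_topology (continuous_operators E F)
     {\<lambda>A. SUP x\<in>B. q (A x) | B q. bounded_in E B \<and> B \<noteq> {} \<and> continuous_seminorm F q}"

definition strong_dual :: "'a::real_vector topology \<Rightarrow> ('a \<Rightarrow> real) topology" where
  "strong_dual E = Lb E euclideanreal"

text \<open>
  Nuclear operators \<open>x \<mapsto> \<Sum>n. f n x *\<^sub>R y n\<close> between seminormed spaces \<open>(S, q)\<close> and \<open>(T, p)\<close>, where
  \<open>a n\<close> bounds the dual norm of \<open>f n\<close>. Passing to the quotients by the kernels of \<open>q\<close> and \<open>p\<close>, this
  is nuclearity of the induced operator between normed spaces.
\<close>

definition nuclear_operator ::
    "'a::real_vector set \<Rightarrow> ('a \<Rightarrow> real) \<Rightarrow> 'b::real_vector set \<Rightarrow> ('b \<Rightarrow> real) \<Rightarrow> ('a \<Rightarrow> 'b) \<Rightarrow> bool" where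
  "nuclear_operator S q T p u \<longleftrightarrow> linear_betw u S T \<and>
     (\<exists>f y a. (\<forall>n::nat. linear_betw (f n) S (UNIV :: real set) \<and> y n \<in> T \<and> a n \<ge> 0 \<and>
                         (\<forall>x\<in>S. \<bar>f n x\<bar> \<le> a n * q x)) \<and>
              summable (\<lambda>n. a n * p (y n)) \<and>
              (\<forall>x\<in>S. (\<lambda>N. p (u x - (\<Sum>n<N. f n x *\<^sub>R y n))) \<longlonglongrightarrow> 0))"

text \<open>
  Nuclearity in the sense of Grothendieck and Pietsch: the canonical map
  \<open>E/ker q \<rightarrow> E/ker p\<close> is nuclear for a suitable \<open>q \<ge> p\<close>. Using the completions of these normed
  spaces instead gives the same notion, since every element of the completion is an absolutely
  convergent sum of elements of the dense subspace.
\<close>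

definition nuclear_space :: "'a::real_vector topology \<Rightarrow> bool" where
  "nuclear_space E \<longleftrightarrow>
     (\<forall>p. continuous_seminorm E p \<longrightarrow>
        (\<exists>q. continuous_seminorm E q \<and> (\<forall>x\<in>topspace E. p x \<le> q x) \<and>
             nuclear_operator (topspace E) q (topspace E) p (\<lambda>x. x)))"

text \<open>
  \<open>dual_operator E F A\<close> is the operator \<open>A' \<in> \<L>(E, F)\<close> dual to \<open>A \<in> \<L>(F', E')\<close>; it exists when
  \<open>E\<close> and \<open>F\<close> are reflexive, and is unique because \<open>F'\<close> separates the points of \<open>F\<close>.
\<close>

definition dual_operator ::
    "'b::real_vector topology \<Rightarrow> 'a::real_vector topology \<Rightarrow> (('a \<Rightarrow> real) \<Rightarrow> ('b \<Rightarrow> real)) \<Rightarrow> 'b \<Rightarrow> 'a" where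
  "dual_operator E F A =
     (THE A'. A' \<in> continuous_operators E F \<and>
              (\<forall>f\<in>topspace (strong_dual F). \<forall>x\<in>topspace E. f (A' x) = A f x))"

definition linear_isomorphism :: "('a::real_vector \<Rightarrow> 'b::real_vector) \<Rightarrow> 'a set \<Rightarrow> 'b set \<Rightarrow> bool" where
  "linear_isomorphism f S T \<longleftrightarrow> linear_betw f S T \<and> bij_betw f S T"

definition linearly_isomorphic :: "'a::real_vector set \<Rightarrow> 'b::real_vector set \<Rightarrow> bool" where
  "linearly_isomorphic S T \<longleftrightarrow> (\<exists>f. linear_isomorphism f S T)"


section \<open>Spaces of bounded predictable processes\<close>

text \<open>
  Only \<open>F t\<close> with \<open>t \<ge> 0\<close> is relevant. The last two assumptions are the usual conditions.
\<close>

locale stochastic_basis = prob_space M + complete_measure M for M :: "'w measure" +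
  fixes F :: "real \<Rightarrow> 'w measure"
  assumes subalg: "\<And>t. 0 \<le> t \<Longrightarrow> subalgebra M (F t)"
    and filtration_mono: "\<And>s t. 0 \<le> s \<Longrightarrow> s \<le> t \<Longrightarrow> sets (F s) \<subseteq> sets (F t)"
    and null_sets_F0: "null_sets M \<subseteq> sets (F 0)"
    and right_continuous: "\<And>t. 0 \<le> t \<Longrightarrow> (\<Inter>s\<in>{t<..}. sets (F s)) = sets (F t)"

definition predictable_sigma :: "'w measure \<Rightarrow> (real \<Rightarrow> 'w measure) \<Rightarrow> (real \<times> 'w) measure" where
  "predictable_sigma M F = sigma ({0..} \<times> space M)
     ({{0} \<times> A | A. A \<in> sets (F 0)} \<union> {{s<..t} \<times> A | s t A. 0 \<le> s \<and> s < t \<and> A \<in> sets (F s)})"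

text \<open>
  Processes are functions of \<open>(t, \<omega>)\<close>, normalised to be \<open>0\<close> outside \<open>{0..} \<times> space M\<close>.
\<close>

definition bP_carrier :: "'w measure \<Rightarrow> (real \<Rightarrow> 'w measure) \<Rightarrow> (real \<times> 'w \<Rightarrow> real) set" where
  "bP_carrier M F = {h. h \<in> borel_measurable (predictable_sigma M F) \<and>
     bounded (h ` ({0..} \<times> space M)) \<and> (\<forall>z. z \<notin> {0..} \<times> space M \<longrightarrow> h z = 0)}"

definition bP :: "'w measure \<Rightarrow> (real \<Rightarrow> 'w measure) \<Rightarrow> (real \<times> 'w \<Rightarrow> real) topology" where
  "bP M F = seminorm_topology (bP_carrier M F) {\<lambda>h. SUP z\<in>{0..} \<times> space M. \<bar>h z\<bar>}"

definition bP_vec_carrier ::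
    "'w measure \<Rightarrow> (real \<Rightarrow> 'w measure) \<Rightarrow> 'a::real_vector topology \<Rightarrow> (real \<times> 'w \<Rightarrow> 'a) set" where
  "bP_vec_carrier M F \<Phi> = {H. (\<forall>z\<in>{0..} \<times> space M. H z \<in> topspace \<Phi>) \<and>
     (\<forall>z. z \<notin> {0..} \<times> space M \<longrightarrow> H z = 0) \<and>
     (\<forall>f\<in>topspace (strong_dual \<Phi>). (\<lambda>z. f (H z)) \<in> bP_carrier M F)}"

definition bP_vec ::
    "'w measure \<Rightarrow> (real \<Rightarrow> 'w measure) \<Rightarrow> 'a::real_vector topology \<Rightarrow> (real \<times> 'w \<Rightarrow> 'a) topology" where
  "bP_vec M F \<Phi> = seminorm_topology (bP_vec_carrier M F \<Phi>)
     {\<lambda>H. SUP z\<in>{0..} \<times> space M. p (H z) | p. continuous_seminorm \<Phi> p}"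

definition bP_op ::
    "'w measure \<Rightarrow> (real \<Rightarrow> 'w measure) \<Rightarrow> 'a::real_vector topology \<Rightarrow> 'b::real_vector topology
      \<Rightarrow> (real \<times> 'w \<Rightarrow> 'a \<Rightarrow> 'b) set" where
  "bP_op M F E G = {R. (\<forall>z\<in>{0..} \<times> space M. R z \<in> continuous_operators E G) \<and>
     (\<forall>z. z \<notin> {0..} \<times> space M \<longrightarrow> R z = 0) \<and>
     (\<forall>g\<in>topspace (strong_dual G). \<forall>e\<in>topspace E.
        (\<lambda>z. g (R z e)) \<in> borel_measurable (predictable_sigma M F)) \<and>
     (\<forall>B. bounded_in E B \<longrightarrow> (\<forall>g\<in>topspace (strong_dual G).
        \<exists>C. \<forall>e\<in>B. \<forall>z\<in>{0..} \<times> space M. \<bar>g (R z e)\<bar> \<le> C))}"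

text \<open>
  Off \<open>{0..} \<times> space M\<close> we have \<open>R z = 0\<close>, whose dual operator is \<open>0\<close>, so the process below is
  normalised as well.
\<close>

definition tilde ::
    "'b::real_vector topology \<Rightarrow> 'a::real_vector topology
      \<Rightarrow> (real \<times> 'w \<Rightarrow> ('a \<Rightarrow> real) \<Rightarrow> ('b \<Rightarrow> real)) \<Rightarrow> 'b \<Rightarrow> (real \<times> 'w \<Rightarrow> 'a)" where
  "tilde \<Psi> \<Phi> R = (\<lambda>\<psi> z. dual_operator \<Psi> \<Phi> (R z) \<psi>)"

end

theory Submission
  imports Defs
begin

text \<open>
  The isomorphisms are the obvious ones: \<open>R \<mapsto> (\<psi> \<mapsto> R \<psi>)\<close>, \<open>L \<mapsto> (\<psi> \<mapsto> (f \<mapsto> f \<circ> L \<psi>))\<close>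
  and pointwise transposition \<open>R \<mapsto> (f \<mapsto> f \<circ> R)\<close>; the map \<open>tilde\<close> is the first one composed
  with the inverse of the transposition.

  Nuclear expansions supply enough continuous functionals without the Hahn-Banach theorem. A
  gliding hump then shows that weakly bounded subsets of a nuclear space are bounded, and that
  pointwise bounded sets of functionals on a quasi-complete space are uniformly bounded on bounded
  sets. As \<open>\<Psi>\<close> is bornological and \<open>\<Phi>\<close> is barrelled, this turns weak bounds into continuity.

  An element of the bidual of a nuclear space is, uniformly on each equicontinuous set, a limit of
  a sequence of evaluations. For complete \<open>\<Phi>\<close> this gives semireflexivity, hence the existence of
  dual operators; for \<open>\<Psi>\<close> it gives the predictability of the transposed process.
\<close>

section \<open>Locally convex topologies and seminorms\<close>

lemma linear_betw_zero: "linear_betw f S T \<Longrightarrow> f 0 = 0"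
  unfolding linear_betw_def by (metis scale_zero_left subspace_0)

lemma linear_betw_diff:
  assumes "linear_betw f S T" "x \<in> S" "y \<in> S"
  shows "f (x - y) = f x - f y"
proof -
  have "f (x - y + y) = f (x - y) + f y"
    using assms unfolding linear_betw_def by (metis subspace_diff)
  then show ?thesis
    by simp
qed

lemma linear_betw_sum:
  assumes f: "linear_betw f S T" and "\<And>i. i \<in> A \<Longrightarrow> x i \<in> S"
  shows "f (\<Sum>i\<in>A. c i *\<^sub>R x i) = (\<Sum>i\<in>A. c i *\<^sub>R f (x i))"
  using assms(2)
proof (induction A rule: infinite_finite_induct)
  case (insert a A)
  have S: "subspace S"
    using f by (simp add: linear_betw_def)
  have "(\<Sum>i\<in>A. c i *\<^sub>R x i) \<in> S" "c a *\<^sub>R x a \<in> S"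
    using insert.prems by (auto intro!: subspace_sum[OF S] subspace_scale[OF S])
  with insert f show ?case
    by (simp add: linear_betw_def)
qed (simp_all add: linear_betw_zero[OF f])

lemma seminorm_on_zero: "subspace S \<Longrightarrow> seminorm_on S p \<Longrightarrow> p 0 = 0"
  unfolding seminorm_on_def by (metis abs_zero mult_zero_left scale_zero_left subspace_0)

lemma seminorm_on_minus_commute:
  assumes "subspace S" "seminorm_on S p" "x \<in> S" "y \<in> S"
  shows "p (x - y) = p (y - x)"
proof -
  have "p ((-1) *\<^sub>R (y - x)) = \<bar>-1\<bar> * p (y - x)"
    using assms subspace_diff unfolding seminorm_on_def by blast
  then show ?thesis
    by (simp add: scaleR_minus_left)
qed

lemma seminorm_on_nonneg:
  assumes "subspace S" "seminorm_on S p" "x \<in> S"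
  shows "0 \<le> p x"
proof -
  have "p (x - x) \<le> p x + p (- x)"
    using assms subspace_neg unfolding seminorm_on_def by fastforce
  moreover have "p (- x) = p x"
    using seminorm_on_minus_commute[OF assms(1,2) subspace_0[OF assms(1)] assms(3)] by simp
  ultimately show ?thesis
    using seminorm_on_zero[OF assms(1,2)] by simp
qed

lemma seminorm_on_triangle:
  assumes "subspace S" "seminorm_on S p" "x \<in> S" "y \<in> S" "z \<in> S"
  shows "p (x - z) \<le> p (x - y) + p (y - z)"
proof -
  have "p ((x - y) + (y - z)) \<le> p (x - y) + p (y - z)"
    using assms subspace_diff unfolding seminorm_on_def by blast
  then show ?thesis
    by simp
qed

lemma seminorm_on_triangle_abs:
  assumes "subspace S" "seminorm_on S p" "x \<in> S" "y \<in> S"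
  shows "\<bar>p x - p y\<bar> \<le> p (x - y)"
  using seminorm_on_triangle[OF assms(1-4) subspace_0[OF assms(1)]]
    seminorm_on_triangle[OF assms(1,2,4,3) subspace_0[OF assms(1)]]
    seminorm_on_minus_commute[OF assms] by simp

lemma seminorm_on_sum_le:
  assumes S: "subspace S" and p: "seminorm_on S p" and "\<And>i. i \<in> A \<Longrightarrow> x i \<in> S"
  shows "p (\<Sum>i\<in>A. c i *\<^sub>R x i) \<le> (\<Sum>i\<in>A. \<bar>c i\<bar> * p (x i))"
  using assms(3)
proof (induction A rule: infinite_finite_induct)
  case (insert a A)
  have *: "(\<Sum>i\<in>A. c i *\<^sub>R x i) \<in> S" "c a *\<^sub>R x a \<in> S" "p (c a *\<^sub>R x a) = \<bar>c a\<bar> * p (x a)"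
    using insert.prems p
    by (auto intro!: subspace_sum[OF S] subspace_scale[OF S] simp: seminorm_on_def)
  then have "p (c a *\<^sub>R x a + (\<Sum>i\<in>A. c i *\<^sub>R x i)) \<le> p (c a *\<^sub>R x a) + p (\<Sum>i\<in>A. c i *\<^sub>R x i)"
    using p unfolding seminorm_on_def by blast
  with insert * show ?case
    by simp
qed (simp_all add: seminorm_on_zero[OF S p])

lemma seminorm_on_le_cong:
  assumes S: "subspace S" and p: "seminorm_on S p" and r: "seminorm_on S r"
    and less: "\<And>x. x \<in> S \<Longrightarrow> p x < 1 \<Longrightarrow> r x \<le> 1" and x: "x \<in> S"
  shows "r x \<le> p x"
proof (rule dense_le)
  fix t assume t: "r x > t"
  show "t \<le> p x"
  proof (rule ccontr)
    assume "\<not> t \<le> p x"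
    then have pt: "p x < t" "t > 0"
      using seminorm_on_nonneg[OF S p x] by auto
    have "(1/t) *\<^sub>R x \<in> S"
      using S x by (rule subspace_scale)
    moreover have "p ((1/t) *\<^sub>R x) = p x / t" "r ((1/t) *\<^sub>R x) = r x / t"
      using p r x pt by (simp_all add: seminorm_on_def)
    moreover have "p x / t < 1" "1 < r x / t"
      using pt t by simp_all
    ultimately show False
      using less[of "(1/t) *\<^sub>R x"] by simp
  qed
qed

lemma seminorm_on_abs_linear: "linear_betw f S (UNIV :: real set) \<Longrightarrow> seminorm_on S (\<lambda>x. \<bar>f x\<bar>)"
  by (simp add: linear_betw_def seminorm_on_def abs_mult abs_triangle_ineq)

lemma seminorm_on_compose:
  assumes "seminorm_on T q" "linear_betw f S T"
  shows "seminorm_on S (\<lambda>x. q (f x))"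
  using assms unfolding linear_betw_def seminorm_on_def by (metis image_subset_iff)

lemma continuous_seminorm_add:
  assumes "continuous_seminorm E p" "continuous_seminorm E q"
  shows "continuous_seminorm E (\<lambda>x. p x + q x)"
  using assms unfolding continuous_seminorm_def seminorm_on_def
  by (auto intro!: continuous_map_add simp: algebra_simps) (smt (verit))

lemma continuous_seminorm_cmult:
  assumes "continuous_seminorm E p" "0 \<le> c"
  shows "continuous_seminorm E (\<lambda>x. c * p x)"
  using assms unfolding continuous_seminorm_def seminorm_on_def
  by (auto intro!: continuous_map_real_mult_left simp: mult_left_mono simp flip: distrib_left)

lemma continuous_seminorm_zero: "continuous_seminorm E (\<lambda>x. 0)"
  by (simp add: continuous_seminorm_def seminorm_on_def)

lemma continuous_seminorm_sum:
  assumes "finite Q" "\<And>q. q \<in> Q \<Longrightarrow> continuous_seminorm E q"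
  shows "continuous_seminorm E (\<lambda>x. \<Sum>q\<in>Q. q x)"
  using assms
  by (induction Q rule: finite_induct) (auto intro: continuous_seminorm_zero continuous_seminorm_add)

definition locally_convex_topology :: "'a::real_vector topology \<Rightarrow> bool" where
  "locally_convex_topology E \<longleftrightarrow> subspace (topspace E) \<and>
     E = seminorm_topology (topspace E) (Collect (continuous_seminorm E))"

lemma locally_convex_topology_subspace: "locally_convex_topology E \<Longrightarrow> subspace (topspace E)"
  unfolding locally_convex_topology_def by (rule conjunct1)

lemma locally_convex_topology_eq:
  "locally_convex_topology E \<Longrightarrow> seminorm_topology (topspace E) (Collect (continuous_seminorm E)) = E"
  unfolding locally_convex_topology_def by (rule conjunct2[THEN sym])

lemma continuous_seminorm_seminorm_topology:
  assumes S: "subspace S" and P: "\<forall>p\<in>P. seminorm_on S p"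
    and r: "seminorm_on S r" and Q: "finite Q" "Q \<subseteq> P" "0 \<le> C"
    and le: "\<And>x. x \<in> S \<Longrightarrow> r x \<le> C * (\<Sum>p\<in>Q. p x)"
  shows "continuous_seminorm (seminorm_topology S P) r"
  unfolding continuous_seminorm_def
proof
  show "seminorm_on (topspace (seminorm_topology S P)) r"
    using r by simp
  have "openin (seminorm_topology S P) {x \<in> S. r x \<in> U}" if U: "open U" for U
    unfolding openin_seminorm_topology
  proof (intro conjI ballI)
    fix x assume "x \<in> {x \<in> S. r x \<in> U}"
    then have x: "x \<in> S" "r x \<in> U" by auto
    obtain e where e: "e > 0" "\<And>u. \<bar>u - r x\<bar> < e \<Longrightarrow> u \<in> U"
      using U x(2) unfolding open_real by blast
    define d where "d = e / (C * card Q + 1)"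
    have C: "C * card Q + 1 > 0"
      using Q(3) by (smt (verit) mult_nonneg_nonneg of_nat_0_le_iff)
    have "d > 0"
      using e C by (simp add: d_def)
    have "y \<in> {x \<in> S. r x \<in> U}" if y: "y \<in> S" "\<forall>p\<in>Q. p (y - x) < d" for y
    proof -
      have "(\<Sum>p\<in>Q. p (y - x)) \<le> card Q * d"
        using y by (intro sum_bounded_above) auto
      then have "r (y - x) \<le> C * (card Q * d)"
        using le[of "y - x"] subspace_diff[OF S y(1) x(1)] Q(3) by (smt (verit) mult_left_mono)
      also have "\<dots> = (C * card Q) * d" by simp
      also have "\<dots> < (C * card Q + 1) * d"
        using \<open>d > 0\<close> by (intro mult_strict_right_mono) auto
      also have "\<dots> = e"
        using C by (simp add: d_def)
      finally have "\<bar>r y - r x\<bar> < e"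
        using seminorm_on_triangle_abs[OF S r y(1) x(1)] by simp
      then show ?thesis
        using e y by auto
    qed
    then show "\<exists>Q e. finite Q \<and> Q \<subseteq> P \<and> 0 < e \<and> {y \<in> S. \<forall>p\<in>Q. p (y - x) < e} \<subseteq> {x \<in> S. r x \<in> U}"
      using Q \<open>d > 0\<close> by (intro exI[of _ Q] exI[of _ d]) auto
  qed auto
  then show "continuous_map (seminorm_topology S P) euclideanreal r"
    by (simp add: continuous_map)
qed

lemma continuous_seminorm_seminorm_topology_bound:
  assumes S: "subspace S" and P: "\<forall>p\<in>P. seminorm_on S p"
    and r: "continuous_seminorm (seminorm_topology S P) r"
  obtains Q C where "finite Q" "Q \<subseteq> P" "0 \<le> C" "\<And>x. x \<in> S \<Longrightarrow> r x \<le> C * (\<Sum>p\<in>Q. p x)"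
proof -
  have rS: "seminorm_on S r"
    using r by (simp add: continuous_seminorm_def)
  have "openin (seminorm_topology S P) {x \<in> S. r x \<in> {..<1}}"
    using r openin_continuous_map_preimage[of "seminorm_topology S P" euclideanreal r "{..<1}"]
    by (simp add: continuous_seminorm_def)
  moreover have "0 \<in> {x \<in> S. r x \<in> {..<1}}"
    using S seminorm_on_zero[OF S rS] by (simp add: subspace_0)
  ultimately obtain Q e where Q: "finite Q" "Q \<subseteq> P" "e > 0"
    "{y \<in> S. \<forall>p\<in>Q. p (y - 0) < e} \<subseteq> {x \<in> S. r x \<in> {..<1}}"
    unfolding openin_seminorm_topology by blast
  have *: "seminorm_on S (\<lambda>x. (1/e) * (\<Sum>p\<in>Q. p x))"
  proof -
    have "continuous_seminorm (seminorm_topology S P) p" if "p \<in> Q" for p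
      using continuous_seminorm_seminorm_topology[OF S P, where r = p and Q = "{p}" and C = 1] P Q(2) that by auto
    then have "continuous_seminorm (seminorm_topology S P) (\<lambda>x. (1/e) * (\<Sum>p\<in>Q. p x))"
      using Q by (intro continuous_seminorm_cmult continuous_seminorm_sum) auto
    then show ?thesis
      by (simp add: continuous_seminorm_def)
  qed
  have "r x \<le> (1/e) * (\<Sum>p\<in>Q. p x)" if "x \<in> S" for x
  proof (rule seminorm_on_le_cong[OF S * rS _ that])
    fix x assume x: "x \<in> S" "(1/e) * (\<Sum>p\<in>Q. p x) < 1"
    then have "(\<Sum>p\<in>Q. p x) < e"
      using Q by (simp add: field_simps)
    moreover have "p x \<le> (\<Sum>p\<in>Q. p x)" if "p \<in> Q" for p
      using that Q x seminorm_on_nonneg[OF S] P by (intro member_le_sum) auto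
    ultimately show "r x \<le> 1"
      using Q(4) x by fastforce
  qed
  then show thesis
    using Q that[of Q "1/e"] by auto
qed

lemma locally_convex_topology_seminorm_topology:
  assumes S: "subspace S" and P: "\<forall>p\<in>P. seminorm_on S p"
  shows "locally_convex_topology (seminorm_topology S P)"
proof -
  let ?E = "seminorm_topology S P"
  have sub: "P \<subseteq> Collect (continuous_seminorm ?E)"
    using continuous_seminorm_seminorm_topology[OF S P, where r = p and Q = "{p}" and C = 1 for p] P by auto
  have "openin ?E W \<longleftrightarrow> openin (seminorm_topology S (Collect (continuous_seminorm ?E))) W" for W
  proof
    assume "openin ?E W"
    then show "openin (seminorm_topology S (Collect (continuous_seminorm ?E))) W"
      using sub unfolding openin_seminorm_topology by (meson order_trans)
  next
    assume W: "openin (seminorm_topology S (Collect (continuous_seminorm ?E))) W"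
    show "openin ?E W"
      unfolding openin_seminorm_topology
    proof (intro conjI ballI)
      show "W \<subseteq> S"
        using W by (simp add: openin_seminorm_topology)
      fix x assume x: "x \<in> W"
      obtain Q e where Q: "finite Q" "Q \<subseteq> Collect (continuous_seminorm ?E)" "e > 0"
        "{y \<in> S. \<forall>p\<in>Q. p (y - x) < e} \<subseteq> W"
        using W x unfolding openin_seminorm_topology by blast
      have "continuous_seminorm ?E (\<lambda>x. \<Sum>q\<in>Q. q x)"
        using Q by (intro continuous_seminorm_sum) auto
      then obtain Q' C where Q': "finite Q'" "Q' \<subseteq> P" "0 \<le> C"
        and le: "\<And>x. x \<in> S \<Longrightarrow> (\<Sum>q\<in>Q. q x) \<le> C * (\<Sum>p\<in>Q'. p x)"
        using continuous_seminorm_seminorm_topology_bound[OF S P] by blast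
      define d where "d = e / (C * card Q' + 1)"
      have C: "C * card Q' + 1 > 0"
        using Q'(3) by (smt (verit) mult_nonneg_nonneg of_nat_0_le_iff)
      have "d > 0"
        using Q C by (simp add: d_def)
      have "y \<in> W" if y: "y \<in> S" "\<forall>p\<in>Q'. p (y - x) < d" for y
      proof -
        have yx: "y - x \<in> S"
          using S y x \<open>W \<subseteq> S\<close> by (auto intro: subspace_diff)
        have "(\<Sum>p\<in>Q'. p (y - x)) \<le> card Q' * d"
          using y by (intro sum_bounded_above) auto
        then have "(\<Sum>q\<in>Q. q (y - x)) \<le> C * (card Q' * d)"
          using le[OF yx] Q'(3) by (smt (verit) mult_left_mono)
        also have "\<dots> = (C * card Q') * d" by simp
        also have "\<dots> < (C * card Q' + 1) * d"
          using \<open>d > 0\<close> by (intro mult_strict_right_mono) auto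
        also have "\<dots> = e"
          using C by (simp add: d_def)
        finally have "(\<Sum>q\<in>Q. q (y - x)) < e" .
        moreover have "q (y - x) \<le> (\<Sum>q\<in>Q. q (y - x))" if "q \<in> Q" for q
        proof (rule member_le_sum[OF that _ Q(1)])
          fix p assume "p \<in> Q - {q}"
          then show "0 \<le> p (y - x)"
            using Q(2) yx by (intro seminorm_on_nonneg[OF S]) (auto simp: continuous_seminorm_def)
        qed
        ultimately show ?thesis
          using Q(4) y by fastforce
      qed
      then show "\<exists>Q e. finite Q \<and> Q \<subseteq> P \<and> 0 < e \<and> {y \<in> S. \<forall>p\<in>Q. p (y - x) < e} \<subseteq> W"
        using Q' \<open>d > 0\<close> by (intro exI[of _ Q'] exI[of _ d]) auto
    qed
  qed
  then show ?thesis
    unfolding locally_convex_topology_def using S by (simp add: topology_eq)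
qed

lemma openin_locally_convex_topology:
  assumes E: "locally_convex_topology E"
  shows "openin E W \<longleftrightarrow> W \<subseteq> topspace E \<and>
    (\<forall>x\<in>W. \<exists>p. continuous_seminorm E p \<and> {y \<in> topspace E. p (y - x) < 1} \<subseteq> W)"
proof -
  let ?S = "topspace E" and ?P = "Collect (continuous_seminorm E)"
  have S: "subspace ?S" and eq: "openin E W \<longleftrightarrow> openin (seminorm_topology ?S ?P) W"
    by (simp_all only: locally_convex_topology_subspace[OF E] locally_convex_topology_eq[OF E])
  have *: "(\<exists>Q e. finite Q \<and> Q \<subseteq> ?P \<and> 0 < e \<and> {y \<in> ?S. \<forall>p\<in>Q. p (y - x) < e} \<subseteq> W) \<longleftrightarrow>
    (\<exists>p. continuous_seminorm E p \<and> {y \<in> ?S. p (y - x) < 1} \<subseteq> W)" (is "?l \<longleftrightarrow> ?r")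
    if x: "x \<in> ?S" for x
  proof
    assume ?l
    then obtain Q e where Q: "finite Q" "Q \<subseteq> ?P" "0 < e" "{y \<in> ?S. \<forall>p\<in>Q. p (y - x) < e} \<subseteq> W"
      by blast
    have p: "continuous_seminorm E (\<lambda>x. (1/e) * (\<Sum>q\<in>Q. q x))"
      using Q by (intro continuous_seminorm_cmult continuous_seminorm_sum) auto
    have "q (y - x) < e" if "y \<in> ?S" "(1/e) * (\<Sum>q\<in>Q. q (y - x)) < 1" "q \<in> Q" for y q
    proof -
      have "q (y - x) \<le> (\<Sum>q\<in>Q. q (y - x))"
      proof (rule member_le_sum[OF that(3) _ Q(1)])
        fix p assume "p \<in> Q - {q}"
        then show "0 \<le> p (y - x)"
          using Q(2) that x
          by (intro seminorm_on_nonneg[OF S] subspace_diff[OF S]) (auto simp: continuous_seminorm_def)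
      qed
      then show ?thesis
        using that(2) Q(3) by (simp add: field_simps)
    qed
    then show ?r
      using Q(4) p by (intro exI[of _ "\<lambda>x. (1/e) * (\<Sum>q\<in>Q. q x)"]) auto
  next
    assume ?r
    then obtain p where "continuous_seminorm E p" "{y \<in> ?S. p (y - x) < 1} \<subseteq> W" by blast
    then show ?l
      by (intro exI[of _ "{p}"] exI[of _ "1::real"]) auto
  qed
  then show ?thesis
    unfolding eq openin_seminorm_topology by (intro conj_cong refl ball_cong *) auto
qed

lemma openin_seminorm_ball:
  assumes E: "subspace (topspace E)" and p: "continuous_seminorm E p"
  shows "openin E {x \<in> topspace E. p x < 1}"
  using p openin_continuous_map_preimage[of E euclideanreal p "{..<1}"]
  by (simp add: continuous_seminorm_def)

lemma zero_nhd_iff: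
  assumes E: "locally_convex_topology E"
  shows "zero_nhd E U \<longleftrightarrow> U \<subseteq> topspace E \<and>
    (\<exists>p. continuous_seminorm E p \<and> {x \<in> topspace E. p x < 1} \<subseteq> U)"
proof -
  have S: "subspace (topspace E)"
    using E by (rule locally_convex_topology_subspace)
  have 0: "0 \<in> {x \<in> topspace E. p x < 1}" if "continuous_seminorm E p" for p
    using that S seminorm_on_zero[OF S, of p] by (simp add: subspace_0 continuous_seminorm_def)
  have "\<exists>p. continuous_seminorm E p \<and> {x \<in> topspace E. p x < 1} \<subseteq> W" if "openin E W" "0 \<in> W" for W
    using that unfolding openin_locally_convex_topology[OF E] by fastforce
  then show ?thesis
    using openin_seminorm_ball[OF S] 0 unfolding zero_nhd_def by (meson order_trans)
qed

lemma bounded_in_iff: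
  assumes E: "locally_convex_topology E"
  shows "bounded_in E B \<longleftrightarrow> B \<subseteq> topspace E \<and>
    (\<forall>p. continuous_seminorm E p \<longrightarrow> (\<exists>C. \<forall>x\<in>B. p x \<le> C))"
proof -
  have S: "subspace (topspace E)"
    using E by (rule locally_convex_topology_subspace)
  have 1: "\<exists>C. \<forall>x\<in>B. p x \<le> C" if B: "bounded_in E B" and p: "continuous_seminorm E p" for p
  proof -
    have "zero_nhd E {x \<in> topspace E. p x < 1}"
      unfolding zero_nhd_iff[OF E] using p by auto
    then obtain r where r: "r > 0" "B \<subseteq> (\<lambda>x. r *\<^sub>R x) ` {x \<in> topspace E. p x < 1}"
      using B unfolding bounded_in_def absorbs_def by (metis abs_ge_self)
    have "p x \<le> r" if "x \<in> B" for x
    proof -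
      obtain y where "x = r *\<^sub>R y" "y \<in> topspace E" "p y < 1"
        using subsetD[OF r(2) \<open>x \<in> B\<close>] by auto
      moreover from this p r(1) have "p x = r * p y"
        by (simp add: continuous_seminorm_def seminorm_on_def)
      ultimately show ?thesis
        using r(1) by simp
    qed
    then show ?thesis
      by blast
  qed
  have 2: "absorbs U B" if B: "B \<subseteq> topspace E" and bd: "\<And>p. continuous_seminorm E p \<Longrightarrow> \<exists>C. \<forall>x\<in>B. p x \<le> C"
    and U: "zero_nhd E U" for U
  proof -
    obtain p where p: "continuous_seminorm E p" "{x \<in> topspace E. p x < 1} \<subseteq> U"
      using U unfolding zero_nhd_iff[OF E] by blast
    obtain C where C: "\<And>x. x \<in> B \<Longrightarrow> p x \<le> C"
      using bd[OF p(1)] by blast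
    have "x \<in> (\<lambda>x. s *\<^sub>R x) ` U" if x: "x \<in> B" and s: "\<bar>s\<bar> \<ge> \<bar>C\<bar> + 1" for x s
    proof -
      have "(1/s) *\<^sub>R x \<in> topspace E"
        using B x by (intro subspace_scale[OF S]) auto
      moreover have "p ((1/s) *\<^sub>R x) = p x / \<bar>s\<bar>"
        using p B x by (auto simp: continuous_seminorm_def seminorm_on_def)
      moreover have "p x / \<bar>s\<bar> < 1"
        using C[OF x] s by (auto simp: field_simps)
      ultimately have "(1/s) *\<^sub>R x \<in> U"
        using p by auto
      moreover have "x = s *\<^sub>R ((1/s) *\<^sub>R x)"
        using s by auto
      ultimately show ?thesis
        by blast
    qed
    then show ?thesis
      unfolding absorbs_def by (intro exI[of _ "\<bar>C\<bar> + 1"]) auto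
  qed
  show ?thesis
    using 1 2 unfolding bounded_in_def by blast
qed

lemma bounded_in_seminorm_topology:
  assumes S: "subspace S" and P: "\<forall>p\<in>P. seminorm_on S p"
    and B: "B \<subseteq> S" and bd: "\<And>p. p \<in> P \<Longrightarrow> \<exists>C. \<forall>x\<in>B. p x \<le> C"
  shows "bounded_in (seminorm_topology S P) B"
proof -
  have lct: "locally_convex_topology (seminorm_topology S P)"
    using S P by (rule locally_convex_topology_seminorm_topology)
  have "\<exists>C. \<forall>x\<in>B. r x \<le> C" if r: "continuous_seminorm (seminorm_topology S P) r" for r
  proof -
  obtain Q C where Q: "finite Q" "Q \<subseteq> P" "0 \<le> C" "\<And>x. x \<in> S \<Longrightarrow> r x \<le> C * (\<Sum>p\<in>Q. p x)"
    using continuous_seminorm_seminorm_topology_bound[OF S P r] by metis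
  obtain K where K: "\<And>p x. p \<in> P \<Longrightarrow> x \<in> B \<Longrightarrow> p x \<le> K p"
    using bd by metis
  have "r x \<le> C * (\<Sum>p\<in>Q. K p)" if "x \<in> B" for x
  proof -
    have "(\<Sum>p\<in>Q. p x) \<le> (\<Sum>p\<in>Q. K p)"
      using K Q that by (intro sum_mono) auto
    then show ?thesis
      using Q(3) Q(4)[of x] that B by (smt (verit) mult_left_mono subsetD)
  qed
  then show "\<exists>C. \<forall>x\<in>B. r x \<le> C"
    by blast
  qed
  then show ?thesis
    using B by (simp add: bounded_in_iff[OF lct])
qed

lemma continuous_map_linear:
  assumes E: "locally_convex_topology E" and T: "subspace T"
    and P: "\<forall>p\<in>P. seminorm_on T p"
    and A: "linear_betw A (topspace E) T"
    and le: "\<And>q. q \<in> P \<Longrightarrow> \<exists>p. continuous_seminorm E p \<and> (\<forall>x\<in>topspace E. q (A x) \<le> p x)"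
  shows "continuous_map E (seminorm_topology T P) A"
proof -
  have S: "subspace (topspace E)"
    using E by (rule locally_convex_topology_subspace)
  have AT: "A x \<in> T" if "x \<in> topspace E" for x
    using A that by (auto simp: linear_betw_def)
  have "openin E {x \<in> topspace E. A x \<in> W}" if W: "openin (seminorm_topology T P) W" for W
    unfolding openin_locally_convex_topology[OF E]
  proof (intro conjI ballI)
    fix x assume "x \<in> {x \<in> topspace E. A x \<in> W}"
    then have x: "x \<in> topspace E" "A x \<in> W" by auto
    obtain Q e where Q: "finite Q" "Q \<subseteq> P" "e > 0" "{y \<in> T. \<forall>p\<in>Q. p (y - A x) < e} \<subseteq> W"
      using W x(2) unfolding openin_seminorm_topology by blast
    obtain p where p: "\<And>q. q \<in> P \<Longrightarrow> continuous_seminorm E (p q) \<and> (\<forall>x\<in>topspace E. q (A x) \<le> p q x)"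
      using le by metis
    let ?r = "\<lambda>x. (1/e) * (\<Sum>s\<in>p ` Q. s x)"
    have r: "continuous_seminorm E ?r"
      using Q p by (intro continuous_seminorm_cmult continuous_seminorm_sum) auto
    have "A y \<in> W" if y: "y \<in> topspace E" "?r (y - x) < 1" for y
    proof -
      have yx: "y - x \<in> topspace E"
        using S y(1) x(1) by (rule subspace_diff)
      have "q (A y - A x) < e" if "q \<in> Q" for q
      proof -
        have "q (A y - A x) = q (A (y - x))"
          using linear_betw_diff[OF A y(1) x(1)] by simp
        also have "\<dots> \<le> p q (y - x)"
          using p[of q] Q(2) that yx by blast
        also have "\<dots> \<le> (\<Sum>s\<in>p ` Q. s (y - x))"
        proof (rule member_le_sum)
          fix s assume "s \<in> p ` Q - {p q}"
          then show "0 \<le> s (y - x)"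
            using Q(2) yx p by (intro seminorm_on_nonneg[OF S]) (auto simp: continuous_seminorm_def)
        qed (use that Q in auto)
        finally show ?thesis
          using y(2) Q(3) by (simp add: field_simps)
      qed
      then show ?thesis
        using Q(4) AT[OF y(1)] by blast
    qed
    then show "\<exists>p. continuous_seminorm E p \<and>
        {y \<in> topspace E. p (y - x) < 1} \<subseteq> {x \<in> topspace E. A x \<in> W}"
      using r by (intro exI[of _ ?r]) auto
  qed auto
  then show ?thesis
    using AT by (simp add: continuous_map)  (auto simp: image_subset_iff)
qed

lemma continuous_map_linear':
  assumes E: "locally_convex_topology E" and F: "locally_convex_topology F"
    and A: "linear_betw A (topspace E) (topspace F)"
    and le: "\<And>q. continuous_seminorm F q \<Longrightarrow>
      \<exists>p. continuous_seminorm E p \<and> (\<forall>x\<in>topspace E. q (A x) \<le> p x)"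
  shows "continuous_map E F A"
proof -
  have "continuous_map E (seminorm_topology (topspace F) (Collect (continuous_seminorm F))) A"
    by (rule continuous_map_linear[OF E locally_convex_topology_subspace[OF F] _ A])
       (use le in \<open>auto simp: continuous_seminorm_def\<close>)
  then show ?thesis
    by (simp only: locally_convex_topology_eq[OF F])
qed

lemma continuous_seminorm_compose:
  assumes "linear_betw A (topspace E) (topspace F)" "continuous_map E F A" "continuous_seminorm F q"
  shows "continuous_seminorm E (\<lambda>x. q (A x))"
  using assms continuous_map_compose[of E F A euclideanreal q] seminorm_on_compose[of "topspace F" q A]
  by (simp add: continuous_seminorm_def o_def)

lemma gauge_seminorm:
  fixes U :: "'a::real_vector set"
  assumes S: "subspace S" and U: "U \<subseteq> S" "convex U" "\<And>x. x \<in> U \<Longrightarrow> - x \<in> U"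
    and abs: "\<And>x. x \<in> S \<Longrightarrow> \<exists>t>0. (1/t) *\<^sub>R x \<in> U"
  defines "p \<equiv> (\<lambda>x. Inf {t. t > 0 \<and> (1/t) *\<^sub>R x \<in> U})"
  shows "seminorm_on S p" "\<And>x. x \<in> S \<Longrightarrow> p x < 1 \<Longrightarrow> x \<in> U" "\<And>x. x \<in> U \<Longrightarrow> p x \<le> 1"
proof -
  define A where "A x = {t. t > 0 \<and> (1/t) *\<^sub>R x \<in> U}" for x
  have p: "p x = Inf (A x)" for x
    by (simp add: p_def A_def)
  have ne: "A x \<noteq> {}" if "x \<in> S" for x
    using abs[OF that] by (auto simp: A_def)
  have bdd: "bdd_below (A x)" for x
    unfolding A_def by (rule bdd_belowI[of _ 0]) auto
  have le: "p x \<le> t" if "t \<in> A x" for x t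
    unfolding p by (rule cInf_lower[OF that bdd])
  have ex: "\<exists>t\<in>A x. t < s" if "x \<in> S" "p x < s" for x s
    using cInf_lessD[OF ne[OF that(1)], of s] that(2) p by auto
  have U0: "0 \<in> U"
    using abs[of 0] S by (simp add: subspace_0)
  have mono: "s \<in> A x" if "t \<in> A x" "t \<le> s" for x s t
  proof -
    have "(t/s) *\<^sub>R ((1/t) *\<^sub>R x) + (1 - t/s) *\<^sub>R 0 \<in> U"
      using that U(2) U0 unfolding A_def by (intro convexD) (auto simp: field_simps)
    then show ?thesis
      using that by (auto simp: A_def)
  qed
  have nonneg: "0 \<le> p x" if "x \<in> S" for x
    unfolding p using ne[OF that] by (intro cInf_greatest) (auto simp: A_def)
  show less: "x \<in> U" if "x \<in> S" "p x < 1" for x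
  proof -
    obtain t where "t \<in> A x" "t < 1"
      using ex[OF \<open>x \<in> S\<close> \<open>p x < 1\<close>] by blast
    then have "1 \<in> A x"
      using mono by fastforce
    then show ?thesis
      by (simp add: A_def)
  qed
  show "p x \<le> 1" if "x \<in> U" for x
    using that by (intro le) (simp add: A_def)
  have tri: "p (x + y) \<le> p x + p y" if x: "x \<in> S" and y: "y \<in> S" for x y
  proof (rule field_le_epsilon)
    fix e :: real assume "e > 0"
    then obtain s t where s: "s \<in> A x" "s < p x + e/2" and t: "t \<in> A y" "t < p y + e/2"
      using ex[OF x, of "p x + e/2"] ex[OF y, of "p y + e/2"] by auto
    have "s / (s+t) + t / (s+t) = 1"
      using s t by (simp add: A_def flip: add_divide_distrib)
    then have "(s/(s+t)) *\<^sub>R ((1/s) *\<^sub>R x) + (t/(s+t)) *\<^sub>R ((1/t) *\<^sub>R y) \<in> U"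
      using s t U(2) unfolding A_def by (intro convexD) auto
    moreover have "s / (s+t) * (1/s) = 1/(s+t)" "t / (s+t) * (1/t) = 1/(s+t)"
      using s t by (auto simp: A_def)
    ultimately have "s + t \<in> A (x + y)"
      using s t by (auto simp: A_def scaleR_add_right)
    then show "p (x + y) \<le> p x + p y + e"
      using le s t by fastforce
  qed
  have pos: "p (c *\<^sub>R x) \<le> c * p x" if x: "x \<in> S" and c: "c > 0" for x c
  proof (rule field_le_epsilon)
    fix e :: real assume "e > 0"
    then obtain t where t: "t \<in> A x" "t < p x + e/c"
      using ex[OF x, of "p x + e/c"] c by auto
    have "c * t \<in> A (c *\<^sub>R x)"
      using t(1) c by (auto simp: A_def)
    then have "p (c *\<^sub>R x) \<le> c * t"
      by (rule le)
    also have "\<dots> \<le> c * p x + e"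
      using t(2) c by (simp add: field_simps)
    finally show "p (c *\<^sub>R x) \<le> c * p x + e" .
  qed
  have pos': "p (c *\<^sub>R x) = c * p x" if x: "x \<in> S" and c: "c > 0" for x c
  proof (rule antisym[OF pos[OF that]])
    have "p ((1/c) *\<^sub>R (c *\<^sub>R x)) \<le> (1/c) * p (c *\<^sub>R x)"
      using c S x by (intro pos) (auto intro: subspace_scale)
    then show "c * p x \<le> p (c *\<^sub>R x)"
      using c by (simp add: field_simps)
  qed
  have minus: "p (- x) = p x" for x
  proof -
    have "A (- x) = A x"
      unfolding A_def using U(3) by fastforce
    then show ?thesis
      by (simp add: p)
  qed
  have zero: "p 0 = 0"
  proof (rule antisym)
    show "p 0 \<le> 0"
    proof (rule field_le_epsilon)
      fix e :: real assume "e > 0"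
      then show "p 0 \<le> 0 + e"
        using U0 by (intro le) (simp add: A_def)
    qed
    show "0 \<le> p 0"
      using nonneg S by (simp add: subspace_0)
  qed
  have "p (c *\<^sub>R x) = \<bar>c\<bar> * p x" if x: "x \<in> S" for x c
  proof (cases c "0 :: real" rule: linorder_cases)
    case less
    then have "p ((- c) *\<^sub>R x) = (- c) * p x"
      using x by (intro pos') auto
    then show ?thesis
      using less minus[of "c *\<^sub>R x"] by simp
  qed (use zero pos'[OF x] in auto)
  with tri show "seminorm_on S p"
    by (simp add: seminorm_on_def)
qed

lemma continuous_map_affine:
  assumes E: "locally_convex_space E" and a: "a \<in> topspace E"
  shows "continuous_map E E (\<lambda>y. c *\<^sub>R (y + a))"
proof -
  have "continuous_map E (prod_topology E E) (\<lambda>y. (y, a))"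
    using a by (intro continuous_map_pairedI) auto
  then have "continuous_map E E ((\<lambda>(x, y). x + y) \<circ> (\<lambda>y. (y, a)))"
    using E unfolding locally_convex_space_def by (intro continuous_map_compose) auto
  then have "continuous_map E (prod_topology euclideanreal E) (\<lambda>y. (c, y + a))"
    by (intro continuous_map_pairedI) (auto simp: o_def)
  then have "continuous_map E E ((\<lambda>(r, x). r *\<^sub>R x) \<circ> (\<lambda>y. (c, y + a)))"
    using E unfolding locally_convex_space_def by (intro continuous_map_compose) auto
  then show ?thesis
    by (simp add: o_def)
qed

lemma locally_convex_space_gauge:
  assumes E: "locally_convex_space E" and W: "openin E W" "0 \<in> W"
  shows "\<exists>p. continuous_seminorm E p \<and> {x \<in> topspace E. p x < 1} \<subseteq> W"
proof -
  let ?S = "topspace E"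
  have S: "subspace ?S"
    using E by (simp add: locally_convex_space_def)
  obtain V where V: "openin E V" "0 \<in> V" "convex V" "V \<subseteq> W"
    using E W unfolding locally_convex_space_def by blast
  define U where "U = V \<inter> {x \<in> ?S. (-1) *\<^sub>R (x + 0) \<in> V}"
  have aff: "continuous_map E E (\<lambda>y. c *\<^sub>R (y + a))" if "a \<in> ?S" for a c
    using continuous_map_affine[OF E that] .
  have U: "openin E U"
    unfolding U_def
    by (rule openin_Int[OF V(1) openin_continuous_map_preimage[OF aff[OF subspace_0[OF S]] V(1)]])
  have "convex {x \<in> ?S. - x \<in> V}"
    unfolding convex_alt
  proof clarify
    fix x y and u :: real
    assume *: "x \<in> ?S" "- x \<in> V" "y \<in> ?S" "- y \<in> V" "0 \<le> u" "u \<le> 1"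
    then have "(1 - u) *\<^sub>R x + u *\<^sub>R y \<in> ?S"
      using S by (intro subspace_add subspace_scale) auto
    moreover have "(1 - u) *\<^sub>R (- x) + u *\<^sub>R (- y) \<in> V"
      using V(3) * unfolding convex_alt by blast
    ultimately show "(1 - u) *\<^sub>R x + u *\<^sub>R y \<in> ?S \<and> - ((1 - u) *\<^sub>R x + u *\<^sub>R y) \<in> V"
      by simp
  qed
  then have conv: "convex U"
    unfolding U_def using V(3) by (simp add: convex_Int)
  have "U \<subseteq> ?S"
    using openin_subset[OF U] .
  have sym: "- x \<in> U" if "x \<in> U" for x
    using that S by (auto simp: U_def subspace_neg)
  have absorb: "\<exists>t>0. (1/t) *\<^sub>R x \<in> U" if x: "x \<in> ?S" for x
  proof -
    have "continuous_map euclideanreal (prod_topology euclideanreal E) (\<lambda>r. (r, x))"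
      using x by (intro continuous_map_pairedI) auto
    then have "continuous_map euclideanreal E ((\<lambda>(r, x). r *\<^sub>R x) \<circ> (\<lambda>r. (r, x)))"
      using E unfolding locally_convex_space_def by (intro continuous_map_compose) auto
    then have "openin euclideanreal {r \<in> topspace euclideanreal. r *\<^sub>R x \<in> U}"
      using U by (intro openin_continuous_map_preimage) (auto simp: o_def)
    then have "open {r. r *\<^sub>R x \<in> U}"
      by simp
    moreover have "0 \<in> {r. r *\<^sub>R x \<in> U}"
      using V S by (simp add: U_def subspace_0)
    ultimately obtain e where e: "e > 0" "\<And>r. \<bar>r - 0\<bar> < e \<Longrightarrow> r \<in> {r. r *\<^sub>R x \<in> U}"
      unfolding open_real by blast
    then have "(e/2) *\<^sub>R x \<in> U"
      by auto
    then show ?thesis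
      using e(1) by (intro exI[of _ "2/e"]) auto
  qed
  define p where "p = (\<lambda>x. Inf {t. t > 0 \<and> (1/t) *\<^sub>R x \<in> U})"
  have p: "seminorm_on ?S p" "\<And>x. x \<in> ?S \<Longrightarrow> p x < 1 \<Longrightarrow> x \<in> U" "\<And>x. x \<in> U \<Longrightarrow> p x \<le> 1"
    unfolding p_def using gauge_seminorm[OF S \<open>U \<subseteq> ?S\<close> conv sym absorb] by auto
  have "openin E {x \<in> ?S. p x \<in> Z}" if Z: "open Z" for Z
  proof (subst openin_subopen, clarify)
    fix x assume x: "x \<in> ?S" "p x \<in> Z"
    obtain e where e: "e > 0" "\<And>u. \<bar>u - p x\<bar> < e \<Longrightarrow> u \<in> Z"
      using Z x(2) unfolding open_real by blast
    let ?T = "{y \<in> ?S. (2/e) *\<^sub>R (y + - x) \<in> U}"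
    have "openin E ?T"
      using S x by (intro openin_continuous_map_preimage[OF aff U]) (auto simp: subspace_neg)
    moreover have "x \<in> ?T"
      using x V S by (simp add: U_def subspace_0)
    moreover have "?T \<subseteq> {x \<in> ?S. p x \<in> Z}"
    proof clarify
      fix y assume y: "y \<in> ?S" "(2/e) *\<^sub>R (y + - x) \<in> U"
      have yx: "y - x \<in> ?S"
        using S y(1) x(1) by (rule subspace_diff)
      have "p ((2/e) *\<^sub>R (y - x)) \<le> 1"
        using p(3) y by simp
      moreover have "p ((2/e) *\<^sub>R (y - x)) = \<bar>2/e\<bar> * p (y - x)"
        using p(1) yx unfolding seminorm_on_def by blast
      ultimately have "(2/e) * p (y - x) \<le> 1"
        using e(1) by simp
      then have "p (y - x) \<le> e/2"
        using e(1) by (simp add: field_simps)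
      then have "\<bar>p y - p x\<bar> < e"
        using seminorm_on_triangle_abs[OF S p(1) y(1) x(1)] e(1) by simp
      then show "p y \<in> Z"
        using e by blast
    qed
    ultimately show "\<exists>T. openin E T \<and> x \<in> T \<and> T \<subseteq> {x \<in> ?S. p x \<in> Z}"
      by blast
  qed
  then have "continuous_seminorm E p"
    using p(1) by (simp add: continuous_seminorm_def continuous_map)
  moreover have "{x \<in> ?S. p x < 1} \<subseteq> W"
    using p(2) V(4) by (auto simp: U_def)
  ultimately show ?thesis
    by blast
qed

lemma locally_convex_space_topology:
  assumes E: "locally_convex_space E"
  shows "locally_convex_topology E"
proof -
  let ?S = "topspace E" and ?P = "Collect (continuous_seminorm E)"
  have S: "subspace ?S"
    using E by (simp add: locally_convex_space_def)
  have "openin E W \<longleftrightarrow> openin (seminorm_topology ?S ?P) W" for W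
  proof
    assume W: "openin E W"
    show "openin (seminorm_topology ?S ?P) W"
      unfolding openin_seminorm_topology
    proof (intro conjI ballI)
      show "W \<subseteq> ?S"
        using W by (rule openin_subset)
      fix x assume x: "x \<in> W"
      with \<open>W \<subseteq> ?S\<close> have xS: "x \<in> ?S" by blast
      have "openin E {y \<in> ?S. 1 *\<^sub>R (y + x) \<in> W}"
        by (rule openin_continuous_map_preimage[OF continuous_map_affine[OF E xS] W])
      moreover have "0 \<in> {y \<in> ?S. 1 *\<^sub>R (y + x) \<in> W}"
        using x S by (simp add: subspace_0)
      ultimately obtain p where p: "continuous_seminorm E p"
        "{y \<in> ?S. p y < 1} \<subseteq> {y \<in> ?S. 1 *\<^sub>R (y + x) \<in> W}"
        using locally_convex_space_gauge[OF E] by meson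
      have "y \<in> W" if "y \<in> ?S" "p (y - x) < 1" for y
        using subspace_diff[OF S that(1) xS] that p(2) by force
      then show "\<exists>Q e. finite Q \<and> Q \<subseteq> ?P \<and> 0 < e \<and> {y \<in> ?S. \<forall>p\<in>Q. p (y - x) < e} \<subseteq> W"
        using p(1) by (intro exI[of _ "{p}"] exI[of _ "1::real"]) auto
    qed
  next
    assume W: "openin (seminorm_topology ?S ?P) W"
    show "openin E W"
    proof (subst openin_subopen, clarify)
      fix x assume x: "x \<in> W"
      have xS: "x \<in> ?S"
        using W x by (auto simp: openin_seminorm_topology)
      obtain Q e where Q: "finite Q" "Q \<subseteq> ?P" "e > 0" "{y \<in> ?S. \<forall>p\<in>Q. p (y - x) < e} \<subseteq> W"
        using W x unfolding openin_seminorm_topology by blast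
      let ?r = "\<lambda>x. \<Sum>q\<in>Q. q x"
      have r: "continuous_seminorm E ?r"
        using Q by (intro continuous_seminorm_sum) auto
      have "continuous_map E euclideanreal (?r \<circ> (\<lambda>y. 1 *\<^sub>R (y + - x)))"
        using r S xS continuous_map_affine[OF E, of "- x" 1]
        by (intro continuous_map_compose) (auto simp: continuous_seminorm_def subspace_neg)
      from openin_continuous_map_preimage[OF this, of "{..<e}"]
      have "openin E {y \<in> ?S. ?r (y - x) < e}"
        by simp
      moreover have "x \<in> {y \<in> ?S. ?r (y - x) < e}"
        using xS Q(3) r seminorm_on_zero[OF S, of ?r] by (simp add: continuous_seminorm_def)
      moreover have "{y \<in> ?S. ?r (y - x) < e} \<subseteq> W"
      proof clarify
        fix y assume y: "y \<in> ?S" "?r (y - x) < e"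
        have "q (y - x) < e" if "q \<in> Q" for q
        proof -
          have "q (y - x) \<le> ?r (y - x)"
          proof (rule member_le_sum[OF that _ Q(1)])
            fix p assume "p \<in> Q - {q}"
            then show "0 \<le> p (y - x)"
              using Q(2) y(1) xS
              by (intro seminorm_on_nonneg[OF S] subspace_diff[OF S]) (auto simp: continuous_seminorm_def)
          qed
          with y(2) show ?thesis
            by simp
        qed
        then show "y \<in> W"
          using Q(4) y(1) by blast
      qed
      ultimately show "\<exists>T. openin E T \<and> x \<in> T \<and> T \<subseteq> W"
        by blast
    qed
  qed
  then have "E = seminorm_topology ?S ?P"
    by (simp only: topology_eq) blast
  then show ?thesis
    unfolding locally_convex_topology_def using S by blast
qed

lemma locally_convex_space_eq_0:
  assumes E: "locally_convex_space E" and x: "x \<in> topspace E"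
    and zero: "\<And>p. continuous_seminorm E p \<Longrightarrow> p x = 0"
  shows "x = 0"
proof (rule ccontr)
  assume "x \<noteq> 0"
  moreover have "0 \<in> topspace E" "Hausdorff_space E"
    using E by (auto simp: locally_convex_space_def subspace_0)
  ultimately obtain U where U: "openin E U" "0 \<in> U" "x \<notin> U"
    using x unfolding Hausdorff_space_def by (metis disjnt_iff)
  then obtain p where "continuous_seminorm E p" "{x \<in> topspace E. p x < 1} \<subseteq> U"
    using locally_convex_space_gauge[OF E] by blast
  with zero[of p] x U(3) show False
    by auto
qed

lemma locally_convex_topology_euclideanreal: "locally_convex_topology euclideanreal"
proof (rule locally_convex_space_topology)
  have "\<exists>V. open V \<and> 0 \<in> V \<and> convex V \<and> V \<subseteq> U" if "open U" "0 \<in> U" for U :: "real set"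
  proof -
    obtain e where "e > 0" "ball 0 e \<subseteq> U"
      using \<open>open U\<close> \<open>0 \<in> U\<close> by (meson openE)
    then show ?thesis
      by (intro exI[of _ "ball 0 e"]) auto
  qed
  moreover have "continuous_map (prod_topology euclideanreal euclideanreal) euclideanreal (\<lambda>(x, y). x + y :: real)"
    "continuous_map (prod_topology euclideanreal euclideanreal) euclideanreal (\<lambda>(x, y). x *\<^sub>R y :: real)"
    unfolding case_prod_beta real_scaleR_def
    by (intro continuous_map_add continuous_map_real_mult continuous_map_fst continuous_map_snd)+
  ultimately show "locally_convex_space euclideanreal"
    by (auto simp: locally_convex_space_def)
qed

lemma continuous_seminorm_abs: "continuous_seminorm euclideanreal (\<lambda>x. \<bar>x\<bar>)"
  by (auto simp: continuous_seminorm_def seminorm_on_def abs_mult intro!: continuous_intros)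

lemma continuous_seminorm_real:
  assumes "continuous_seminorm euclideanreal q"
  shows "q x = \<bar>x\<bar> * q 1" "q 1 \<ge> 0"
proof -
  have q: "seminorm_on UNIV q"
    using assms by (simp add: continuous_seminorm_def)
  then have "q (x *\<^sub>R 1) = \<bar>x\<bar> * q 1"
    unfolding seminorm_on_def by blast
  then show "q x = \<bar>x\<bar> * q 1"
    by simp
  show "q 1 \<ge> 0"
    using seminorm_on_nonneg[OF _ q] by simp
qed

locale sup_seminorms =
  fixes T :: "('i \<Rightarrow> 'b::real_vector) set" and V :: "'b set" and G :: "'i set \<Rightarrow> ('b \<Rightarrow> real) \<Rightarrow> bool"
    and X :: "('i \<Rightarrow> 'b) topology"
  assumes subspace: "subspace T" "subspace V"
    and G: "\<And>I q. G I q \<Longrightarrow> I \<noteq> {} \<and> seminorm_on V q"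
    and T: "\<And>I q H. G I q \<Longrightarrow> H \<in> T \<Longrightarrow> H ` I \<subseteq> V \<and> bdd_above ((\<lambda>i. q (H i)) ` I)"
    and X: "X = seminorm_topology T {\<lambda>H. SUP i\<in>I. q (H i) | I q. G I q}"
begin

lemma seminorm_on_SUP:
  assumes "G I q"
  shows "seminorm_on T (\<lambda>H. SUP i\<in>I. q (H i))"
  unfolding seminorm_on_def
proof (intro conjI ballI allI)
  have q: "I \<noteq> {}" "seminorm_on V q"
    using G[OF assms] by auto
  have V: "H i \<in> V" if "H \<in> T" "i \<in> I" for H i
    using T[OF assms that(1)] that(2) by auto
  have upper: "q (H i) \<le> (SUP i\<in>I. q (H i))" if "H \<in> T" "i \<in> I" for H i
    using T[OF assms that(1)] that(2) by (auto intro: cSUP_upper)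
  show "(SUP i\<in>I. q ((H + K) i)) \<le> (SUP i\<in>I. q (H i)) + (SUP i\<in>I. q (K i))"
    if "H \<in> T" "K \<in> T" for H K
  proof (rule cSUP_least[OF q(1)])
    fix i assume i: "i \<in> I"
    have "q (H i + K i) \<le> q (H i) + q (K i)"
      using q(2) V that i by (simp add: seminorm_on_def)
    with upper[OF that(1) i] upper[OF that(2) i]
    show "q ((H + K) i) \<le> (SUP i\<in>I. q (H i)) + (SUP i\<in>I. q (K i))"
      by simp
  qed
  show "(SUP i\<in>I. q ((c *\<^sub>R H) i)) = \<bar>c\<bar> * (SUP i\<in>I. q (H i))" if H: "H \<in> T" for H and c :: real
  proof -
    have eq: "q ((c *\<^sub>R H) i) = \<bar>c\<bar> * q (H i)" if "i \<in> I" for i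
      using q(2) V[OF H that] by (simp add: seminorm_on_def scaleR_fun_def)
    show ?thesis
    proof (cases "c = 0")
      case True
      then have "(SUP i\<in>I. q ((c *\<^sub>R H) i)) = (SUP i\<in>I. 0)"
        using eq by (intro SUP_cong) auto
      with True q(1) show ?thesis
        by simp
    next
      case False
      have "(SUP i\<in>I. q ((c *\<^sub>R H) i)) \<le> \<bar>c\<bar> * (SUP i\<in>I. q (H i))"
        using eq upper[OF H] by (intro cSUP_least[OF q(1)]) (auto intro: mult_left_mono)
      moreover have "(SUP i\<in>I. q (H i)) \<le> (SUP i\<in>I. q ((c *\<^sub>R H) i)) / \<bar>c\<bar>"
      proof (rule cSUP_least[OF q(1)])
        fix i assume i: "i \<in> I"
        have "q ((c *\<^sub>R H) i) \<le> (SUP i\<in>I. q ((c *\<^sub>R H) i))"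
          using upper[OF subspace_scale[OF subspace(1) H] i] .
        with False show "q (H i) \<le> (SUP i\<in>I. q ((c *\<^sub>R H) i)) / \<bar>c\<bar>"
          by (simp add: eq[OF i] field_simps)
      qed
      ultimately show ?thesis
        using False by (simp add: field_simps)
    qed
  qed
qed

lemma seminorms: "\<forall>p\<in>{\<lambda>H. SUP i\<in>I. q (H i) | I q. G I q}. seminorm_on T p"
  using seminorm_on_SUP by auto

lemma topspace_X [simp]: "topspace X = T"
  by (simp add: X)

lemma locally_convex_X: "locally_convex_topology X"
  unfolding X by (rule locally_convex_topology_seminorm_topology[OF subspace(1) seminorms])

lemma uniform_seminorm:
  assumes "G I q"
  obtains P where "continuous_seminorm X P" "\<And>H i. H \<in> T \<Longrightarrow> i \<in> I \<Longrightarrow> q (H i) \<le> P H"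
proof
  show "continuous_seminorm X (\<lambda>H. SUP i\<in>I. q (H i))"
    unfolding X
    by (rule continuous_seminorm_seminorm_topology[OF subspace(1) seminorms seminorm_on_SUP[OF assms],
          where Q = "{\<lambda>H. SUP i\<in>I. q (H i)}" and C = 1]) (use assms in auto)
  show "q (H i) \<le> (SUP i\<in>I. q (H i))" if "H \<in> T" "i \<in> I" for H i
    using T[OF assms that(1)] that(2) by (auto intro: cSUP_upper)
qed

lemma continuous_map_into:
  assumes E: "locally_convex_topology E" and A: "linear_betw A (topspace E) T"
    and le: "\<And>I q. G I q \<Longrightarrow> \<exists>p. continuous_seminorm E p \<and> (\<forall>x\<in>topspace E. \<forall>i\<in>I. q (A x i) \<le> p x)"
  shows "continuous_map E X A"
  unfolding X
proof (rule continuous_map_linear[OF E subspace(1) seminorms A], clarify)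
  fix I q assume G': "G I q"
  then obtain p where "continuous_seminorm E p" "\<forall>x\<in>topspace E. \<forall>i\<in>I. q (A x i) \<le> p x"
    using le by blast
  then show "\<exists>p. continuous_seminorm E p \<and> (\<forall>x\<in>topspace E. (SUP i\<in>I. q (A x i)) \<le> p x)"
    using G[OF G'] by (intro exI[of _ p]) (auto intro!: cSUP_least)
qed

lemma bounded_in_X:
  assumes B: "B \<subseteq> T" and bd: "\<And>I q. G I q \<Longrightarrow> \<exists>C. \<forall>H\<in>B. \<forall>i\<in>I. q (H i) \<le> C"
  shows "bounded_in X B"
  unfolding X
proof (rule bounded_in_seminorm_topology[OF subspace(1) seminorms B], clarify)
  fix I q assume G': "G I q"
  then obtain C where "\<forall>H\<in>B. \<forall>i\<in>I. q (H i) \<le> C"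
    using bd by blast
  then show "\<exists>C. \<forall>H\<in>B. (SUP i\<in>I. q (H i)) \<le> C"
    using G[OF G'] by (intro exI[of _ C]) (auto intro!: cSUP_least)
qed

end

lemma linear_betwD:
  assumes "linear_betw f S T"
  shows "x \<in> S \<Longrightarrow> f x \<in> T" "x \<in> S \<Longrightarrow> y \<in> S \<Longrightarrow> f (x + y) = f x + f y"
    "x \<in> S \<Longrightarrow> f (c *\<^sub>R x) = c *\<^sub>R f x"
  using assms by (auto simp: linear_betw_def)

lemma continuous_operatorsI:
  assumes "locally_convex_topology E" "locally_convex_topology F"
    and "linear_betw A (topspace E) (topspace F)" "\<And>x. x \<notin> topspace E \<Longrightarrow> A x = 0"
    and "\<And>q. continuous_seminorm F q \<Longrightarrow>
      \<exists>p. continuous_seminorm E p \<and> (\<forall>x\<in>topspace E. q (A x) \<le> p x)"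
  shows "A \<in> continuous_operators E F"
  using assms continuous_map_linear'[of E F A] by (simp add: continuous_operators_def)

lemma continuous_operatorsD:
  assumes "A \<in> continuous_operators E F"
  shows "linear_betw A (topspace E) (topspace F)" "continuous_map E F A"
    "\<And>x. x \<notin> topspace E \<Longrightarrow> A x = 0"
  using assms by (auto simp: continuous_operators_def)

lemma continuous_operators_seminorm:
  "A \<in> continuous_operators E F \<Longrightarrow> continuous_seminorm F q \<Longrightarrow> continuous_seminorm E (\<lambda>x. q (A x))"
  using continuous_seminorm_compose continuous_operatorsD by blast

lemma subspace_continuous_operators:
  assumes E: "locally_convex_topology E" and F: "locally_convex_topology F"
  shows "subspace (continuous_operators E F)"
proof -
  have S: "subspace (topspace E)" "subspace (topspace F)"
    using E F by (auto intro: locally_convex_topology_subspace)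
  have "(0 :: 'a \<Rightarrow> 'b) \<in> continuous_operators E F"
  proof (rule continuous_operatorsI[OF E F])
    show "linear_betw (0 :: 'a \<Rightarrow> 'b) (topspace E) (topspace F)"
      using S by (auto simp: linear_betw_def subspace_0)
    show "\<exists>p. continuous_seminorm E p \<and> (\<forall>x\<in>topspace E. q ((0 :: 'a \<Rightarrow> 'b) x) \<le> p x)"
      if "continuous_seminorm F q" for q
      using continuous_seminorm_zero seminorm_on_zero[OF S(2), of q] that
      by (intro exI[of _ "\<lambda>x. 0"]) (auto simp: continuous_seminorm_def)
  qed simp
  moreover have "A + B \<in> continuous_operators E F"
    if A: "A \<in> continuous_operators E F" and B: "B \<in> continuous_operators E F" for A B
  proof (rule continuous_operatorsI[OF E F])
    note l = continuous_operatorsD(1)[OF A] continuous_operatorsD(1)[OF B]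
    show "linear_betw (A + B) (topspace E) (topspace F)"
      unfolding linear_betw_def image_subset_iff
      using S by (simp add: linear_betwD[OF l(1)] linear_betwD[OF l(2)] subspace_add scaleR_add_right)
    show "\<exists>p. continuous_seminorm E p \<and> (\<forall>x\<in>topspace E. q ((A + B) x) \<le> p x)"
      if q: "continuous_seminorm F q" for q
    proof (intro exI conjI ballI)
      show "continuous_seminorm E (\<lambda>x. q (A x) + q (B x))"
        using continuous_seminorm_add[OF continuous_operators_seminorm[OF A q] continuous_operators_seminorm[OF B q]] .
      show "q ((A + B) x) \<le> q (A x) + q (B x)" if "x \<in> topspace E" for x
        using q linear_betwD(1)[OF l(1) that] linear_betwD(1)[OF l(2) that]
        by (simp add: continuous_seminorm_def seminorm_on_def)
    qed
  qed (use continuous_operatorsD(3)[OF A] continuous_operatorsD(3)[OF B] in auto)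
  moreover have "c *\<^sub>R A \<in> continuous_operators E F"
    if A: "A \<in> continuous_operators E F" for A c
  proof (rule continuous_operatorsI[OF E F])
    note l = continuous_operatorsD(1)[OF A]
    show "linear_betw (c *\<^sub>R A) (topspace E) (topspace F)"
      unfolding linear_betw_def image_subset_iff
      using S by (simp add: linear_betwD[OF l] subspace_scale scaleR_add_right scaleR_fun_def mult.commute)
    show "\<exists>p. continuous_seminorm E p \<and> (\<forall>x\<in>topspace E. q ((c *\<^sub>R A) x) \<le> p x)"
      if q: "continuous_seminorm F q" for q
    proof (intro exI conjI ballI)
      show "continuous_seminorm E (\<lambda>x. \<bar>c\<bar> * q (A x))"
        using continuous_seminorm_cmult[OF continuous_operators_seminorm[OF A q], of "\<bar>c\<bar>"] by simp
      show "q ((c *\<^sub>R A) x) \<le> \<bar>c\<bar> * q (A x)" if "x \<in> topspace E" for x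
        using q linear_betwD(1)[OF l that]
        by (simp add: continuous_seminorm_def seminorm_on_def scaleR_fun_def)
    qed
  qed (use continuous_operatorsD(3)[OF A] in \<open>auto simp: scaleR_fun_def\<close>)
  ultimately show ?thesis
    by (simp add: subspace_def)
qed

lemma bounded_in_continuous_image:
  assumes E: "locally_convex_topology E" and F: "locally_convex_topology F"
    and A: "A \<in> continuous_operators E F" and B: "bounded_in E B"
  shows "bounded_in F (A ` B)"
  unfolding bounded_in_iff[OF F]
proof (intro conjI allI impI)
  show "A ` B \<subseteq> topspace F"
    using B linear_betwD(1)[OF continuous_operatorsD(1)[OF A]] by (auto simp: bounded_in_def)
  show "\<exists>C. \<forall>x\<in>A ` B. q x \<le> C" if "continuous_seminorm F q" for q
    using B continuous_operators_seminorm[OF A that] by (auto simp: bounded_in_iff[OF E])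
qed

lemma bounded_in_singleton:
  "locally_convex_topology E \<Longrightarrow> x \<in> topspace E \<Longrightarrow> bounded_in E {x}"
  by (auto simp: bounded_in_iff)

section \<open>Spaces of operators and strong duals\<close>

abbreviation dual :: "'a::real_vector topology \<Rightarrow> ('a \<Rightarrow> real) set" where
  "dual E \<equiv> continuous_operators E euclideanreal"

lemma topspace_Lb [simp]: "topspace (Lb E F) = continuous_operators E F"
  by (simp add: Lb_def)

lemma topspace_strong_dual [simp]: "topspace (strong_dual E) = dual E"
  by (simp add: strong_dual_def)

lemma sup_seminorms_Lb:
  assumes E: "locally_convex_topology E" and F: "locally_convex_topology F"
  shows "sup_seminorms (continuous_operators E F) (topspace F)
    (\<lambda>B q. bounded_in E B \<and> B \<noteq> {} \<and> continuous_seminorm F q) (Lb E F)"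
proof
  fix B q A assume *: "bounded_in E B \<and> B \<noteq> {} \<and> continuous_seminorm F q"
    and A: "A \<in> continuous_operators E F"
  then have "bounded_in F (A ` B)"
    using bounded_in_continuous_image[OF E F A] by blast
  then have "A ` B \<subseteq> topspace F" "\<exists>C. \<forall>x\<in>A ` B. q x \<le> C"
    using * unfolding bounded_in_iff[OF F] by blast+
  then show "A ` B \<subseteq> topspace F \<and> bdd_above ((\<lambda>x. q (A x)) ` B)"
    by (auto simp: bdd_above_def)
qed (use subspace_continuous_operators[OF E F] locally_convex_topology_subspace[OF F]
    in \<open>auto simp: Lb_def continuous_seminorm_def\<close>)

lemma locally_convex_topology_Lb:
  "locally_convex_topology E \<Longrightarrow> locally_convex_topology F \<Longrightarrow> locally_convex_topology (Lb E F)"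
  by (rule sup_seminorms.locally_convex_X[OF sup_seminorms_Lb])

lemma Lb_uniform_seminorm:
  assumes E: "locally_convex_topology E" and F: "locally_convex_topology F"
    and B: "bounded_in E B" and q: "continuous_seminorm F q"
  obtains P where "continuous_seminorm (Lb E F) P"
    "\<And>A x. A \<in> continuous_operators E F \<Longrightarrow> x \<in> B \<Longrightarrow> q (A x) \<le> P A"
proof (cases "B = {}")
  case True
  then show thesis
    using that[OF continuous_seminorm_zero] by blast
next
  case False
  with B q have "bounded_in E B \<and> B \<noteq> {} \<and> continuous_seminorm F q"
    by blast
  from sup_seminorms.uniform_seminorm[OF sup_seminorms_Lb[OF E F] this] show thesis
    using that by blast
qed

lemma Lb_continuous_operatorsI:
  assumes X: "locally_convex_topology X" and E: "locally_convex_topology E" and F: "locally_convex_topology F"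
    and A: "linear_betw A (topspace X) (continuous_operators E F)" "\<And>x. x \<notin> topspace X \<Longrightarrow> A x = 0"
    and le: "\<And>B q. bounded_in E B \<Longrightarrow> continuous_seminorm F q \<Longrightarrow>
      \<exists>p. continuous_seminorm X p \<and> (\<forall>x\<in>topspace X. \<forall>e\<in>B. q (A x e) \<le> p x)"
  shows "A \<in> continuous_operators X (Lb E F)"
proof -
  have "continuous_map X (Lb E F) A"
    by (rule sup_seminorms.continuous_map_into[OF sup_seminorms_Lb[OF E F] X A(1)]) (use le in blast)
  with A show ?thesis
    by (simp add: continuous_operators_def)
qed

lemma locally_convex_topology_strong_dual:
  "locally_convex_topology E \<Longrightarrow> locally_convex_topology (strong_dual E)"
  unfolding strong_dual_def by (intro locally_convex_topology_Lb locally_convex_topology_euclideanreal)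

lemma dualI:
  assumes E: "locally_convex_topology E" and f: "linear_betw f (topspace E) UNIV"
    and "\<And>x. x \<notin> topspace E \<Longrightarrow> f x = 0"
    and p: "continuous_seminorm E p" and le: "\<And>x. x \<in> topspace E \<Longrightarrow> \<bar>f x\<bar> \<le> p x"
  shows "f \<in> dual E"
proof (rule continuous_operatorsI[OF E locally_convex_topology_euclideanreal])
  show "\<exists>p. continuous_seminorm E p \<and> (\<forall>x\<in>topspace E. q (f x) \<le> p x)"
    if q: "continuous_seminorm euclideanreal q" for q
  proof (intro exI conjI ballI)
    show "continuous_seminorm E (\<lambda>x. q 1 * p x)"
      using p continuous_seminorm_real(2)[OF q] by (rule continuous_seminorm_cmult)
    show "q (f x) \<le> q 1 * p x" if "x \<in> topspace E" for x
      using le[OF that] continuous_seminorm_real[OF q]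
      by (metis mult.commute mult_left_mono)
  qed
qed (use assms in auto)

lemma dual_linear: "f \<in> dual E \<Longrightarrow> linear_betw f (topspace E) UNIV"
  using continuous_operatorsD(1) by fastforce

lemma dual_seminorm: "f \<in> dual E \<Longrightarrow> continuous_seminorm E (\<lambda>x. \<bar>f x\<bar>)"
  using continuous_operators_seminorm[OF _ continuous_seminorm_abs] .

lemma dual_bounded:
  assumes E: "locally_convex_topology E" and f: "f \<in> dual E" and B: "bounded_in E B"
  shows "\<exists>C. \<forall>x\<in>B. \<bar>f x\<bar> \<le> C"
  using B dual_seminorm[OF f] unfolding bounded_in_iff[OF E] by blast

lemma bounded_in_strong_dual:
  assumes E: "locally_convex_topology E" and B: "B \<subseteq> dual E"
    and bd: "\<And>D. bounded_in E D \<Longrightarrow> \<exists>C. \<forall>f\<in>B. \<forall>x\<in>D. \<bar>f x\<bar> \<le> C"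
  shows "bounded_in (strong_dual E) B"
  unfolding strong_dual_def
proof (rule sup_seminorms.bounded_in_X[OF sup_seminorms_Lb[OF E locally_convex_topology_euclideanreal] B])
  fix D q assume *: "bounded_in E D \<and> D \<noteq> {} \<and> continuous_seminorm euclideanreal q"
  then obtain C where "\<forall>f\<in>B. \<forall>x\<in>D. \<bar>f x\<bar> \<le> C"
    using bd by blast
  moreover have "q x = \<bar>x\<bar> * q 1" "q 1 \<ge> 0" for x
    using * continuous_seminorm_real by blast+
  ultimately show "\<exists>C. \<forall>f\<in>B. \<forall>x\<in>D. q (f x) \<le> C"
    by (intro exI[of _ "C * q 1"]) (metis mult_right_mono)
qed

lemma strong_dual_uniform_seminorm:
  assumes E: "locally_convex_topology E" and B: "bounded_in E B"
  shows "\<exists>P. continuous_seminorm (strong_dual E) P \<and> (\<forall>f\<in>dual E. \<forall>x\<in>B. \<bar>f x\<bar> \<le> P f)"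
  unfolding strong_dual_def
  by (rule Lb_uniform_seminorm[OF E locally_convex_topology_euclideanreal B continuous_seminorm_abs]) auto

lemma bounded_in_strong_dual_bound:
  assumes E: "locally_convex_topology E" and B: "bounded_in (strong_dual E) B" and D: "bounded_in E D"
  shows "\<exists>C. \<forall>f\<in>B. \<forall>x\<in>D. \<bar>f x\<bar> \<le> C"
proof -
  obtain P where P: "continuous_seminorm (strong_dual E) P"
    "\<forall>f\<in>dual E. \<forall>x\<in>D. \<bar>f x\<bar> \<le> P f"
    using strong_dual_uniform_seminorm[OF E D] by blast
  obtain C where "\<forall>f\<in>B. P f \<le> C" "B \<subseteq> dual E"
    using B P(1) unfolding bounded_in_iff[OF locally_convex_topology_strong_dual[OF E]] by auto
  then have "\<forall>f\<in>B. \<forall>x\<in>D. \<bar>f x\<bar> \<le> C"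
    using P(2) order_trans[of "\<bar>_\<bar>" "P _" C] by blast
  then show ?thesis
    by blast
qed

lemma equicontinuous_bounded:
  assumes E: "locally_convex_topology E" and p: "continuous_seminorm E p"
    and B: "B \<subseteq> dual E" "\<And>f x. f \<in> B \<Longrightarrow> x \<in> topspace E \<Longrightarrow> \<bar>f x\<bar> \<le> p x"
  shows "bounded_in (strong_dual E) B"
proof (rule bounded_in_strong_dual[OF E B(1)])
  fix D assume "bounded_in E D"
  then obtain C where "\<forall>x\<in>D. p x \<le> C" "D \<subseteq> topspace E"
    using p unfolding bounded_in_iff[OF E] by blast
  then have "\<forall>f\<in>B. \<forall>x\<in>D. \<bar>f x\<bar> \<le> C"
    using B(2) order_trans[of "\<bar>_\<bar>" "p _" C] by blast
  then show "\<exists>C. \<forall>f\<in>B. \<forall>x\<in>D. \<bar>f x\<bar> \<le> C"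
    by blast
qed

lemma evaluation_mem_bidual:
  assumes E: "locally_convex_topology E" and x: "x \<in> topspace E"
  shows "(\<lambda>f. if f \<in> dual E then f x else 0) \<in> dual (strong_dual E)"
proof -
  obtain P where P: "continuous_seminorm (strong_dual E) P" "\<forall>f\<in>dual E. \<bar>f x\<bar> \<le> P f"
    using strong_dual_uniform_seminorm[OF E bounded_in_singleton[OF E x]] by blast
  have S: "subspace (dual E)"
    using subspace_continuous_operators[OF E locally_convex_topology_euclideanreal] .
  show ?thesis
    by (rule dualI[OF locally_convex_topology_strong_dual[OF E] _ _ P(1)])
       (use S P(2) in \<open>auto simp: linear_betw_def subspace_add subspace_scale\<close>, simp add: scaleR_fun_def)
qed

section \<open>Barrelled and bornological spaces\<close>

lemma absolutely_convex_seminorms: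
  assumes S: "subspace S" and r: "\<And>i. i \<in> I \<Longrightarrow> seminorm_on S (r i)"
  shows "absolutely_convex {x \<in> S. \<forall>i\<in>I. r i x \<le> 1}"
  unfolding absolutely_convex_def convex_alt
proof (intro conjI ballI allI impI)
  fix x y and u :: real
  assume x: "x \<in> {x \<in> S. \<forall>i\<in>I. r i x \<le> 1}" and y: "y \<in> {x \<in> S. \<forall>i\<in>I. r i x \<le> 1}"
    and u: "0 \<le> u \<and> u \<le> 1"
  have "r i ((1 - u) *\<^sub>R x + u *\<^sub>R y) \<le> 1" if i: "i \<in> I" for i
  proof -
    have "(1 - u) *\<^sub>R x \<in> S" "u *\<^sub>R y \<in> S"
      using x y subspace_scale[OF S] by auto
    then have "r i ((1 - u) *\<^sub>R x + u *\<^sub>R y) \<le> r i ((1 - u) *\<^sub>R x) + r i (u *\<^sub>R y)"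
      using r[OF i] unfolding seminorm_on_def by blast
    also have "\<dots> = (1 - u) * r i x + u * r i y"
      using r[OF i] x y u by (simp add: seminorm_on_def)
    also have "\<dots> \<le> (1 - u) * 1 + u * 1"
      using x y u i by (intro add_mono mult_left_mono) auto
    finally show ?thesis by simp
  qed
  then show "(1 - u) *\<^sub>R x + u *\<^sub>R y \<in> {x \<in> S. \<forall>i\<in>I. r i x \<le> 1}"
    using x y by (simp add: subspace_add[OF S] subspace_scale[OF S])
next
  fix x and c :: real
  assume x: "x \<in> {x \<in> S. \<forall>i\<in>I. r i x \<le> 1}" and c: "\<bar>c\<bar> \<le> 1"
  have "r i (c *\<^sub>R x) \<le> 1" if "i \<in> I" for i
    using r[OF that] x c that seminorm_on_nonneg[OF S r[OF that], of x]
    by (auto simp: seminorm_on_def intro: mult_le_one)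
  then show "c *\<^sub>R x \<in> {x \<in> S. \<forall>i\<in>I. r i x \<le> 1}"
    using x by (simp add: subspace_scale[OF S])
qed

lemma absorbs_seminorms:
  assumes S: "subspace S" and r: "\<And>i. i \<in> I \<Longrightarrow> seminorm_on S (r i)"
    and B: "B \<subseteq> S" "\<And>i x. i \<in> I \<Longrightarrow> x \<in> B \<Longrightarrow> r i x \<le> C"
  shows "absorbs {x \<in> S. \<forall>i\<in>I. r i x \<le> 1} B"
  unfolding absorbs_def
proof (intro exI[of _ "\<bar>C\<bar> + 1"] conjI allI impI subsetI)
  fix s x assume s: "\<bar>s\<bar> \<ge> \<bar>C\<bar> + 1" and x: "x \<in> B"
  have xS: "x \<in> S"
    using x B by auto
  have "r i ((1/s) *\<^sub>R x) \<le> 1" if "i \<in> I" for i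
  proof -
    have "r i ((1/s) *\<^sub>R x) = r i x / \<bar>s\<bar>"
      using r[OF that] xS by (simp add: seminorm_on_def)
    also have "\<dots> \<le> 1"
      using B(2)[OF that x] s by (auto simp: field_simps)
    finally show ?thesis .
  qed
  then have "(1/s) *\<^sub>R x \<in> {x \<in> S. \<forall>i\<in>I. r i x \<le> 1}"
    using subspace_scale[OF S xS] by simp
  moreover have "x = s *\<^sub>R ((1/s) *\<^sub>R x)"
    using s by auto
  ultimately show "x \<in> (\<lambda>x. s *\<^sub>R x) ` {x \<in> S. \<forall>i\<in>I. r i x \<le> 1}"
    by blast
qed auto

lemma zero_nhd_seminorms:
  assumes E: "locally_convex_topology E" and r: "\<And>i. i \<in> I \<Longrightarrow> seminorm_on (topspace E) (r i)"
    and nhd: "zero_nhd E {x \<in> topspace E. \<forall>i\<in>I. r i x \<le> 1}"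
  shows "\<exists>p. continuous_seminorm E p \<and> (\<forall>i\<in>I. \<forall>x\<in>topspace E. r i x \<le> p x)"
proof -
  have S: "subspace (topspace E)"
    using E by (rule locally_convex_topology_subspace)
  obtain p where p: "continuous_seminorm E p"
    "{x \<in> topspace E. p x < 1} \<subseteq> {x \<in> topspace E. \<forall>i\<in>I. r i x \<le> 1}"
    using nhd unfolding zero_nhd_iff[OF E] by blast
  have "r i x \<le> p x" if "i \<in> I" "x \<in> topspace E" for i x
    by (rule seminorm_on_le_cong[OF S _ r[OF that(1)] _ that(2)])
       (use p that(1) in \<open>auto simp: continuous_seminorm_def\<close>)
  with p(1) show ?thesis
    by blast
qed

lemma barrelled_equicontinuous:
  assumes E: "locally_convex_topology E" "barrelled E" and B: "B \<subseteq> dual E"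
    and bd: "\<And>x. x \<in> topspace E \<Longrightarrow> \<exists>C. \<forall>f\<in>B. \<bar>f x\<bar> \<le> C"
  shows "\<exists>p. continuous_seminorm E p \<and> (\<forall>f\<in>B. \<forall>x\<in>topspace E. \<bar>f x\<bar> \<le> p x)"
proof (rule zero_nhd_seminorms[OF E(1)])
  have S: "subspace (topspace E)"
    using E(1) by (rule locally_convex_topology_subspace)
  let ?D = "{x \<in> topspace E. \<forall>f\<in>B. \<bar>f x\<bar> \<le> 1}"
  show r: "seminorm_on (topspace E) (\<lambda>x. \<bar>f x\<bar>)" if "f \<in> B" for f
    using that B by (auto intro!: seminorm_on_abs_linear dual_linear)
  have "closedin E {x \<in> topspace E. \<bar>f x\<bar> \<in> {..1}}" if "f \<in> B" for f
    using dual_seminorm[of f E] that B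
    by (intro closedin_continuous_map_preimage[of E euclideanreal]) (auto simp: continuous_seminorm_def)
  then have "closedin E (\<Inter>(insert (topspace E) ((\<lambda>f. {x \<in> topspace E. \<bar>f x\<bar> \<in> {..1}}) ` B)))"
    by (intro closedin_Inter) auto
  also have "\<Inter>(insert (topspace E) ((\<lambda>f. {x \<in> topspace E. \<bar>f x\<bar> \<in> {..1}}) ` B)) = ?D"
    by auto
  finally have "closedin E ?D" .
  moreover have "absolutely_convex ?D"
    using absolutely_convex_seminorms[OF S r] .
  moreover have "absorbs ?D {x}" if x: "x \<in> topspace E" for x
  proof -
    obtain C where "\<forall>f\<in>B. \<bar>f x\<bar> \<le> C"
      using bd x by blast
    then show ?thesis
      using x by (intro absorbs_seminorms[OF S r, where C = C]) auto
  qed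
  ultimately show "zero_nhd E ?D"
    using E(2) unfolding barrelled_def by blast
qed

lemma strongly_bounded_equicontinuous:
  assumes \<Phi>: "locally_convex_topology \<Phi>" "barrelled \<Phi>" and B: "bounded_in (strong_dual \<Phi>) B"
  shows "\<exists>p. continuous_seminorm \<Phi> p \<and> (\<forall>f\<in>B. \<forall>x\<in>topspace \<Phi>. \<bar>f x\<bar> \<le> p x)"
proof (rule barrelled_equicontinuous[OF \<Phi>])
  show "B \<subseteq> dual \<Phi>"
    using B by (simp add: bounded_in_def)
  show "\<exists>C. \<forall>f\<in>B. \<bar>f x\<bar> \<le> C" if "x \<in> topspace \<Phi>" for x
    using bounded_in_strong_dual_bound[OF \<Phi>(1) B bounded_in_singleton[OF \<Phi>(1) that]] by simp
qed

lemma bornological_equicontinuous: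
  assumes E: "locally_convex_topology E" "bornological E"
    and r: "\<And>i. i \<in> I \<Longrightarrow> seminorm_on (topspace E) (r i)"
    and bd: "\<And>B. bounded_in E B \<Longrightarrow> \<exists>C. \<forall>i\<in>I. \<forall>x\<in>B. r i x \<le> C"
  shows "\<exists>p. continuous_seminorm E p \<and> (\<forall>i\<in>I. \<forall>x\<in>topspace E. r i x \<le> p x)"
proof (rule zero_nhd_seminorms[OF E(1) r])
  have S: "subspace (topspace E)"
    using E(1) by (rule locally_convex_topology_subspace)
  let ?D = "{x \<in> topspace E. \<forall>i\<in>I. r i x \<le> 1}"
  have "absorbs ?D B" if B: "bounded_in E B" for B
  proof -
    obtain C where "\<forall>i\<in>I. \<forall>x\<in>B. r i x \<le> C"
      using bd B by blast
    then show ?thesis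
      using B by (intro absorbs_seminorms[OF S r, where C = C]) (auto simp: bounded_in_def)
  qed
  moreover have "absolutely_convex ?D"
    by (rule absolutely_convex_seminorms[OF S r])
  moreover have "?D \<subseteq> topspace E"
    by auto
  ultimately show "zero_nhd E ?D"
    using E(2) unfolding bornological_def by blast
qed

section \<open>Functionals on nuclear spaces\<close>

lemma dual_series:
  assumes E: "locally_convex_topology E" and q: "continuous_seminorm E q"
    and g: "\<forall>n. linear_betw (g n) (topspace E) UNIV"
    and le: "\<forall>n. \<forall>x\<in>topspace E. \<bar>g n x\<bar> \<le> w n * q x"
    and w: "\<forall>n::nat. 0 \<le> w n" "summable w"
  defines "s \<equiv> (\<lambda>x. if x \<in> topspace E then \<Sum>n. g n x else 0 :: real)"
  shows "s \<in> dual E" "x \<in> topspace E \<Longrightarrow> \<bar>s x\<bar> \<le> suminf w * q x"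
    "x \<in> topspace E \<Longrightarrow> summable (\<lambda>n. \<bar>g n x\<bar>)"
proof -
  have S: "subspace (topspace E)"
    using E by (rule locally_convex_topology_subspace)
  have sw: "summable (\<lambda>n. w n * q x)" for x
    using w(2) by (rule summable_mult2)
  show sum_abs: "summable (\<lambda>n. \<bar>g n x\<bar>)" if "x \<in> topspace E" for x
    using le that by (intro summable_comparison_test'[OF sw[of x]]) auto
  have sum: "summable (\<lambda>n. g n x)" if "x \<in> topspace E" for x
    by (rule summable_rabs_cancel[OF sum_abs[OF that]])
  show bound: "\<bar>s x\<bar> \<le> suminf w * q x" if x: "x \<in> topspace E" for x
  proof -
    have "\<bar>s x\<bar> \<le> (\<Sum>n. \<bar>g n x\<bar>)"
      using summable_rabs[OF sum_abs[OF x]] x by (simp add: s_def)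
    also have "\<dots> \<le> (\<Sum>n. w n * q x)"
      using le x by (intro suminf_le sum_abs[OF x] sw) auto
    also have "\<dots> = suminf w * q x"
      using suminf_mult2[OF w(2)] by simp
    finally show ?thesis .
  qed
  show "s \<in> dual E"
  proof (rule dualI[OF E])
    show "linear_betw s (topspace E) UNIV"
      unfolding linear_betw_def
    proof (intro conjI ballI allI)
      fix x y assume xy: "x \<in> topspace E" "y \<in> topspace E"
      have "g n (x + y) = g n x + g n y" for n
        using g xy by (simp add: linear_betw_def)
      then show "s (x + y) = s x + s y"
        using xy subspace_add[OF S] by (simp add: s_def suminf_add[OF sum sum])
    next
      fix x and c :: real assume x: "x \<in> topspace E"
      have "g n (c *\<^sub>R x) = c * g n x" for n
        using g x by (simp add: linear_betw_def)
      then show "s (c *\<^sub>R x) = c *\<^sub>R s x"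
        using x subspace_scale[OF S] by (simp add: s_def suminf_mult[OF sum])
    qed (use S in auto)
    show "continuous_seminorm E (\<lambda>x. suminf w * q x)"
      using q w by (intro continuous_seminorm_cmult suminf_nonneg) auto
  qed (use bound in \<open>auto simp: s_def\<close>)
qed

lemma nuclear_expansion:
  assumes E: "locally_convex_topology E" "nuclear_space E" and p: "continuous_seminorm E p"
  obtains q f y a where "continuous_seminorm E q"
    "\<And>n::nat. f n \<in> dual E" "\<And>n. y n \<in> topspace E" "\<And>n. 0 \<le> a n"
    "\<And>n x. x \<in> topspace E \<Longrightarrow> \<bar>f n x\<bar> \<le> a n * q x"
    "summable (\<lambda>n. a n * p (y n))"
    "\<And>x. x \<in> topspace E \<Longrightarrow> (\<lambda>N. p (x - (\<Sum>n<N. f n x *\<^sub>R y n))) \<longlonglongrightarrow> 0"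
proof -
  have S: "subspace (topspace E)"
    using E(1) by (rule locally_convex_topology_subspace)
  obtain q where q: "continuous_seminorm E q"
    and nuc: "nuclear_operator (topspace E) q (topspace E) p (\<lambda>x. x)"
    using E(2) p unfolding nuclear_space_def by blast
  obtain f y a where f: "\<forall>n::nat. linear_betw (f n) (topspace E) (UNIV :: real set) \<and> y n \<in> topspace E \<and>
      a n \<ge> 0 \<and> (\<forall>x\<in>topspace E. \<bar>f n x\<bar> \<le> a n * q x)"
    and sm: "summable (\<lambda>n. a n * p (y n))"
    and lim: "\<forall>x\<in>topspace E. (\<lambda>N. p (x - (\<Sum>n<N. f n x *\<^sub>R y n))) \<longlonglongrightarrow> 0"
    using nuc unfolding nuclear_operator_def by blast
  define g where "g n x = (if x \<in> topspace E then f n x else 0)" for n x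
  have "g n \<in> dual E" for n
  proof (rule dualI[OF E(1)])
    show "linear_betw (g n) (topspace E) UNIV"
      using f S by (auto simp: linear_betw_def g_def subspace_add subspace_scale)
    show "continuous_seminorm E (\<lambda>x. a n * q x)"
      using f by (intro continuous_seminorm_cmult q) auto
  qed (use f in \<open>auto simp: g_def\<close>)
  moreover have "(\<lambda>N. p (x - (\<Sum>n<N. g n x *\<^sub>R y n))) \<longlonglongrightarrow> 0" if "x \<in> topspace E" for x
    using lim that by (simp add: g_def)
  ultimately show thesis
    using that[of q g y a] q f sm by (simp add: g_def)
qed

text \<open>
  This replaces the Hahn-Banach theorem: the functional attached to \<open>x\<close> is the nuclear expansion
  with the signs of its coefficients at \<open>x\<close>.
\<close>

lemma nuclear_norming:
  assumes E: "locally_convex_topology E" "nuclear_space E" and p: "continuous_seminorm E p"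
  obtains q where "continuous_seminorm E q"
    "\<And>x. x \<in> topspace E \<Longrightarrow> \<exists>g\<in>dual E. (\<forall>u\<in>topspace E. \<bar>g u\<bar> \<le> q u) \<and> p x \<le> \<bar>g x\<bar>"
proof -
  have S: "subspace (topspace E)" and pS: "seminorm_on (topspace E) p"
    using E(1) p by (auto intro: locally_convex_topology_subspace simp: continuous_seminorm_def)
  obtain q f y a where q: "continuous_seminorm E q"
    and f: "\<And>n::nat. f n \<in> dual E" and y: "\<And>n. y n \<in> topspace E" and a: "\<And>n. 0 \<le> a n"
    and fq: "\<And>n x. x \<in> topspace E \<Longrightarrow> \<bar>f n x\<bar> \<le> a n * q x"
    and sm: "summable (\<lambda>n. a n * p (y n))"
    and lim: "\<And>x. x \<in> topspace E \<Longrightarrow> (\<lambda>N. p (x - (\<Sum>n<N. f n x *\<^sub>R y n))) \<longlonglongrightarrow> 0"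
    using nuclear_expansion[OF E p] by blast
  have py: "0 \<le> p (y n)" for n
    using seminorm_on_nonneg[OF S pS y] .
  show thesis
  proof
    show "continuous_seminorm E (\<lambda>x. (\<Sum>n. a n * p (y n)) * q x)"
      using sm a py by (intro continuous_seminorm_cmult[OF q] suminf_nonneg) auto
    fix x assume x: "x \<in> topspace E"
    define g where "g n u = (sgn (f n x) * p (y n)) * f n u" for n u
    define G where "G u = (if u \<in> topspace E then \<Sum>n. g n u else 0)" for u
    have lin: "\<forall>n. linear_betw (g n) (topspace E) UNIV"
      using dual_linear[OF f] by (auto simp: linear_betw_def g_def algebra_simps)
    have le: "\<bar>g n u\<bar> \<le> (a n * p (y n)) * q u" if "u \<in> topspace E" for n u
    proof -
      have "\<bar>g n u\<bar> \<le> p (y n) * \<bar>f n u\<bar>"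
        using py[of n] by (simp add: g_def abs_mult abs_sgn_eq mult_left_mono)
      also have "\<dots> \<le> p (y n) * (a n * q u)"
        using fq[OF that] py by (intro mult_left_mono) auto
      finally show ?thesis by (simp add: algebra_simps)
    qed
    have le': "\<forall>n. \<forall>u\<in>topspace E. \<bar>g n u\<bar> \<le> (a n * p (y n)) * q u"
      using le by blast
    have nn: "\<forall>n. 0 \<le> a n * p (y n)"
      using a py by simp
    note G = dual_series[OF E(1) q lin le' nn sm]
    have gx: "g n x = \<bar>f n x\<bar> * p (y n)" for n
      by (simp add: g_def algebra_simps flip: abs_sgn)
    have "p x \<le> (\<Sum>n. g n x)"
    proof (rule LIMSEQ_le_const)
      show "(\<lambda>N. p (x - (\<Sum>n<N. f n x *\<^sub>R y n)) + (\<Sum>n<N. g n x)) \<longlonglongrightarrow> (\<Sum>n. g n x)"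
        using tendsto_add[OF lim[OF x] summable_LIMSEQ[OF summable_rabs_cancel[OF G(3)[OF x]]]] by simp
      have "p x \<le> p (x - (\<Sum>n<N. f n x *\<^sub>R y n)) + (\<Sum>n<N. g n x)" for N
      proof -
        have "p x \<le> p (x - (\<Sum>n<N. f n x *\<^sub>R y n)) + p (\<Sum>n<N. f n x *\<^sub>R y n)"
          using seminorm_on_triangle[OF S pS x subspace_sum[OF S subspace_scale[OF S y]] subspace_0[OF S]]
          by simp
        also have "p (\<Sum>n<N. f n x *\<^sub>R y n) \<le> (\<Sum>n<N. g n x)"
          using seminorm_on_sum_le[OF S pS y] by (simp add: gx)
        finally show ?thesis by simp
      qed
      then show "\<exists>N. \<forall>n\<ge>N. p x \<le> p (x - (\<Sum>n<n. f n x *\<^sub>R y n)) + (\<Sum>n<n. g n x)"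
        by blast
    qed
    then have "p x \<le> \<bar>G x\<bar>"
      using x by (simp add: G_def)
    moreover have "G \<in> dual E" "\<bar>G u\<bar> \<le> (\<Sum>n. a n * p (y n)) * q u" if "u \<in> topspace E" for u
      using G(1) G(2)[OF that] that by (simp_all add: G_def[abs_def])
    ultimately show "\<exists>g\<in>dual E. (\<forall>u\<in>topspace E. \<bar>g u\<bar> \<le> (\<Sum>n. a n * p (y n)) * q u) \<and> p x \<le> \<bar>g x\<bar>"
      using x by blast
  qed
qed

lemma nuclear_dual_separates:
  assumes E: "locally_convex_space E" "nuclear_space E" and x: "x \<in> topspace E" "y \<in> topspace E"
    and eq: "\<And>f. f \<in> dual E \<Longrightarrow> f x = f y"
  shows "x = y"
proof -
  have lct: "locally_convex_topology E"
    using E(1) by (rule locally_convex_space_topology)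
  have S: "subspace (topspace E)"
    using lct by (rule locally_convex_topology_subspace)
  have xy: "x - y \<in> topspace E"
    using S x by (rule subspace_diff)
  have "p (x - y) = 0" if p: "continuous_seminorm E p" for p
  proof -
    obtain g where g: "g \<in> dual E" "p (x - y) \<le> \<bar>g (x - y)\<bar>"
      using nuclear_norming[OF lct E(2) p] xy by metis
    then have "p (x - y) \<le> 0"
      using linear_betw_diff[OF dual_linear[OF g(1)] x] eq[OF g(1)] by simp
    moreover have "0 \<le> p (x - y)"
      using seminorm_on_nonneg[OF S _ xy] p by (simp add: continuous_seminorm_def)
    ultimately show ?thesis by simp
  qed
  then have "x - y = 0"
    using locally_convex_space_eq_0[OF E(1) xy] by blast
  then show ?thesis by simp
qed

section \<open>Uniform boundedness\<close>

fun hump_coeff :: "(nat \<Rightarrow> nat \<Rightarrow> real) \<Rightarrow> nat \<Rightarrow> real" where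
  "hump_coeff b n = (1/3)^n * (if 0 \<le> (\<Sum>k<n. hump_coeff b k * b n k) * b n n then 1 else -1)"

declare hump_coeff.simps [simp del]

lemma abs_hump_coeff: "\<bar>hump_coeff b n\<bar> = (1/3)^n"
  by (subst hump_coeff.simps) (simp add: abs_mult)

lemma hump_coeff_partial_sum: "(1/3)^n * \<bar>b n n\<bar> \<le> \<bar>\<Sum>k<Suc n. hump_coeff b k * b n k\<bar>"
proof -
  let ?s = "\<Sum>k<n. hump_coeff b k * b n k" and ?t = "hump_coeff b n * b n n"
  have t: "?t = (1/3)^n * (if 0 \<le> ?s * b n n then 1 else -1) * b n n"
    by (simp only: hump_coeff.simps[of b n])
  have "0 \<le> ?s * ?t"
  proof (cases "0 \<le> ?s * b n n")
    case True
    then have "0 \<le> (1/3)^n * (?s * b n n)"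
      by (rule mult_nonneg_nonneg[rotated]) simp
    also have "\<dots> = ?s * ?t"
      using True by (subst t) simp
    finally show ?thesis .
  next
    case False
    then have "0 \<le> - (?s * b n n)"
      by simp
    then have "0 \<le> (1/3)^n * - (?s * b n n)"
      by (rule mult_nonneg_nonneg[rotated]) simp
    also have "\<dots> = ?s * ?t"
      using False by (subst t) simp
    finally show ?thesis .
  qed
  moreover have "\<bar>t\<bar> \<le> \<bar>s + t\<bar>" if "0 \<le> s * t" for s t :: real
    using that by (auto simp: zero_le_mult_iff)
  ultimately have "\<bar>?t\<bar> \<le> \<bar>?s + ?t\<bar>"
    by blast
  then show ?thesis
    by (simp add: abs_mult abs_hump_coeff)
qed

text \<open>
  The gliding hump argument, stated for the array of values \<open>h i c\<close> so that it applies both to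
  functionals \<open>i\<close> at points \<open>c\<close> and to points \<open>i\<close> tested by functionals \<open>c\<close>.
\<close>

lemma gliding_hump:
  fixes h :: "'i \<Rightarrow> 'c \<Rightarrow> real"
  assumes pt: "\<And>i. i \<in> I \<Longrightarrow> \<exists>K. \<forall>c\<in>C. \<bar>h i c\<bar> \<le> K"
    and ser: "\<And>a c. (\<And>n. c n \<in> C) \<Longrightarrow> (\<And>n. \<bar>a n\<bar> \<le> (1/3)^n) \<Longrightarrow>
      \<exists>K. \<forall>i\<in>I. \<bar>\<Sum>n. a n * h i (c n)\<bar> \<le> K"
  shows "\<exists>K. \<forall>i\<in>I. \<forall>c\<in>C. \<bar>h i c\<bar> \<le> K"
proof (rule ccontr)
  assume unbounded: "\<nexists>K. \<forall>i\<in>I. \<forall>c\<in>C. \<bar>h i c\<bar> \<le> K"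
  define s where "s i = (SUP c\<in>C. \<bar>h i c\<bar>)" for i
  have bdd: "bdd_above ((\<lambda>c. \<bar>h i c\<bar>) ` C)" if "i \<in> I" for i
    using pt[OF that] by (auto simp: bdd_above_def)
  have upper: "\<bar>h i c\<bar> \<le> s i" if "i \<in> I" "c \<in> C" for i c
    unfolding s_def using bdd that by (intro cSUP_upper) auto
  have "\<exists>i c. i \<in> I \<and> c \<in> C \<and> 4^n < s i \<and> 3/4 * s i < \<bar>h i c\<bar>" for n :: nat
  proof -
    obtain i c where ic: "i \<in> I" "c \<in> C" "4^n < \<bar>h i c\<bar>"
      using unbounded by (meson not_le_imp_less)
    have s: "4^n < s i"
      using upper ic by fastforce
    then have "3/4 * s i < s i"
      using zero_less_power[of "4::real" n] by linarith
    then obtain c' where "c' \<in> C" "3/4 * s i < \<bar>h i c'\<bar>"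
      unfolding s_def using less_cSUP_iff[OF _ bdd[OF ic(1)]] ic(2) by (metis empty_iff)
    with ic s show ?thesis by blast
  qed
  then obtain i c where i: "\<And>n. i n \<in> I" and c: "\<And>n. c n \<in> C"
    and s: "\<And>n::nat. 4^n < s (i n)" and h: "\<And>n. 3/4 * s (i n) < \<bar>h (i n) (c n)\<bar>"
    by metis
  define b where "b n k = h (i n) (c k)" for n k
  define a where "a = hump_coeff b"
  have a: "\<bar>a n\<bar> = (1/3)^n" for n
    by (simp add: a_def abs_hump_coeff)
  obtain K where K: "\<And>j. j \<in> I \<Longrightarrow> \<bar>\<Sum>n. a n * h j (c n)\<bar> \<le> K"
    using ser[of c a] c a by auto
  have le: "1/4 * (4/3)^n \<le> K" for n
  proof -
    have geo: "(\<lambda>k. (1/3)^k * s (i n)) sums (3/2 * s (i n))"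
      using sums_mult2[OF geometric_sums[of "1/3 :: real"]] by simp
    have le: "\<bar>a k * b n k\<bar> \<le> (1/3)^k * s (i n)" for k
      using upper[OF i c] by (simp add: abs_mult a b_def mult_left_mono)
    have sm: "summable (\<lambda>k. a k * b n k)"
      using le by (intro summable_comparison_test'[OF sums_summable[OF geo]]) auto
    have split: "(\<Sum>k. a k * b n k) = (\<Sum>k. a (k + Suc n) * b n (k + Suc n)) + (\<Sum>k<Suc n. a k * b n k)"
      by (rule suminf_split_initial_segment[OF sm])
    have tail: "\<bar>\<Sum>k. a (k + Suc n) * b n (k + Suc n)\<bar> \<le> (1/3)^n * (1/2 * s (i n))"
    proof -
      have geo': "(\<lambda>k. (1/3)^Suc n * ((1/3)^k * s (i n))) sums ((1/3)^Suc n * (3/2 * s (i n)))"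
        by (rule sums_mult[OF geo])
      have le': "\<bar>a (k + Suc n) * b n (k + Suc n)\<bar> \<le> (1/3)^Suc n * ((1/3)^k * s (i n))" for k
        using le[of "k + Suc n"] by (simp only: power_add ac_simps)
      have sm': "summable (\<lambda>k. \<bar>a (k + Suc n) * b n (k + Suc n)\<bar>)"
        using le' by (intro summable_comparison_test'[OF sums_summable[OF geo']]) auto
      have "\<bar>\<Sum>k. a (k + Suc n) * b n (k + Suc n)\<bar> \<le> (\<Sum>k. \<bar>a (k + Suc n) * b n (k + Suc n)\<bar>)"
        by (rule summable_rabs[OF sm'])
      also have "\<dots> \<le> (1/3)^Suc n * (3/2 * s (i n))"
        using suminf_le[OF le' sm' sums_summable[OF geo']] sums_unique[OF geo'] by simp
      finally show ?thesis by simp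
    qed
    have "(1/3)^n * (3/4 * s (i n)) \<le> (1/3)^n * \<bar>b n n\<bar>"
      using h[of n] by (intro mult_left_mono) (auto simp: b_def)
    also have "\<dots> \<le> \<bar>\<Sum>k<Suc n. a k * b n k\<bar>"
      unfolding a_def by (rule hump_coeff_partial_sum)
    also have "\<dots> \<le> \<bar>\<Sum>k. a k * b n k\<bar> + (1/3)^n * (1/2 * s (i n))"
      using split tail by linarith
    also have "\<dots> \<le> K + (1/3)^n * (1/2 * s (i n))"
      using K[OF i[of n]] by (simp add: b_def)
    finally have "(1/3)^n * (1/4 * s (i n)) \<le> K"
      by (simp add: algebra_simps)
    moreover have "(1/3)^n * (1/4 * 4^n) \<le> (1/3)^n * (1/4 * s (i n))"
      using s[of n] by (intro mult_left_mono) auto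
    moreover have "(1/3)^n * (1/4 * 4^n) = 1/4 * (4/3 :: real)^n"
      by (simp add: power_divide)
    ultimately show ?thesis by linarith
  qed
  obtain n where "4 * K < (4/3 :: real)^n"
    using real_arch_pow[of "4/3" "4 * K"] by auto
  with le[of n] show False
    by simp
qed

lemma nuclear_weakly_bounded:
  assumes E: "locally_convex_topology E" "nuclear_space E" and B: "B \<subseteq> topspace E"
    and weak: "\<And>f. f \<in> dual E \<Longrightarrow> \<exists>K. \<forall>x\<in>B. \<bar>f x\<bar> \<le> K"
  shows "bounded_in E B"
  unfolding bounded_in_iff[OF E(1)]
proof (intro conjI allI impI B)
  fix p assume p: "continuous_seminorm E p"
  obtain q where q: "continuous_seminorm E q"
    "\<And>x. x \<in> topspace E \<Longrightarrow> \<exists>g\<in>dual E. (\<forall>u\<in>topspace E. \<bar>g u\<bar> \<le> q u) \<and> p x \<le> \<bar>g x\<bar>"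
    using nuclear_norming[OF E p] by blast
  let ?C = "{g \<in> dual E. \<forall>u\<in>topspace E. \<bar>g u\<bar> \<le> q u}"
  have "\<exists>K. \<forall>x\<in>B. \<forall>g\<in>?C. \<bar>g x\<bar> \<le> K"
  proof (rule gliding_hump[where h = "\<lambda>x g. g x"])
    show "\<exists>K. \<forall>g\<in>?C. \<bar>g x\<bar> \<le> K" if "x \<in> B" for x
      using that B by (intro exI[of _ "q x"]) auto
    fix a :: "nat \<Rightarrow> real" and g :: "nat \<Rightarrow> 'a \<Rightarrow> real"
    assume g: "\<And>n. g n \<in> ?C" and a: "\<And>n. \<bar>a n\<bar> \<le> (1/3)^n"
    have "linear_betw (g n) (topspace E) UNIV" for n
      using g by (auto intro: dual_linear)
    then have lin: "\<forall>n. linear_betw (\<lambda>x. a n * g n x) (topspace E) UNIV"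
      by (auto simp: linear_betw_def algebra_simps)
    have le: "\<forall>n. \<forall>x\<in>topspace E. \<bar>a n * g n x\<bar> \<le> (1/3)^n * q x"
      using a g by (auto simp: abs_mult intro!: mult_mono)
    have "(\<lambda>x. if x \<in> topspace E then \<Sum>n. a n * g n x else 0) \<in> dual E"
      by (rule dual_series(1)[OF E(1) q(1) lin le]) auto
    from weak[OF this] obtain K where "\<forall>x\<in>B. \<bar>if x \<in> topspace E then \<Sum>n. a n * g n x else 0\<bar> \<le> K"
      by blast
    with B show "\<exists>K. \<forall>x\<in>B. \<bar>\<Sum>n. a n * g n x\<bar> \<le> K"
      by (intro exI[of _ K]) (auto simp: subset_iff)
  qed
  then obtain K where K: "\<And>x g. x \<in> B \<Longrightarrow> g \<in> ?C \<Longrightarrow> \<bar>g x\<bar> \<le> K"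
    by blast
  have "p x \<le> K" if x: "x \<in> B" for x
  proof -
    obtain g where "g \<in> ?C" "p x \<le> \<bar>g x\<bar>"
      using q(2)[of x] x B by blast
    with K[OF x] show ?thesis
      by fastforce
  qed
  then show "\<exists>C. \<forall>x\<in>B. p x \<le> C"
    by blast
qed

lemma quasi_complete_series:
  assumes E: "locally_convex_topology E" "quasi_complete E" and C: "bounded_in E C"
    and c: "\<And>n. c n \<in> C" and a: "\<And>n::nat. \<bar>a n\<bar> \<le> (1/3 :: real)^n"
  obtains x where "x \<in> topspace E" "\<And>f. f \<in> dual E \<Longrightarrow> f x = (\<Sum>n. a n * f (c n))"
proof -
  have S: "subspace (topspace E)"
    using E(1) by (rule locally_convex_topology_subspace)
  have cS: "c n \<in> topspace E" for n
    using C c by (auto simp: bounded_in_def)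
  obtain M where M: "\<And>p x. continuous_seminorm E p \<Longrightarrow> x \<in> C \<Longrightarrow> p x \<le> M p"
    using C unfolding bounded_in_iff[OF E(1)] by metis
  define s where "s n = (\<Sum>k<n. a k *\<^sub>R c k)" for n
  have sS: "s n \<in> topspace E" for n
    unfolding s_def using cS by (intro subspace_sum[OF S] subspace_scale[OF S])
  have diff: "p (s n - s m) \<le> (1/3)^m * (3/2 * M p)" if p: "continuous_seminorm E p" and "m \<le> n" for p m n
  proof -
    have pS: "seminorm_on (topspace E) p"
      using p by (simp add: continuous_seminorm_def)
    have M0: "0 \<le> M p"
      using seminorm_on_nonneg[OF S pS cS] M[OF p c] order_trans by blast
    have "s n - s m = (\<Sum>k\<in>{m..<n}. a k *\<^sub>R c k)"
      unfolding s_def using \<open>m \<le> n\<close> sum_diff[of "{..<n}" "{..<m}" "\<lambda>k. a k *\<^sub>R c k"]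
      by (simp add: lessThan_minus_lessThan subset_iff)
    then have "p (s n - s m) \<le> (\<Sum>k\<in>{m..<n}. \<bar>a k\<bar> * p (c k))"
      using seminorm_on_sum_le[OF S pS cS] by simp
    also have "\<dots> \<le> (\<Sum>k\<in>{m..<n}. (1/3)^k * M p)"
      using a M[OF p c] seminorm_on_nonneg[OF S pS cS] by (intro sum_mono mult_mono) auto
    also have "\<dots> = (\<Sum>k\<in>{m..<n}. (1/3)^k) * M p"
      by (simp add: sum_distrib_right)
    also have "(\<Sum>k\<in>{m..<n}. (1/3::real)^k) = ((1/3)^m - (1/3)^n) * (3/2)"
      using \<open>m \<le> n\<close> by (induction n rule: dec_induct) (auto simp: algebra_simps)
    also have "\<dots> * M p \<le> (1/3)^m * (3/2) * M p"
      using M0 by (intro mult_right_mono) auto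
    finally show ?thesis by simp
  qed
  define K where "K = {x \<in> topspace E. \<forall>p. continuous_seminorm E p \<longrightarrow> p x \<le> 3/2 * M p}"
  have "bounded_in E K"
    unfolding bounded_in_iff[OF E(1)]
  proof (intro conjI allI impI)
    show "\<exists>C. \<forall>x\<in>K. p x \<le> C" if "continuous_seminorm E p" for p
      using that by (intro exI[of _ "3/2 * M p"]) (auto simp: K_def)
  qed (auto simp: K_def)
  moreover have "closedin E K"
  proof -
    have "closedin E {x \<in> topspace E. p x \<in> {..3/2 * M p}}" if "continuous_seminorm E p" for p
      using that by (intro closedin_continuous_map_preimage[of E euclideanreal]) (auto simp: continuous_seminorm_def)
    then have "closedin E (\<Inter>((\<lambda>p. {x \<in> topspace E. p x \<in> {..3/2 * M p}}) ` Collect (continuous_seminorm E)))"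
      using continuous_seminorm_zero[of E] by (intro closedin_Inter) auto
    also have "(\<Inter>((\<lambda>p. {x \<in> topspace E. p x \<in> {..3/2 * M p}}) ` Collect (continuous_seminorm E))) = K"
      using continuous_seminorm_zero[of E] by (auto simp: K_def)
    finally show ?thesis .
  qed
  ultimately have K: "complete_in E K"
    using E(2) unfolding quasi_complete_def by blast
  have sK: "s n \<in> K" for n
    using diff[of _ 0 n] sS by (auto simp: K_def s_def)
  let ?F = "filtermap s sequentially"
  have "Cauchy_filter_in E ?F"
    unfolding Cauchy_filter_in_def
  proof (intro allI impI)
    fix U assume "zero_nhd E U"
    then obtain p where p: "continuous_seminorm E p" "{x \<in> topspace E. p x < 1} \<subseteq> U"
      unfolding zero_nhd_iff[OF E(1)] by blast
    have lim: "(\<lambda>m. (1/3)^m * (3/2 * M p)) \<longlonglongrightarrow> 0 * (3/2 * M p)"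
      by (intro tendsto_mult LIMSEQ_realpow_zero tendsto_const) auto
    have "\<forall>\<^sub>F m in sequentially. (1/3)^m * (3/2 * M p) < 1/2"
      by (rule order_tendstoD(2)[OF lim]) simp
    then obtain m where m: "(1/3)^m * (3/2 * M p) < 1/2"
      using eventually_happens sequentially_bot by blast
    have pS: "seminorm_on (topspace E) p"
      using p by (simp add: continuous_seminorm_def)
    have "s n - s k \<in> U" if "m \<le> n" "m \<le> k" for n k
    proof -
      have "p (s n - s k) \<le> p (s n - s m) + p (s m - s k)"
        by (rule seminorm_on_triangle[OF S pS sS sS sS])
      also have "\<dots> = p (s n - s m) + p (s k - s m)"
        using seminorm_on_minus_commute[OF S pS sS sS] by simp
      also have "\<dots> < 1"
        using diff[OF p(1) that(1)] diff[OF p(1) that(2)] m by linarith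
      finally show ?thesis
        using p(2) subspace_diff[OF S sS sS] by blast
    qed
    then show "\<exists>A. (\<forall>\<^sub>F x in ?F. x \<in> A) \<and> (\<forall>x\<in>A. \<forall>y\<in>A. x - y \<in> U)"
      by (intro exI[of _ "s ` {m..}"]) (auto simp: eventually_filtermap eventually_sequentially)
  qed
  moreover have "?F \<le> principal K" "?F \<noteq> bot"
    using sK by (auto simp: le_principal eventually_filtermap filtermap_bot_iff)
  ultimately obtain x where x: "x \<in> K" "limitin E (\<lambda>y. y) x ?F"
    using K unfolding complete_in_def by blast
  show thesis
  proof
    show "x \<in> topspace E"
      using x by (simp add: K_def)
    fix f assume f: "f \<in> dual E"
    have "limitin euclideanreal (f \<circ> (\<lambda>y. y)) (f x) ?F"
      by (rule continuous_map_limit[OF continuous_operatorsD(2)[OF f] x(2)])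
    then have "((\<lambda>n. f (s n)) \<longlongrightarrow> f x) sequentially"
      by (simp add: o_def filterlim_filtermap)
    moreover have "f (s n) = (\<Sum>k<n. a k * f (c k))" for n
      unfolding s_def using linear_betw_sum[OF dual_linear[OF f] cS] by simp
    ultimately have "(\<lambda>k. a k * f (c k)) sums f x"
      by (simp add: sums_def)
    then show "f x = (\<Sum>n. a n * f (c n))"
      by (rule sums_unique)
  qed
qed

lemma quasi_complete_uniform_boundedness:
  assumes E: "locally_convex_topology E" "quasi_complete E" and C: "bounded_in E C"
    and B: "B \<subseteq> dual E" and bd: "\<And>x. x \<in> topspace E \<Longrightarrow> \<exists>K. \<forall>f\<in>B. \<bar>f x\<bar> \<le> K"
  shows "\<exists>K. \<forall>f\<in>B. \<forall>x\<in>C. \<bar>f x\<bar> \<le> K"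
proof (rule gliding_hump)
  show "\<exists>K. \<forall>x\<in>C. \<bar>f x\<bar> \<le> K" if "f \<in> B" for f
    using dual_bounded[OF E(1) _ C] B that by blast
  fix a :: "nat \<Rightarrow> real" and c :: "nat \<Rightarrow> 'a"
  assume c: "\<And>n. c n \<in> C" and a: "\<And>n. \<bar>a n\<bar> \<le> (1/3)^n"
  obtain x where x: "x \<in> topspace E" "\<And>f. f \<in> dual E \<Longrightarrow> f x = (\<Sum>n. a n * f (c n))"
    using quasi_complete_series[OF E C, of c a] c a by blast
  from bd[OF x(1)] obtain K where "\<forall>f\<in>B. \<bar>f x\<bar> \<le> K"
    by blast
  with B x(2) show "\<exists>K. \<forall>f\<in>B. \<bar>\<Sum>n. a n * f (c n)\<bar> \<le> K"
    by (intro exI[of _ K]) (auto simp: subset_iff)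
qed

section \<open>Semireflexivity\<close>

lemma sum_fun_apply: "(\<Sum>i\<in>A. F i) x = (\<Sum>i\<in>A. F i x)"
  by (induction A rule: infinite_finite_induct) auto

lemma subspace_dual: "locally_convex_topology E \<Longrightarrow> subspace (dual E)"
  by (intro subspace_continuous_operators locally_convex_topology_euclideanreal)

lemma nuclear_bidual_approximation:
  assumes E: "locally_convex_topology E" "nuclear_space E"
    and \<phi>: "\<phi> \<in> dual (strong_dual E)" and p: "continuous_seminorm E p"
  obtains x t where "\<And>N::nat. x N \<in> topspace E" "t \<longlonglongrightarrow> 0"
    "\<And>g N. g \<in> dual E \<Longrightarrow> (\<forall>u\<in>topspace E. \<bar>g u\<bar> \<le> p u) \<Longrightarrow> \<bar>\<phi> g - g (x N)\<bar> \<le> t N"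
proof -
  have S: "subspace (topspace E)" and pS: "seminorm_on (topspace E) p"
    using E(1) p by (auto intro: locally_convex_topology_subspace simp: continuous_seminorm_def)
  obtain q f y a where q: "continuous_seminorm E q"
    and f: "\<And>n::nat. f n \<in> dual E" and y: "\<And>n. y n \<in> topspace E" and a: "\<And>n. 0 \<le> a n"
    and fq: "\<And>n x. x \<in> topspace E \<Longrightarrow> \<bar>f n x\<bar> \<le> a n * q x"
    and sm: "summable (\<lambda>n. a n * p (y n))"
    and lim: "\<And>x. x \<in> topspace E \<Longrightarrow> (\<lambda>N. p (x - (\<Sum>n<N. f n x *\<^sub>R y n))) \<longlonglongrightarrow> 0"
    using nuclear_expansion[OF E p] by blast
  have q0: "0 \<le> q u" if "u \<in> topspace E" for u
    using q that by (intro seminorm_on_nonneg[OF S]) (auto simp: continuous_seminorm_def)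
  have py: "0 \<le> p (y n)" for n
    using seminorm_on_nonneg[OF S pS y] .
  define T where "T N = (\<Sum>n. a (n + N) * p (y (n + N)))" for N
  have T0: "0 \<le> T N" for N
    unfolding T_def using a py summable_ignore_initial_segment[OF sm] by (intro suminf_nonneg) auto
  let ?Q = "{h \<in> dual E. \<forall>u\<in>topspace E. \<bar>h u\<bar> \<le> q u}"
  have "bounded_in (strong_dual E) ?Q"
    by (rule equicontinuous_bounded[OF E(1) q]) auto
  then obtain M where M: "\<And>h. h \<in> ?Q \<Longrightarrow> \<bar>\<phi> h\<bar> \<le> M"
    using dual_bounded[OF locally_convex_topology_strong_dual[OF E(1)] \<phi>] by blast
  define s where "s N u = (\<Sum>n<N. f n u *\<^sub>R y n)" for N u
  have sS: "s N u \<in> topspace E" for N u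
    unfolding s_def by (intro subspace_sum[OF S] subspace_scale[OF S] y)
  have tail: "p (u - s N u) \<le> T N * q u" if u: "u \<in> topspace E" for N u
  proof (rule LIMSEQ_le_const)
    have "(\<lambda>m. p (u - s (N + m) u)) \<longlonglongrightarrow> 0"
      using LIMSEQ_ignore_initial_segment[OF lim[OF u], of N] by (simp add: s_def add.commute)
    moreover have "(\<lambda>m. \<Sum>k<m. a (k + N) * p (y (k + N))) \<longlonglongrightarrow> T N"
      unfolding T_def by (rule summable_LIMSEQ[OF summable_ignore_initial_segment[OF sm]])
    ultimately show "(\<lambda>m. p (u - s (N + m) u) + (\<Sum>k<m. a (k + N) * p (y (k + N))) * q u) \<longlonglongrightarrow> T N * q u"
      using tendsto_add[OF _ tendsto_mult[OF _ tendsto_const[of "q u"]], where a = 0] by fastforce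
    have "p (u - s N u) \<le> p (u - s (N + m) u) + (\<Sum>k<m. a (k + N) * p (y (k + N))) * q u" for m
    proof (induction m)
      case (Suc m)
      have eq: "u - s (N + m) u = (u - s (N + Suc m) u) + f (m + N) u *\<^sub>R y (m + N)"
        by (simp add: s_def add.commute)
      have "u - s (N + Suc m) u \<in> topspace E" "f (m + N) u *\<^sub>R y (m + N) \<in> topspace E"
        by (intro subspace_diff[OF S] subspace_scale[OF S] u sS y)+
      then have "p (u - s (N + m) u) \<le> p (u - s (N + Suc m) u) + p (f (m + N) u *\<^sub>R y (m + N))"
        unfolding eq using pS unfolding seminorm_on_def by blast
      also have "p (f (m + N) u *\<^sub>R y (m + N)) = \<bar>f (m + N) u\<bar> * p (y (m + N))"
        using pS y unfolding seminorm_on_def by blast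
      also have "\<dots> \<le> (a (m + N) * q u) * p (y (m + N))"
        by (intro mult_right_mono fq u py)
      finally show ?case
        using Suc.IH by (simp add: algebra_simps)
    qed simp
    then show "\<exists>M. \<forall>m\<ge>M. p (u - s N u) \<le> p (u - s (N + m) u) + (\<Sum>k<m. a (k + N) * p (y (k + N))) * q u"
      by blast
  qed
  define x where "x N = (\<Sum>n<N. \<phi> (f n) *\<^sub>R y n)" for N
  define t where "t N = M * (T N + 1 / real (Suc N))" for N
  show thesis
  proof
    show "x N \<in> topspace E" for N
      unfolding x_def by (intro subspace_sum[OF S] subspace_scale[OF S] y)
    have "T \<longlonglongrightarrow> 0"
      unfolding T_def by (rule suminf_exist_split2[OF sm])
    then have "t \<longlonglongrightarrow> M * (0 + 0)"
      unfolding t_def by (intro tendsto_mult tendsto_add tendsto_const lim_inverse_n'[THEN LIMSEQ_Suc])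
    then show "t \<longlonglongrightarrow> 0"
      by simp
    fix g N assume g: "g \<in> dual E" and gp: "\<forall>u\<in>topspace E. \<bar>g u\<bar> \<le> p u"
    define h where "h = g - (\<Sum>n<N. g (y n) *\<^sub>R f n)"
    have sf: "(\<Sum>n<N. g (y n) *\<^sub>R f n) \<in> dual E"
      by (intro subspace_sum[OF subspace_dual[OF E(1)]] subspace_scale[OF subspace_dual[OF E(1)]] f)
    have h: "h \<in> dual E"
      unfolding h_def by (rule subspace_diff[OF subspace_dual[OF E(1)] g sf])
    have hu: "\<bar>h u\<bar> \<le> T N * q u" if u: "u \<in> topspace E" for u
    proof -
      have "h u = g u - (\<Sum>n<N. f n u *\<^sub>R g (y n))"
        by (simp add: h_def sum_fun_apply scaleR_fun_def mult.commute)
      also have "(\<Sum>n<N. f n u *\<^sub>R g (y n)) = g (s N u)"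
        unfolding s_def by (rule linear_betw_sum[OF dual_linear[OF g] y, symmetric])
      also have "g u - g (s N u) = g (u - s N u)"
        by (rule linear_betw_diff[OF dual_linear[OF g] u sS, symmetric])
      finally have "\<bar>h u\<bar> \<le> p (u - s N u)"
        using gp subspace_diff[OF S u sS] by simp
      with tail[OF u, of N] show ?thesis
        by simp
    qed
    define e where "e = T N + 1 / real (Suc N)"
    have e: "e > 0" "T N \<le> e"
      using T0[of N] by (auto simp: e_def intro: add_nonneg_pos)
    have "(1/e) *\<^sub>R h \<in> ?Q"
    proof -
      have "\<bar>((1/e) *\<^sub>R h) u\<bar> \<le> q u" if u: "u \<in> topspace E" for u
      proof -
        have "\<bar>h u\<bar> \<le> e * q u"
          using hu[OF u] mult_right_mono[OF e(2) q0[OF u]] by linarith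
        with e(1) show ?thesis
          by (simp add: scaleR_fun_def abs_mult field_simps)
      qed
      then show ?thesis
        using subspace_scale[OF subspace_dual[OF E(1)] h] by blast
    qed
    then have "\<bar>\<phi> ((1/e) *\<^sub>R h)\<bar> \<le> M"
      by (rule M)
    moreover have lin: "linear_betw \<phi> (dual E) UNIV"
      using dual_linear[OF \<phi>] by simp
    ultimately have "\<bar>\<phi> h\<bar> \<le> M * e"
      using linear_betwD(3)[OF lin h, of "1/e"] e(1) by (simp add: abs_mult field_simps)
    moreover have "\<phi> h = \<phi> g - g (x N)"
      unfolding h_def x_def linear_betw_diff[OF lin g sf] linear_betw_sum[OF lin f]
        linear_betw_sum[OF dual_linear[OF g] y] by (simp add: mult.commute)
    ultimately show "\<bar>\<phi> g - g (x N)\<bar> \<le> t N"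
      by (simp add: t_def e_def)
  qed
qed

lemma complete_nuclear_semireflexive:
  assumes E: "locally_convex_topology E" "nuclear_space E" "complete_lcs E"
    and \<phi>: "\<phi> \<in> dual (strong_dual E)"
  shows "\<exists>x\<in>topspace E. \<forall>f\<in>dual E. \<phi> f = f x"
proof -
  have S: "subspace (topspace E)"
    using E(1) by (rule locally_convex_topology_subspace)
  have lin: "linear_betw \<phi> (dual E) UNIV"
    using dual_linear[OF \<phi>] by simp
  define X where "X p = {x \<in> topspace E. \<forall>g\<in>dual E. (\<forall>u\<in>topspace E. \<bar>g u\<bar> \<le> p u) \<longrightarrow> \<bar>\<phi> g - g x\<bar> \<le> 1}" for p
  have X_mono: "X r \<subseteq> X p" if le: "\<And>u. u \<in> topspace E \<Longrightarrow> p u \<le> r u" for p r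
  proof
    fix x assume x: "x \<in> X r"
    have "\<bar>\<phi> g - g x\<bar> \<le> 1" if g: "g \<in> dual E" "\<forall>u\<in>topspace E. \<bar>g u\<bar> \<le> p u" for g
    proof -
      have "\<forall>u\<in>topspace E. \<bar>g u\<bar> \<le> r u"
        using g(2) le by fastforce
      with x g(1) show ?thesis
        by (simp add: X_def)
    qed
    with x show "x \<in> X p"
      by (simp add: X_def)
  qed
  have scaled: "\<bar>\<phi> g - g x\<bar> \<le> 1/c"
    if "x \<in> X (\<lambda>u. c * p u)" "g \<in> dual E" "\<forall>u\<in>topspace E. \<bar>g u\<bar> \<le> p u" "c > 0" for x c p g
  proof -
    have "c *\<^sub>R g \<in> dual E"
      using subspace_dual[OF E(1)] that(2) by (rule subspace_scale)
    moreover have "\<forall>u\<in>topspace E. \<bar>(c *\<^sub>R g) u\<bar> \<le> c * p u"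
      using that(3,4) by (simp add: scaleR_fun_def abs_mult)
    ultimately have "\<bar>\<phi> (c *\<^sub>R g) - (c *\<^sub>R g) x\<bar> \<le> 1"
      using that(1) by (simp add: X_def)
    also have "\<phi> (c *\<^sub>R g) - (c *\<^sub>R g) x = c * (\<phi> g - g x)"
      using linear_betwD(3)[OF lin that(2)] by (simp add: scaleR_fun_def algebra_simps)
    finally have "c * \<bar>\<phi> g - g x\<bar> \<le> 1"
      using that(4) by (simp add: abs_mult)
    then show ?thesis
      using that(4) by (simp add: field_simps)
  qed
  let ?P = "Collect (continuous_seminorm E)"
  define \<F> where "\<F> = (INF p\<in>?P. principal (X p))"
  have ne: "X p \<noteq> {}" if p: "continuous_seminorm E p" for p
  proof -
    obtain x t where x: "\<And>N::nat. x N \<in> topspace E" and t: "t \<longlonglongrightarrow> (0::real)"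
      and le: "\<And>g N. g \<in> dual E \<Longrightarrow> (\<forall>u\<in>topspace E. \<bar>g u\<bar> \<le> p u) \<Longrightarrow> \<bar>\<phi> g - g (x N)\<bar> \<le> t N"
      using nuclear_bidual_approximation[OF E(1,2) \<phi> p] by blast
    have "\<forall>\<^sub>F N in sequentially. t N < 1"
      by (rule order_tendstoD(2)[OF t]) simp
    then obtain N where "t N < 1"
      using eventually_happens sequentially_bot by blast
    then have "\<bar>\<phi> g - g (x N)\<bar> \<le> 1" if "g \<in> dual E" "\<forall>u\<in>topspace E. \<bar>g u\<bar> \<le> p u" for g
      using le[OF that, of N] by simp
    then have "x N \<in> X p"
      unfolding X_def using x by blast
    then show ?thesis by blast
  qed
  have base: "eventually Q \<F> \<longleftrightarrow> (\<exists>p\<in>?P. \<forall>x\<in>X p. Q x)" for Q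
  proof -
    have "eventually Q \<F> \<longleftrightarrow> (\<exists>p\<in>?P. eventually Q (principal (X p)))"
      unfolding \<F>_def
    proof (rule eventually_INF_base)
      show "?P \<noteq> {}"
        using continuous_seminorm_zero[of E] by blast
      fix p r assume "p \<in> ?P" "r \<in> ?P"
      then have pr: "continuous_seminorm E p" "continuous_seminorm E r" by auto
      have 0: "0 \<le> p u" "0 \<le> r u" if "u \<in> topspace E" for u
        using pr seminorm_on_nonneg[OF S _ that] by (auto simp: continuous_seminorm_def)
      have "X (\<lambda>x. p x + r x) \<subseteq> X p \<inter> X r"
        using X_mono[of p "\<lambda>x. p x + r x"] X_mono[of r "\<lambda>x. p x + r x"] 0 by auto
      then show "\<exists>x\<in>?P. principal (X x) \<le> inf (principal (X p)) (principal (X r))"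
        using continuous_seminorm_add[OF pr] by (intro bexI[of _ "\<lambda>x. p x + r x"]) auto
    qed
    then show ?thesis
      by (simp add: eventually_principal)
  qed
  have bot: "\<F> \<noteq> bot"
    unfolding trivial_limit_def base using ne by blast
  have "Cauchy_filter_in E \<F>"
    unfolding Cauchy_filter_in_def
  proof (intro allI impI)
    fix U assume "zero_nhd E U"
    then obtain p where p: "continuous_seminorm E p" "{x \<in> topspace E. p x < 1} \<subseteq> U"
      unfolding zero_nhd_iff[OF E(1)] by blast
    obtain q where q: "continuous_seminorm E q"
      "\<And>x. x \<in> topspace E \<Longrightarrow> \<exists>g\<in>dual E. (\<forall>u\<in>topspace E. \<bar>g u\<bar> \<le> q u) \<and> p x \<le> \<bar>g x\<bar>"
      using nuclear_norming[OF E(1,2) p(1)] by blast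
    let ?A = "X (\<lambda>u. 4 * q u)"
    have "x - y \<in> U" if x: "x \<in> ?A" and y: "y \<in> ?A" for x y
    proof -
      have xy: "x \<in> topspace E" "y \<in> topspace E"
        using x y by (auto simp: X_def)
      have d: "x - y \<in> topspace E"
        using S xy by (rule subspace_diff)
      obtain g where g: "g \<in> dual E" "\<forall>u\<in>topspace E. \<bar>g u\<bar> \<le> q u" "p (x - y) \<le> \<bar>g (x - y)\<bar>"
        using q(2)[OF d] by blast
      have "\<bar>\<phi> g - g x\<bar> \<le> 1/4" "\<bar>\<phi> g - g y\<bar> \<le> 1/4"
        using scaled[OF x g(1,2)] scaled[OF y g(1,2)] by simp_all
      then have "p (x - y) < 1"
        using g(3) linear_betw_diff[OF dual_linear[OF g(1)] xy] by linarith
      then show ?thesis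
        using p(2) d by blast
    qed
    moreover have "eventually (\<lambda>x. x \<in> ?A) \<F>"
      unfolding base using continuous_seminorm_cmult[OF q(1), of 4] by auto
    ultimately show "\<exists>A. eventually (\<lambda>x. x \<in> A) \<F> \<and> (\<forall>x\<in>A. \<forall>y\<in>A. x - y \<in> U)"
      by blast
  qed
  moreover have "\<F> \<le> principal (topspace E)"
    unfolding le_principal base using continuous_seminorm_zero[of E] by (auto simp: X_def)
  ultimately obtain x where x: "x \<in> topspace E" "limitin E (\<lambda>y. y) x \<F>"
    using E(3) bot unfolding complete_lcs_def complete_in_def by blast
  have "\<phi> f = f x" if f: "f \<in> dual E" for f
  proof -
    have "limitin euclideanreal (f \<circ> (\<lambda>y. y)) (f x) \<F>"
      by (rule continuous_map_limit[OF continuous_operatorsD(2)[OF f] x(2)])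
    then have "((\<lambda>y. \<bar>\<phi> f - f y\<bar>) \<longlongrightarrow> \<bar>\<phi> f - f x\<bar>) \<F>"
      by (intro tendsto_intros) (simp add: o_def)
    moreover have "eventually (\<lambda>y. \<bar>\<phi> f - f y\<bar> \<le> e) \<F>" if "e > 0" for e
    proof -
      have "continuous_seminorm E (\<lambda>u. (1/e) * \<bar>f u\<bar>)"
        using that by (intro continuous_seminorm_cmult dual_seminorm f) auto
      moreover have "\<bar>\<phi> f - f y\<bar> \<le> e" if "y \<in> X (\<lambda>u. (1/e) * \<bar>f u\<bar>)" for y
        using scaled[OF that f] \<open>e > 0\<close> by simp
      ultimately show ?thesis
        unfolding base by blast
    qed
    ultimately have "\<bar>\<phi> f - f x\<bar> \<le> 0 + e" if "e > 0" for e
      using tendsto_upperbound[OF _ _ bot] that by fastforce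
    then have "\<bar>\<phi> f - f x\<bar> \<le> 0"
      by (rule field_le_epsilon)
    then show ?thesis by simp
  qed
  with x(1) show ?thesis by blast
qed

section \<open>Dual operators\<close>

lemma dual_operator_eqI:
  assumes \<Phi>: "locally_convex_space \<Phi>" "nuclear_space \<Phi>"
    and A': "A' \<in> continuous_operators \<Psi> \<Phi>"
    and eq: "\<And>f x. f \<in> dual \<Phi> \<Longrightarrow> x \<in> topspace \<Psi> \<Longrightarrow> f (A' x) = A f x"
  shows "dual_operator \<Psi> \<Phi> A = A'"
  unfolding dual_operator_def
proof (rule the_equality)
  show "A' \<in> continuous_operators \<Psi> \<Phi> \<and>
      (\<forall>f\<in>topspace (strong_dual \<Phi>). \<forall>x\<in>topspace \<Psi>. f (A' x) = A f x)"
    using A' eq by simp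
  fix B assume B: "B \<in> continuous_operators \<Psi> \<Phi> \<and>
      (\<forall>f\<in>topspace (strong_dual \<Phi>). \<forall>x\<in>topspace \<Psi>. f (B x) = A f x)"
  then have BL: "B \<in> continuous_operators \<Psi> \<Phi>" by blast
  show "B = A'"
  proof
    fix x show "B x = A' x"
    proof (cases "x \<in> topspace \<Psi>")
      case True
      show ?thesis
      proof (rule nuclear_dual_separates[OF \<Phi>])
        show "B x \<in> topspace \<Phi>" "A' x \<in> topspace \<Phi>"
          using linear_betwD(1)[OF continuous_operatorsD(1) True] A' BL by blast+
      qed (use B eq True in simp)
    qed (use continuous_operatorsD(3)[OF BL] continuous_operatorsD(3)[OF A'] in simp)
  qed
qed

lemma dual_operator_exists:
  assumes \<Psi>: "locally_convex_topology \<Psi>" "bornological \<Psi>"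
    and \<Phi>: "locally_convex_space \<Phi>" "nuclear_space \<Phi>" "complete_lcs \<Phi>"
    and A: "A \<in> continuous_operators (strong_dual \<Phi>) (strong_dual \<Psi>)"
  shows "\<exists>A'\<in>continuous_operators \<Psi> \<Phi>. \<forall>f\<in>dual \<Phi>. \<forall>x\<in>topspace \<Psi>. f (A' x) = A f x"
proof -
  have lct: "locally_convex_topology \<Phi>"
    using \<Phi>(1) by (rule locally_convex_space_topology)
  note dual_lct = locally_convex_topology_strong_dual[OF lct] locally_convex_topology_strong_dual[OF \<Psi>(1)]
  have S: "subspace (topspace \<Psi>)" "subspace (topspace \<Phi>)"
    using \<Psi>(1) lct by (auto intro: locally_convex_topology_subspace)
  have linA: "linear_betw A (dual \<Phi>) (dual \<Psi>)"
    using continuous_operatorsD(1)[OF A] by simp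
  have AD: "A f \<in> dual \<Psi>" if "f \<in> dual \<Phi>" for f
    using linear_betwD(1)[OF linA that] .
  have "\<exists>y\<in>topspace \<Phi>. \<forall>f\<in>dual \<Phi>. A f x = f y" if x: "x \<in> topspace \<Psi>" for x
  proof -
    obtain P where P: "continuous_seminorm (strong_dual \<Psi>) P" "\<forall>h\<in>dual \<Psi>. \<bar>h x\<bar> \<le> P h"
      using strong_dual_uniform_seminorm[OF \<Psi>(1) bounded_in_singleton[OF \<Psi>(1) x]] by auto
    have "(\<lambda>f. A f x) \<in> dual (strong_dual \<Phi>)"
    proof (rule dualI[OF dual_lct(1)])
      show "linear_betw (\<lambda>f. A f x) (topspace (strong_dual \<Phi>)) UNIV"
        using linA subspace_dual[OF lct] by (simp add: linear_betw_def scaleR_fun_def)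
      show "continuous_seminorm (strong_dual \<Phi>) (\<lambda>f. P (A f))"
        by (rule continuous_operators_seminorm[OF A P(1)])
      show "\<bar>A f x\<bar> \<le> P (A f)" if "f \<in> topspace (strong_dual \<Phi>)" for f
        using P(2) AD that by simp
    qed (use continuous_operatorsD(3)[OF A] in auto)
    from complete_nuclear_semireflexive[OF lct \<Phi>(2,3) this] show ?thesis .
  qed
  then obtain B where B: "\<And>x. x \<in> topspace \<Psi> \<Longrightarrow> B x \<in> topspace \<Phi>"
    "\<And>x f. x \<in> topspace \<Psi> \<Longrightarrow> f \<in> dual \<Phi> \<Longrightarrow> A f x = f (B x)"
    by metis
  define A' where "A' x = (if x \<in> topspace \<Psi> then B x else 0)" for x
  have A'S: "A' x \<in> topspace \<Phi>" if "x \<in> topspace \<Psi>" for x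
    using B that by (simp add: A'_def)
  have A': "f (A' x) = A f x" if "x \<in> topspace \<Psi>" "f \<in> dual \<Phi>" for f x
    using B that by (simp add: A'_def)
  have "A' \<in> continuous_operators \<Psi> \<Phi>"
  proof (rule continuous_operatorsI[OF \<Psi>(1) lct])
    show "linear_betw A' (topspace \<Psi>) (topspace \<Phi>)"
      unfolding linear_betw_def
    proof (intro conjI ballI allI)
      fix x y assume xy: "x \<in> topspace \<Psi>" "y \<in> topspace \<Psi>"
      show "A' (x + y) = A' x + A' y"
      proof (rule nuclear_dual_separates[OF \<Phi>(1,2)])
        show "f (A' (x + y)) = f (A' x + A' y)" if f: "f \<in> dual \<Phi>" for f
          using xy A'S linear_betwD(2)[OF dual_linear[OF f]] linear_betwD(2)[OF dual_linear[OF AD[OF f]]]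
          by (simp add: A' f subspace_add[OF S(1)])
      qed (use xy A'S in \<open>auto intro: subspace_add[OF S(1)] subspace_add[OF S(2)]\<close>)
    next
      fix x and c :: real assume x: "x \<in> topspace \<Psi>"
      show "A' (c *\<^sub>R x) = c *\<^sub>R A' x"
      proof (rule nuclear_dual_separates[OF \<Phi>(1,2)])
        show "f (A' (c *\<^sub>R x)) = f (c *\<^sub>R A' x)" if f: "f \<in> dual \<Phi>" for f
          using x A'S linear_betwD(3)[OF dual_linear[OF f]] linear_betwD(3)[OF dual_linear[OF AD[OF f]]]
          by (simp add: A' f subspace_scale[OF S(1)])
      qed (use x A'S in \<open>auto intro: subspace_scale[OF S(1)] subspace_scale[OF S(2)]\<close>)
    qed (use S A'S in auto)
    fix p assume p: "continuous_seminorm \<Phi> p"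
    obtain q where q: "continuous_seminorm \<Phi> q"
      "\<And>x. x \<in> topspace \<Phi> \<Longrightarrow> \<exists>g\<in>dual \<Phi>. (\<forall>u\<in>topspace \<Phi>. \<bar>g u\<bar> \<le> q u) \<and> p x \<le> \<bar>g x\<bar>"
      using nuclear_norming[OF lct \<Phi>(2) p] by blast
    let ?Q = "{g \<in> dual \<Phi>. \<forall>u\<in>topspace \<Phi>. \<bar>g u\<bar> \<le> q u}"
    have "bounded_in (strong_dual \<Phi>) ?Q"
      by (rule equicontinuous_bounded[OF lct q(1)]) auto
    then have AQ: "bounded_in (strong_dual \<Psi>) (A ` ?Q)"
      by (rule bounded_in_continuous_image[OF dual_lct A])
    have "\<exists>r. continuous_seminorm \<Psi> r \<and> (\<forall>h\<in>A ` ?Q. \<forall>x\<in>topspace \<Psi>. \<bar>h x\<bar> \<le> r x)"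
    proof (rule bornological_equicontinuous[OF \<Psi>])
      show "seminorm_on (topspace \<Psi>) (\<lambda>x. \<bar>h x\<bar>)" if "h \<in> A ` ?Q" for h
        using that AD by (intro seminorm_on_abs_linear dual_linear) auto
      show "\<exists>C. \<forall>h\<in>A ` ?Q. \<forall>x\<in>B. \<bar>h x\<bar> \<le> C" if "bounded_in \<Psi> B" for B
        by (rule bounded_in_strong_dual_bound[OF \<Psi>(1) AQ that])
    qed
    then obtain r where r: "continuous_seminorm \<Psi> r" "\<And>g x. g \<in> ?Q \<Longrightarrow> x \<in> topspace \<Psi> \<Longrightarrow> \<bar>A g x\<bar> \<le> r x"
      by blast
    have "p (A' x) \<le> r x" if x: "x \<in> topspace \<Psi>" for x
    proof -
      obtain g where g: "g \<in> ?Q" "p (A' x) \<le> \<bar>g (A' x)\<bar>"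
        using q(2)[OF A'S[OF x]] by blast
      then show ?thesis
        using r(2)[OF g(1) x] A'[OF x, of g] by simp
    qed
    with r(1) show "\<exists>r. continuous_seminorm \<Psi> r \<and> (\<forall>x\<in>topspace \<Psi>. p (A' x) \<le> r x)"
      by blast
  qed (simp add: A'_def)
  with A' show ?thesis
    by blast
qed

section \<open>Spaces of processes\<close>

declare split_paired_All [simp del] split_paired_Ex [simp del]
  split_paired_Ball_Sigma [simp del] split_paired_Bex_Sigma [simp del]

lemma space_predictable_sigma [simp]: "space (predictable_sigma M F) = {0..} \<times> space M"
  by (simp add: predictable_sigma_def space_measure_of_conv)

lemma mem_bP_carrier_iff:
  "h \<in> bP_carrier M F \<longleftrightarrow> h \<in> borel_measurable (predictable_sigma M F) \<and>
     (\<exists>C. \<forall>z\<in>{0..} \<times> space M. \<bar>h z\<bar> \<le> C) \<and> (\<forall>z. z \<notin> {0..} \<times> space M \<longrightarrow> h z = 0)"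
  unfolding bP_carrier_def bounded_iff by (simp only: mem_Collect_eq Set.ball_simps real_norm_def)

lemma subspace_bP_carrier: "subspace (bP_carrier M F)"
  unfolding subspace_def
proof (intro conjI ballI allI)
  show "0 \<in> bP_carrier M F"
    by (auto simp: mem_bP_carrier_iff zero_fun_def intro: exI[of _ 0])
  show "h + k \<in> bP_carrier M F" if "h \<in> bP_carrier M F" "k \<in> bP_carrier M F" for h k
  proof -
    obtain C D where CD: "\<forall>z\<in>{0..} \<times> space M. \<bar>h z\<bar> \<le> C" "\<forall>z\<in>{0..} \<times> space M. \<bar>k z\<bar> \<le> D"
      using \<open>h \<in> bP_carrier M F\<close> \<open>k \<in> bP_carrier M F\<close> unfolding mem_bP_carrier_iff by blast
    have "\<bar>(h + k) z\<bar> \<le> C + D" if "z \<in> {0..} \<times> space M" for z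
      using bspec[OF CD(1) that] bspec[OF CD(2) that] abs_triangle_ineq[of "h z" "k z"] by simp
    then have "\<forall>z\<in>{0..} \<times> space M. \<bar>(h + k) z\<bar> \<le> C + D"
      by blast
    moreover have "(\<lambda>z. h z + k z) \<in> borel_measurable (predictable_sigma M F)"
      using that by (intro borel_measurable_add) (auto simp: mem_bP_carrier_iff)
    ultimately show ?thesis
      using that unfolding mem_bP_carrier_iff by (auto simp: plus_fun_def)
  qed
  show "c *\<^sub>R h \<in> bP_carrier M F" if "h \<in> bP_carrier M F" for h c
  proof -
    obtain C where "\<forall>z\<in>{0..} \<times> space M. \<bar>h z\<bar> \<le> C"
      using \<open>h \<in> bP_carrier M F\<close> unfolding mem_bP_carrier_iff by blast
    then have "\<forall>z\<in>{0..} \<times> space M. \<bar>(c *\<^sub>R h) z\<bar> \<le> \<bar>c\<bar> * C"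
      by (auto simp: scaleR_fun_def abs_mult intro: mult_left_mono)
    moreover have "(\<lambda>z. c *\<^sub>R h z) \<in> borel_measurable (predictable_sigma M F)"
      using that by (intro borel_measurable_scaleR) (auto simp: mem_bP_carrier_iff)
    ultimately show ?thesis
      using that unfolding mem_bP_carrier_iff by (auto simp: scaleR_fun_def)
  qed
qed

lemma sup_seminorms_bP:
  fixes M :: "'w measure"
  assumes "space M \<noteq> {}"
  shows "sup_seminorms (bP_carrier M F) UNIV (\<lambda>I q. I = {0..} \<times> space M \<and> q = abs) (bP M F)"
proof
  fix I :: "(real \<times> 'w) set" and q :: "real \<Rightarrow> real" and h
  assume "I = {0..} \<times> space M \<and> q = abs" and h: "h \<in> bP_carrier M F"
  moreover obtain C where "\<forall>z\<in>{0..} \<times> space M. \<bar>h z\<bar> \<le> C"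
    using h unfolding mem_bP_carrier_iff by blast
  ultimately show "h ` I \<subseteq> UNIV \<and> bdd_above ((\<lambda>i. q (h i)) ` I)"
    by (auto simp: bdd_above_def)
qed (use assms in \<open>auto simp: subspace_bP_carrier bP_def seminorm_on_def abs_mult\<close>)

lemma topspace_bP [simp]: "topspace (bP M F) = bP_carrier M F"
  by (simp add: bP_def)

lemma locally_convex_topology_bP: "space M \<noteq> {} \<Longrightarrow> locally_convex_topology (bP M F)"
  by (rule sup_seminorms.locally_convex_X[OF sup_seminorms_bP])

lemma bP_uniform_seminorm:
  assumes "space M \<noteq> {}"
  shows "\<exists>P. continuous_seminorm (bP M F) P \<and> (\<forall>h\<in>bP_carrier M F. \<forall>z\<in>{0..} \<times> space M. \<bar>h z\<bar> \<le> P h)"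
  by (rule sup_seminorms.uniform_seminorm[OF sup_seminorms_bP[OF assms], of "{0..} \<times> space M" abs]) auto

lemma bP_seminorm_bound:
  assumes M: "space M \<noteq> {}" and q: "continuous_seminorm (bP M F) q"
  obtains C where "0 \<le> C"
    "\<And>h c. h \<in> bP_carrier M F \<Longrightarrow> (\<forall>z\<in>{0..} \<times> space M. \<bar>h z\<bar> \<le> c) \<Longrightarrow> q h \<le> C * c"
proof -
  let ?Z = "{0::real..} \<times> space M"
  let ?s = "\<lambda>h. SUP z\<in>?Z. \<bar>h z\<bar>"
  have s: "\<forall>p\<in>{?s}. seminorm_on (bP_carrier M F) p"
    using sup_seminorms.seminorm_on_SUP[OF sup_seminorms_bP[OF M], of ?Z abs] by simp
  obtain Q C where Q: "finite Q" "Q \<subseteq> {?s}" "0 \<le> C"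
    "\<And>h. h \<in> bP_carrier M F \<Longrightarrow> q h \<le> C * (\<Sum>p\<in>Q. p h)"
    using continuous_seminorm_seminorm_topology_bound[OF subspace_bP_carrier s, of q] q
    unfolding bP_def by metis
  have "q h \<le> C * c" if h: "h \<in> bP_carrier M F" and c: "\<forall>z\<in>?Z. \<bar>h z\<bar> \<le> c" for h c
  proof -
    obtain \<omega> where "\<omega> \<in> space M"
      using M by blast
    then have z: "(0 :: real, \<omega>) \<in> ?Z" by simp
    have "0 \<le> c"
      using bspec[OF c z] by linarith
    moreover have "?s h \<le> c"
    proof (rule cSUP_least)
      show "?Z \<noteq> {}"
        using z by blast
    qed (rule bspec[OF c])
    moreover have "Q = {} \<or> Q = {?s}"
      using Q(2) by blast
    ultimately have "(\<Sum>p\<in>Q. p h) \<le> c"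
      by auto
    then show ?thesis
      using order_trans[OF Q(4)[OF h] mult_left_mono[OF _ Q(3)]] by blast
  qed
  with Q(3) show thesis
    by (rule that)
qed

lemma bP_vec_carrierD:
  assumes "H \<in> bP_vec_carrier M F \<Phi>"
  shows "z \<in> {0..} \<times> space M \<Longrightarrow> H z \<in> topspace \<Phi>" "z \<notin> {0..} \<times> space M \<Longrightarrow> H z = 0"
    "f \<in> dual \<Phi> \<Longrightarrow> (\<lambda>z. f (H z)) \<in> bP_carrier M F"
  using assms unfolding bP_vec_carrier_def topspace_strong_dual by blast+

lemma bP_vec_value:
  assumes "locally_convex_topology \<Phi>" "H \<in> bP_vec_carrier M F \<Phi>"
  shows "H z \<in> topspace \<Phi>"
  using bP_vec_carrierD(1,2)[OF assms(2), of z] locally_convex_topology_subspace[OF assms(1)]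
  by (cases "z \<in> {0..} \<times> space M") (auto simp: subspace_0)

lemma subspace_bP_vec_carrier:
  assumes \<Phi>: "locally_convex_topology \<Phi>"
  shows "subspace (bP_vec_carrier M F \<Phi>)"
  unfolding subspace_def
proof (intro conjI ballI allI)
  have S: "subspace (topspace \<Phi>)"
    using \<Phi> by (rule locally_convex_topology_subspace)
  note bP = subspace_bP_carrier[of M F]
  have f0: "f 0 = 0" if "f \<in> dual \<Phi>" for f
    using linear_betw_zero[OF dual_linear[OF that]] .
  have "(\<lambda>z. f 0) \<in> bP_carrier M F" if "f \<in> dual \<Phi>" for f
    using subspace_0[OF bP] f0[OF that] by (simp add: zero_fun_def)
  then show "0 \<in> bP_vec_carrier M F \<Phi>"
    using subspace_0[OF S] by (simp add: bP_vec_carrier_def)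
  show "H + K \<in> bP_vec_carrier M F \<Phi>" if H: "H \<in> bP_vec_carrier M F \<Phi>" and K: "K \<in> bP_vec_carrier M F \<Phi>" for H K
  proof -
    have "(\<lambda>z. f ((H + K) z)) \<in> bP_carrier M F" if f: "f \<in> dual \<Phi>" for f
    proof -
      have "(\<lambda>z. f ((H + K) z)) = (\<lambda>z. f (H z)) + (\<lambda>z. f (K z))"
        using linear_betwD(2)[OF dual_linear[OF f]] bP_vec_value[OF \<Phi> H] bP_vec_value[OF \<Phi> K]
        by (simp add: fun_eq_iff)
      then show ?thesis
        using subspace_add[OF bP bP_vec_carrierD(3)[OF H f] bP_vec_carrierD(3)[OF K f]] by simp
    qed
    then show ?thesis
      using bP_vec_carrierD(1,2)[OF H] bP_vec_carrierD(1,2)[OF K] subspace_add[OF S]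
      by (simp add: bP_vec_carrier_def)
  qed
  show "c *\<^sub>R H \<in> bP_vec_carrier M F \<Phi>" if H: "H \<in> bP_vec_carrier M F \<Phi>" for H c
  proof -
    have "(\<lambda>z. f ((c *\<^sub>R H) z)) \<in> bP_carrier M F" if f: "f \<in> dual \<Phi>" for f
    proof -
      have "(\<lambda>z. f ((c *\<^sub>R H) z)) = c *\<^sub>R (\<lambda>z. f (H z))"
        using linear_betwD(3)[OF dual_linear[OF f]] bP_vec_value[OF \<Phi> H]
        by (simp add: fun_eq_iff scaleR_fun_def)
      then show ?thesis
        using subspace_scale[OF bP bP_vec_carrierD(3)[OF H f]] by simp
    qed
    then show ?thesis
      using bP_vec_carrierD(1,2)[OF H] subspace_scale[OF S]
      by (simp add: bP_vec_carrier_def scaleR_fun_def)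
  qed
qed

lemma bP_vec_bounded:
  assumes \<Phi>: "locally_convex_topology \<Phi>" "nuclear_space \<Phi>" and H: "H \<in> bP_vec_carrier M F \<Phi>"
  shows "bounded_in \<Phi> (H ` ({0..} \<times> space M))"
proof (rule nuclear_weakly_bounded[OF \<Phi>])
  show "H ` ({0..} \<times> space M) \<subseteq> topspace \<Phi>"
    using bP_vec_carrierD(1)[OF H] by blast
  show "\<exists>K. \<forall>x\<in>H ` ({0..} \<times> space M). \<bar>f x\<bar> \<le> K" if "f \<in> dual \<Phi>" for f
    using bP_vec_carrierD(3)[OF H that] unfolding mem_bP_carrier_iff by blast
qed

lemma sup_seminorms_bP_vec:
  fixes M :: "'w measure"
  assumes M: "space M \<noteq> {}" and \<Phi>: "locally_convex_topology \<Phi>" "nuclear_space \<Phi>"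
  shows "sup_seminorms (bP_vec_carrier M F \<Phi>) (topspace \<Phi>)
    (\<lambda>I q. I = {0..} \<times> space M \<and> continuous_seminorm \<Phi> q) (bP_vec M F \<Phi>)"
proof
  fix I :: "(real \<times> 'w) set" and q H
  assume *: "I = {0..} \<times> space M \<and> continuous_seminorm \<Phi> q" and H: "H \<in> bP_vec_carrier M F \<Phi>"
  have "H ` I \<subseteq> topspace \<Phi>" "\<exists>C. \<forall>x\<in>H ` I. q x \<le> C"
    using bP_vec_bounded[OF \<Phi> H] * unfolding bounded_in_iff[OF \<Phi>(1)] by blast+
  then show "H ` I \<subseteq> topspace \<Phi> \<and> bdd_above ((\<lambda>i. q (H i)) ` I)"
    by (auto simp: bdd_above_def)
next
  have "{\<lambda>H. SUP i\<in>I. q (H i) | I q. I = {0::real..} \<times> space M \<and> continuous_seminorm \<Phi> q} =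
    {\<lambda>H. SUP z\<in>{0::real..} \<times> space M. p (H z) | p. continuous_seminorm \<Phi> p}"
    by blast
  then show "bP_vec M F \<Phi> = seminorm_topology (bP_vec_carrier M F \<Phi>)
      {\<lambda>H. SUP i\<in>I. q (H i) | I q. I = {0..} \<times> space M \<and> continuous_seminorm \<Phi> q}"
    by (simp only: bP_vec_def)
qed (use M \<Phi> in \<open>auto simp: subspace_bP_vec_carrier locally_convex_topology_subspace continuous_seminorm_def\<close>)

lemma topspace_bP_vec [simp]: "topspace (bP_vec M F \<Phi>) = bP_vec_carrier M F \<Phi>"
  by (simp add: bP_vec_def)

lemma locally_convex_topology_bP_vec:
  "space M \<noteq> {} \<Longrightarrow> locally_convex_topology \<Phi> \<Longrightarrow> nuclear_space \<Phi> \<Longrightarrow> locally_convex_topology (bP_vec M F \<Phi>)"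
  by (rule sup_seminorms.locally_convex_X[OF sup_seminorms_bP_vec])

lemma bP_vec_uniform_seminorm:
  assumes "space M \<noteq> {}" "locally_convex_topology \<Phi>" "nuclear_space \<Phi>" "continuous_seminorm \<Phi> q"
  shows "\<exists>P. continuous_seminorm (bP_vec M F \<Phi>) P \<and>
    (\<forall>H\<in>bP_vec_carrier M F \<Phi>. \<forall>z\<in>{0..} \<times> space M. q (H z) \<le> P H)"
  by (rule sup_seminorms.uniform_seminorm[OF sup_seminorms_bP_vec[OF assms(1-3)], of "{0..} \<times> space M" q])
     (use assms(4) in auto)

lemma bP_vec_continuous_operatorsI:
  assumes M: "space M \<noteq> {}" and \<Phi>: "locally_convex_topology \<Phi>" "nuclear_space \<Phi>"
    and \<Psi>: "locally_convex_topology \<Psi>"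
    and L: "linear_betw L (topspace \<Psi>) (bP_vec_carrier M F \<Phi>)" "\<And>x. x \<notin> topspace \<Psi> \<Longrightarrow> L x = 0"
    and le: "\<And>q. continuous_seminorm \<Phi> q \<Longrightarrow> \<exists>p. continuous_seminorm \<Psi> p \<and>
      (\<forall>x\<in>topspace \<Psi>. \<forall>z\<in>{0..} \<times> space M. q (L x z) \<le> p x)"
  shows "L \<in> continuous_operators \<Psi> (bP_vec M F \<Phi>)"
proof -
  have "continuous_map \<Psi> (bP_vec M F \<Phi>) L"
    by (rule sup_seminorms.continuous_map_into[OF sup_seminorms_bP_vec[OF M \<Phi>] \<Psi> L(1)]) (use le in blast)
  with L show ?thesis
    by (simp add: continuous_operators_def)
qed

lemma bP_opD:
  assumes "R \<in> bP_op M F E G"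
  shows "z \<in> {0..} \<times> space M \<Longrightarrow> R z \<in> continuous_operators E G"
    "z \<notin> {0..} \<times> space M \<Longrightarrow> R z = 0"
    "g \<in> dual G \<Longrightarrow> e \<in> topspace E \<Longrightarrow> (\<lambda>z. g (R z e)) \<in> borel_measurable (predictable_sigma M F)"
    "bounded_in E B \<Longrightarrow> g \<in> dual G \<Longrightarrow> \<exists>C. \<forall>e\<in>B. \<forall>z\<in>{0..} \<times> space M. \<bar>g (R z e)\<bar> \<le> C"
  using assms unfolding bP_op_def topspace_strong_dual by blast+

lemma bP_op_operator:
  assumes "locally_convex_topology E" "locally_convex_topology G" "R \<in> bP_op M F E G"
  shows "R z \<in> continuous_operators E G"
  using bP_opD(1,2)[OF assms(3), of z] subspace_0[OF subspace_continuous_operators[OF assms(1,2)]]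
  by (cases "z \<in> {0..} \<times> space M") auto

lemma bP_op_value:
  assumes "locally_convex_topology E" "locally_convex_topology G" "R \<in> bP_op M F E G" "e \<in> topspace E"
  shows "R z e \<in> topspace G"
  using linear_betwD(1)[OF continuous_operatorsD(1)[OF bP_op_operator[OF assms(1-3)]] assms(4)] .

lemma bP_op_uniform:
  assumes \<Psi>: "locally_convex_topology \<Psi>" "bornological \<Psi>"
    and \<Phi>: "locally_convex_topology \<Phi>" "nuclear_space \<Phi>"
    and R: "R \<in> bP_op M F \<Psi> \<Phi>" and q: "continuous_seminorm \<Phi> q"
  shows "\<exists>p. continuous_seminorm \<Psi> p \<and> (\<forall>z\<in>{0..} \<times> space M. \<forall>x\<in>topspace \<Psi>. q (R z x) \<le> p x)"
proof (rule bornological_equicontinuous[OF \<Psi>])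
  let ?Z = "{0::real..} \<times> space M"
  show "seminorm_on (topspace \<Psi>) (\<lambda>x. q (R z x))" for z
    using continuous_operators_seminorm[OF bP_op_operator[OF \<Psi>(1) \<Phi>(1) R] q]
    by (simp add: continuous_seminorm_def)
  fix B assume B: "bounded_in \<Psi> B"
  have "bounded_in \<Phi> ((\<lambda>(z, x). R z x) ` (?Z \<times> B))"
  proof (rule nuclear_weakly_bounded[OF \<Phi>])
    show "(\<lambda>(z, x). R z x) ` (?Z \<times> B) \<subseteq> topspace \<Phi>"
      using B bP_op_value[OF \<Psi>(1) \<Phi>(1) R] by (auto simp: bounded_in_def)
    show "\<exists>K. \<forall>y\<in>(\<lambda>(z, x). R z x) ` (?Z \<times> B). \<bar>f y\<bar> \<le> K" if "f \<in> dual \<Phi>" for f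
      using bP_opD(4)[OF R B that] by fastforce
  qed
  then obtain C where C: "\<forall>y\<in>(\<lambda>(z, x). R z x) ` (?Z \<times> B). q y \<le> C"
    using q unfolding bounded_in_iff[OF \<Phi>(1)] by blast
  then have "q (R z x) \<le> C" if "z \<in> ?Z" "x \<in> B" for z x
    using that by blast
  then show "\<exists>C. \<forall>z\<in>?Z. \<forall>x\<in>B. q (R z x) \<le> C"
    by blast
qed

section \<open>The four spaces\<close>

lemma flip_mem_continuous_operators:
  assumes M: "space M \<noteq> {}" and \<Psi>: "locally_convex_topology \<Psi>" "bornological \<Psi>"
    and \<Phi>: "locally_convex_topology \<Phi>" "nuclear_space \<Phi>" and R: "R \<in> bP_op M F \<Psi> \<Phi>"
  shows "(\<lambda>x z. R z x) \<in> continuous_operators \<Psi> (bP_vec M F \<Phi>)"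
proof (rule bP_vec_continuous_operatorsI[OF M \<Phi> \<Psi>(1)])
  have op: "R z \<in> continuous_operators \<Psi> \<Phi>" for z
    using bP_op_operator[OF \<Psi>(1) \<Phi>(1) R] .
  have "(\<lambda>z. R z x) \<in> bP_vec_carrier M F \<Phi>" if x: "x \<in> topspace \<Psi>" for x
  proof -
    have "(\<lambda>z. f (R z x)) \<in> bP_carrier M F" if f: "f \<in> dual \<Phi>" for f
      using bP_opD(3)[OF R f x] bP_opD(4)[OF R bounded_in_singleton[OF \<Psi>(1) x] f] bP_opD(2)[OF R]
        linear_betw_zero[OF dual_linear[OF f]]
      by (simp add: mem_bP_carrier_iff)
    then show ?thesis
      using bP_op_value[OF \<Psi>(1) \<Phi>(1) R x] bP_opD(2)[OF R] by (simp add: bP_vec_carrier_def)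
  qed
  then show "linear_betw (\<lambda>x z. R z x) (topspace \<Psi>) (bP_vec_carrier M F \<Phi>)"
    using linear_betwD(2,3)[OF continuous_operatorsD(1)[OF op]] subspace_bP_vec_carrier[OF \<Phi>(1)]
      locally_convex_topology_subspace[OF \<Psi>(1)]
    by (auto simp: linear_betw_def fun_eq_iff scaleR_fun_def)
  show "(\<lambda>z. R z x) = 0" if "x \<notin> topspace \<Psi>" for x
    using continuous_operatorsD(3)[OF op that] by (simp add: fun_eq_iff)
  show "\<exists>p. continuous_seminorm \<Psi> p \<and> (\<forall>x\<in>topspace \<Psi>. \<forall>z\<in>{0..} \<times> space M. q (R z x) \<le> p x)"
    if "continuous_seminorm \<Phi> q" for q
    using bP_op_uniform[OF \<Psi> \<Phi> R that] by blast
qed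

lemma flip_mem_bP_op:
  assumes M: "space M \<noteq> {}" and \<Psi>: "locally_convex_topology \<Psi>"
    and \<Phi>: "locally_convex_topology \<Phi>" "nuclear_space \<Phi>"
    and L: "L \<in> continuous_operators \<Psi> (bP_vec M F \<Phi>)"
  shows "(\<lambda>z x. L x z) \<in> bP_op M F \<Psi> \<Phi>"
proof -
  let ?Z = "{0::real..} \<times> space M"
  have lin: "linear_betw L (topspace \<Psi>) (bP_vec_carrier M F \<Phi>)"
    using continuous_operatorsD(1)[OF L] by simp
  have Lx: "L x \<in> bP_vec_carrier M F \<Phi>" if "x \<in> topspace \<Psi>" for x
    using linear_betwD(1)[OF lin that] .
  have L0: "L x = 0" if "x \<notin> topspace \<Psi>" for x
    using continuous_operatorsD(3)[OF L that] .
  have bound: "\<exists>p. continuous_seminorm \<Psi> p \<and> (\<forall>x\<in>topspace \<Psi>. \<forall>z\<in>?Z. q (L x z) \<le> p x)"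
    if q: "continuous_seminorm \<Phi> q" for q
  proof -
    obtain P where P: "continuous_seminorm (bP_vec M F \<Phi>) P"
      "\<forall>H\<in>bP_vec_carrier M F \<Phi>. \<forall>z\<in>?Z. q (H z) \<le> P H"
      using bP_vec_uniform_seminorm[OF M \<Phi> q] by blast
    show ?thesis
      using continuous_operators_seminorm[OF L P(1)] P(2) Lx by blast
  qed
  have "(\<lambda>x. L x z) \<in> continuous_operators \<Psi> \<Phi>" if z: "z \<in> ?Z" for z
  proof (rule continuous_operatorsI[OF \<Psi> \<Phi>(1)])
    show "linear_betw (\<lambda>x. L x z) (topspace \<Psi>) (topspace \<Phi>)"
      using lin bP_vec_value[OF \<Phi>(1) Lx, where z = z] locally_convex_topology_subspace[OF \<Phi>(1)]
      by (auto simp: linear_betw_def scaleR_fun_def)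
    show "\<exists>p. continuous_seminorm \<Psi> p \<and> (\<forall>x\<in>topspace \<Psi>. q (L x z) \<le> p x)"
      if "continuous_seminorm \<Phi> q" for q
      using bound[OF that] z by blast
  qed (simp add: L0)
  moreover have "(\<lambda>x. L x z) = 0" if "z \<notin> ?Z" for z
  proof
    show "L x z = 0 x" for x
      using L0[of x] bP_vec_carrierD(2)[OF Lx that] by (cases "x \<in> topspace \<Psi>") auto
  qed
  moreover have "(\<lambda>z. f (L x z)) \<in> borel_measurable (predictable_sigma M F)"
    if "f \<in> dual \<Phi>" "x \<in> topspace \<Psi>" for f x
    using bP_vec_carrierD(3)[OF Lx[OF that(2)] that(1)] by (simp add: mem_bP_carrier_iff)
  moreover have "\<exists>C. \<forall>x\<in>B. \<forall>z\<in>?Z. \<bar>f (L x z)\<bar> \<le> C" if B: "bounded_in \<Psi> B" and f: "f \<in> dual \<Phi>" for B f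
  proof -
    obtain p where p: "continuous_seminorm \<Psi> p" "\<forall>x\<in>topspace \<Psi>. \<forall>z\<in>?Z. \<bar>f (L x z)\<bar> \<le> p x"
      using bound[OF dual_seminorm[OF f]] by blast
    obtain C where C: "\<forall>x\<in>B. p x \<le> C" "B \<subseteq> topspace \<Psi>"
      using B p(1) unfolding bounded_in_iff[OF \<Psi>] by blast
    have "\<bar>f (L x z)\<bar> \<le> C" if "x \<in> B" "z \<in> ?Z" for x z
      using p(2) C that order_trans[of "\<bar>f (L x z)\<bar>" "p x" C] by blast
    then show ?thesis
      by blast
  qed
  ultimately show ?thesis
    by (simp add: bP_op_def)
qed

definition pairing_operator :: "'a::real_vector topology \<Rightarrow> ('b \<Rightarrow> 'z \<Rightarrow> 'a) \<Rightarrow> 'b \<Rightarrow> ('a \<Rightarrow> real) \<Rightarrow> 'z \<Rightarrow> real" where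
  "pairing_operator \<Phi> L = (\<lambda>x f. if f \<in> dual \<Phi> then (\<lambda>z. f (L x z)) else 0)"

lemma pairing_mem_continuous_operators:
  assumes M: "space M \<noteq> {}" and \<Psi>: "locally_convex_topology \<Psi>"
    and \<Phi>: "locally_convex_topology \<Phi>" "nuclear_space \<Phi>" "barrelled \<Phi>"
    and L: "L \<in> continuous_operators \<Psi> (bP_vec M F \<Phi>)"
  shows "pairing_operator \<Phi> L \<in> continuous_operators \<Psi> (Lb (strong_dual \<Phi>) (bP M F))"
proof -
  let ?Z = "{0::real..} \<times> space M"
  note bP = locally_convex_topology_bP[OF M] and dual_lct = locally_convex_topology_strong_dual[OF \<Phi>(1)]
  have linL: "linear_betw L (topspace \<Psi>) (bP_vec_carrier M F \<Phi>)"
    using continuous_operatorsD(1)[OF L] by simp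
  have Lx: "L x \<in> bP_vec_carrier M F \<Phi>" if "x \<in> topspace \<Psi>" for x
    using linear_betwD(1)[OF linL that] .
  have fin: "(\<lambda>z. f (L x z)) \<in> bP_carrier M F" if "f \<in> dual \<Phi>" "x \<in> topspace \<Psi>" for f x
    using bP_vec_carrierD(3)[OF Lx[OF that(2)] that(1)] .
  have op: "pairing_operator \<Phi> L x \<in> continuous_operators (strong_dual \<Phi>) (bP M F)" if x: "x \<in> topspace \<Psi>" for x
  proof (rule continuous_operatorsI[OF dual_lct bP])
    show "linear_betw (pairing_operator \<Phi> L x) (topspace (strong_dual \<Phi>)) (topspace (bP M F))"
      using fin[OF _ x] subspace_dual[OF \<Phi>(1)] subspace_bP_carrier
      by (auto simp: linear_betw_def pairing_operator_def subspace_add subspace_scale fun_eq_iff)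
         (simp add: scaleR_fun_def)
    obtain P where P: "continuous_seminorm (strong_dual \<Phi>) P" "\<forall>f\<in>dual \<Phi>. \<forall>y\<in>L x ` ?Z. \<bar>f y\<bar> \<le> P f"
      using strong_dual_uniform_seminorm[OF \<Phi>(1) bP_vec_bounded[OF \<Phi>(1,2) Lx[OF x]]] by blast
    fix q assume q: "continuous_seminorm (bP M F) q"
    obtain C where C: "0 \<le> C"
      "\<And>h c. h \<in> bP_carrier M F \<Longrightarrow> (\<forall>z\<in>?Z. \<bar>h z\<bar> \<le> c) \<Longrightarrow> q h \<le> C * c"
      using bP_seminorm_bound[OF M q] by blast
    have "q (pairing_operator \<Phi> L x f) \<le> C * P f" if "f \<in> dual \<Phi>" for f
      using C(2)[OF fin[OF that x], of "P f"] P(2) that by (simp add: pairing_operator_def)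
    then show "\<exists>p. continuous_seminorm (strong_dual \<Phi>) p \<and>
        (\<forall>f\<in>topspace (strong_dual \<Phi>). q (pairing_operator \<Phi> L x f) \<le> p f)"
      using continuous_seminorm_cmult[OF P(1) C(1)] by auto
  qed (simp add: pairing_operator_def)
  show ?thesis
  proof (rule Lb_continuous_operatorsI[OF \<Psi> dual_lct bP])
    have add: "pairing_operator \<Phi> L (x + y) = pairing_operator \<Phi> L x + pairing_operator \<Phi> L y"
      if "x \<in> topspace \<Psi>" "y \<in> topspace \<Psi>" for x y
      using linear_betwD(2)[OF linL that] linear_betwD(2)[OF dual_linear
          bP_vec_value[OF \<Phi>(1) Lx[OF that(1)]] bP_vec_value[OF \<Phi>(1) Lx[OF that(2)]]]
      by (simp add: pairing_operator_def fun_eq_iff)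
    have scale: "pairing_operator \<Phi> L (c *\<^sub>R x) = c *\<^sub>R pairing_operator \<Phi> L x"
      if "x \<in> topspace \<Psi>" for x c
      using linear_betwD(3)[OF linL that] linear_betwD(3)[OF dual_linear bP_vec_value[OF \<Phi>(1) Lx[OF that]]]
      by (simp add: pairing_operator_def fun_eq_iff scaleR_fun_def)
    show "linear_betw (pairing_operator \<Phi> L) (topspace \<Psi>) (continuous_operators (strong_dual \<Phi>) (bP M F))"
      unfolding linear_betw_def
      using op add scale locally_convex_topology_subspace[OF \<Psi>] subspace_continuous_operators[OF dual_lct bP]
      by blast
    show "pairing_operator \<Phi> L x = 0" if "x \<notin> topspace \<Psi>" for x
      using continuous_operatorsD(3)[OF L that] linear_betw_zero[OF dual_linear[where E = \<Phi>]]
      by (simp add: pairing_operator_def fun_eq_iff)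
    fix B q assume B: "bounded_in (strong_dual \<Phi>) B" and q: "continuous_seminorm (bP M F) q"
    obtain C where C: "0 \<le> C"
      "\<And>h c. h \<in> bP_carrier M F \<Longrightarrow> (\<forall>z\<in>?Z. \<bar>h z\<bar> \<le> c) \<Longrightarrow> q h \<le> C * c"
      using bP_seminorm_bound[OF M q] by blast
    obtain p where p: "continuous_seminorm \<Phi> p" "\<forall>f\<in>B. \<forall>y\<in>topspace \<Phi>. \<bar>f y\<bar> \<le> p y"
      using strongly_bounded_equicontinuous[OF \<Phi>(1,3) B] by blast
    obtain P where P: "continuous_seminorm (bP_vec M F \<Phi>) P"
      "\<forall>H\<in>bP_vec_carrier M F \<Phi>. \<forall>z\<in>?Z. p (H z) \<le> P H"
      using bP_vec_uniform_seminorm[OF M \<Phi>(1,2) p(1)] by blast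
    have "q (pairing_operator \<Phi> L x f) \<le> C * P (L x)" if x: "x \<in> topspace \<Psi>" and f: "f \<in> B" for x f
    proof -
      have fd: "f \<in> dual \<Phi>"
        using B f by (auto simp: bounded_in_def)
      have "\<bar>f (L x z)\<bar> \<le> P (L x)" if z: "z \<in> ?Z" for z
      proof -
        have "\<bar>f (L x z)\<bar> \<le> p (L x z)"
          using p(2) f bP_vec_value[OF \<Phi>(1) Lx[OF x]] by blast
        also have "\<dots> \<le> P (L x)"
          using P(2) Lx[OF x] z by blast
        finally show ?thesis .
      qed
      then show ?thesis
        using C(2)[OF fin[OF fd x], of "P (L x)"] fd by (simp add: pairing_operator_def)
    qed
    then show "\<exists>p. continuous_seminorm \<Psi> p \<and>
        (\<forall>x\<in>topspace \<Psi>. \<forall>f\<in>B. q (pairing_operator \<Phi> L x f) \<le> p x)"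
      using continuous_seminorm_cmult[OF continuous_operators_seminorm[OF L P(1)] C(1)]
      by (intro exI[of _ "\<lambda>x. C * P (L x)"]) auto
  qed
qed

lemma pairing_surj:
  assumes M: "space M \<noteq> {}" and \<Psi>: "locally_convex_topology \<Psi>"
    and \<Phi>: "locally_convex_space \<Phi>" "nuclear_space \<Phi>" "complete_lcs \<Phi>"
    and K: "K \<in> continuous_operators \<Psi> (Lb (strong_dual \<Phi>) (bP M F))"
  shows "\<exists>L\<in>continuous_operators \<Psi> (bP_vec M F \<Phi>). pairing_operator \<Phi> L = K"
proof -
  let ?Z = "{0::real..} \<times> space M"
  have lct: "locally_convex_topology \<Phi>"
    using \<Phi>(1) by (rule locally_convex_space_topology)
  note bP = locally_convex_topology_bP[OF M] and dual_lct = locally_convex_topology_strong_dual[OF lct]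
  have S: "subspace (topspace \<Psi>)" "subspace (topspace \<Phi>)"
    using \<Psi> lct by (auto intro: locally_convex_topology_subspace)
  have linK: "linear_betw K (topspace \<Psi>) (continuous_operators (strong_dual \<Phi>) (bP M F))"
    using continuous_operatorsD(1)[OF K] by simp
  have Kx: "K x \<in> continuous_operators (strong_dual \<Phi>) (bP M F)" if "x \<in> topspace \<Psi>" for x
    using linear_betwD(1)[OF linK that] .
  have linKx: "linear_betw (K x) (dual \<Phi>) (bP_carrier M F)" if "x \<in> topspace \<Psi>" for x
    using continuous_operatorsD(1)[OF Kx[OF that]] by simp
  obtain P where P: "continuous_seminorm (bP M F) P" "\<forall>h\<in>bP_carrier M F. \<forall>z\<in>?Z. \<bar>h z\<bar> \<le> P h"
    using bP_uniform_seminorm[OF M] by blast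
  have "\<exists>y\<in>topspace \<Phi>. \<forall>f\<in>dual \<Phi>. K x f z = f y" if x: "x \<in> topspace \<Psi>" and z: "z \<in> ?Z" for x z
  proof -
    have "(\<lambda>f. K x f z) \<in> dual (strong_dual \<Phi>)"
    proof (rule dualI[OF dual_lct])
      show "linear_betw (\<lambda>f. K x f z) (topspace (strong_dual \<Phi>)) UNIV"
        using linKx[OF x] by (simp add: linear_betw_def scaleR_fun_def)
      show "continuous_seminorm (strong_dual \<Phi>) (\<lambda>f. P (K x f))"
        by (rule continuous_operators_seminorm[OF Kx[OF x] P(1)])
      show "\<bar>K x f z\<bar> \<le> P (K x f)" if "f \<in> topspace (strong_dual \<Phi>)" for f
        using P(2) linear_betwD(1)[OF linKx[OF x], of f] that z by simp
    qed (use continuous_operatorsD(3)[OF Kx[OF x]] in auto)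
    from complete_nuclear_semireflexive[OF lct \<Phi>(2,3) this] show ?thesis .
  qed
  then obtain y where y: "\<And>x z. x \<in> topspace \<Psi> \<Longrightarrow> z \<in> ?Z \<Longrightarrow> y x z \<in> topspace \<Phi>"
    "\<And>x z f. x \<in> topspace \<Psi> \<Longrightarrow> z \<in> ?Z \<Longrightarrow> f \<in> dual \<Phi> \<Longrightarrow> K x f z = f (y x z)"
    by metis
  define L where "L x z = (if x \<in> topspace \<Psi> \<and> z \<in> ?Z then y x z else 0)" for x z
  have LS: "L x z \<in> topspace \<Phi>" for x z
    using y subspace_0[OF S(2)] by (simp add: L_def)
  have fL: "f (L x z) = K x f z" if f: "f \<in> dual \<Phi>" for f x z
  proof (cases "x \<in> topspace \<Psi> \<and> z \<in> ?Z")
    case True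
    then show ?thesis
      using y(2) f by (simp add: L_def)
  next
    case False
    have "K x f z = 0"
    proof (cases "x \<in> topspace \<Psi>")
      case True
      then show ?thesis
        using False linear_betwD(1)[OF linKx[OF True] f] by (simp add: mem_bP_carrier_iff)
    qed (simp add: continuous_operatorsD(3)[OF K])
    moreover have "L x z = 0"
      unfolding L_def using False by (rule if_not_P)
    ultimately show ?thesis
      using linear_betw_zero[OF dual_linear[OF f]] by simp
  qed
  have eqI: "u = v" if "u \<in> topspace \<Phi>" "v \<in> topspace \<Phi>" "\<And>f. f \<in> dual \<Phi> \<Longrightarrow> f u = f v" for u v
    using nuclear_dual_separates[OF \<Phi>(1,2) that] .
  have "L \<in> continuous_operators \<Psi> (bP_vec M F \<Phi>)"
  proof (rule bP_vec_continuous_operatorsI[OF M lct \<Phi>(2) \<Psi>])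
    have "L x \<in> bP_vec_carrier M F \<Phi>" if x: "x \<in> topspace \<Psi>" for x
    proof -
      have "(\<lambda>z. f (L x z)) \<in> bP_carrier M F" if f: "f \<in> dual \<Phi>" for f
        using linear_betwD(1)[OF linKx[OF x] f] by (simp add: fL f)
      moreover have "L x z = 0" if "z \<notin> ?Z" for z
        unfolding L_def using that by (intro if_not_P) blast
      ultimately show ?thesis
        using LS by (simp add: bP_vec_carrier_def)
    qed
    moreover have "L (x + x') = L x + L x'" if x: "x \<in> topspace \<Psi>" "x' \<in> topspace \<Psi>" for x x'
    proof
      fix z
      have "L (x + x') z = L x z + L x' z"
      proof (rule eqI)
        show "f (L (x + x') z) = f (L x z + L x' z)" if f: "f \<in> dual \<Phi>" for f
          using linear_betwD(2)[OF linK x] linear_betwD(2)[OF dual_linear[OF f] LS LS] by (simp add: fL f)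
      qed (intro LS subspace_add[OF S(2)])+
      then show "L (x + x') z = (L x + L x') z"
        by simp
    qed
    moreover have "L (c *\<^sub>R x) = c *\<^sub>R L x" if x: "x \<in> topspace \<Psi>" for x c
    proof
      fix z
      have "L (c *\<^sub>R x) z = c *\<^sub>R L x z"
      proof (rule eqI)
        show "f (L (c *\<^sub>R x) z) = f (c *\<^sub>R L x z)" if f: "f \<in> dual \<Phi>" for f
          using linear_betwD(3)[OF linK x] linear_betwD(3)[OF dual_linear[OF f] LS]
          by (simp add: fL f scaleR_fun_def)
      qed (intro LS subspace_scale[OF S(2)])+
      then show "L (c *\<^sub>R x) z = (c *\<^sub>R L x) z"
        by (simp add: scaleR_fun_def)
    qed
    ultimately show "linear_betw L (topspace \<Psi>) (bP_vec_carrier M F \<Phi>)"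
      unfolding linear_betw_def using S subspace_bP_vec_carrier[OF lct] by blast
    show "L x = 0" if "x \<notin> topspace \<Psi>" for x
      using that by (simp add: L_def fun_eq_iff)
    fix p assume p: "continuous_seminorm \<Phi> p"
    obtain q where q: "continuous_seminorm \<Phi> q"
      "\<And>x. x \<in> topspace \<Phi> \<Longrightarrow> \<exists>g\<in>dual \<Phi>. (\<forall>u\<in>topspace \<Phi>. \<bar>g u\<bar> \<le> q u) \<and> p x \<le> \<bar>g x\<bar>"
      using nuclear_norming[OF lct \<Phi>(2) p] by blast
    let ?Q = "{g \<in> dual \<Phi>. \<forall>u\<in>topspace \<Phi>. \<bar>g u\<bar> \<le> q u}"
    have Q: "bounded_in (strong_dual \<Phi>) ?Q"
      by (rule equicontinuous_bounded[OF lct q(1)]) auto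
    obtain r where r: "continuous_seminorm (Lb (strong_dual \<Phi>) (bP M F)) r"
      "\<And>A f. A \<in> continuous_operators (strong_dual \<Phi>) (bP M F) \<Longrightarrow> f \<in> ?Q \<Longrightarrow> P (A f) \<le> r A"
      using Lb_uniform_seminorm[OF dual_lct bP Q P(1)] by blast
    have "p (L x z) \<le> r (K x)" if x: "x \<in> topspace \<Psi>" and z: "z \<in> ?Z" for x z
    proof -
      obtain g where g: "g \<in> ?Q" "p (L x z) \<le> \<bar>g (L x z)\<bar>"
        using q(2)[OF LS[of x z]] by blast
      have "\<bar>g (L x z)\<bar> \<le> P (K x g)"
        using P(2) linear_betwD(1)[OF linKx[OF x]] g(1) z by (simp add: fL)
      also have "\<dots> \<le> r (K x)"
        by (rule r(2)[OF Kx[OF x] g(1)])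
      finally show ?thesis
        using g(2) by simp
    qed
    then show "\<exists>r. continuous_seminorm \<Psi> r \<and> (\<forall>x\<in>topspace \<Psi>. \<forall>z\<in>?Z. p (L x z) \<le> r x)"
      using continuous_operators_seminorm[OF K r(1)] by blast
  qed
  moreover have "pairing_operator \<Phi> L = K"
  proof (intro ext)
    show "pairing_operator \<Phi> L x f z = K x f z" for x f z
    proof (cases "f \<in> dual \<Phi>")
      case False
      then have "K x f = 0"
        using continuous_operatorsD(3)[OF Kx, of x f] continuous_operatorsD(3)[OF K, of x]
        by (cases "x \<in> topspace \<Psi>") auto
      with False show ?thesis
        by (simp add: pairing_operator_def)
    qed (simp add: pairing_operator_def fL)
  qed
  ultimately show ?thesis
    by blast
qed

definition transpose_process ::
    "'a::real_vector topology \<Rightarrow> ('z \<Rightarrow> 'b \<Rightarrow> 'a) \<Rightarrow> 'z \<Rightarrow> ('a \<Rightarrow> real) \<Rightarrow> 'b \<Rightarrow> real" where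
  "transpose_process \<Phi> R = (\<lambda>z f. if f \<in> dual \<Phi> then (\<lambda>x. f (R z x)) else 0)"

lemma transpose_mem_bP_op:
  assumes \<Psi>: "locally_convex_topology \<Psi>" "bornological \<Psi>" "nuclear_space \<Psi>"
    and \<Phi>: "locally_convex_topology \<Phi>" "nuclear_space \<Phi>" "barrelled \<Phi>"
    and R: "R \<in> bP_op M F \<Psi> \<Phi>"
  shows "transpose_process \<Phi> R \<in> bP_op M F (strong_dual \<Phi>) (strong_dual \<Psi>)"
proof -
  let ?Z = "{0::real..} \<times> space M"
  note dual_lct = locally_convex_topology_strong_dual[OF \<Phi>(1)] locally_convex_topology_strong_dual[OF \<Psi>(1)]
  have op: "R z \<in> continuous_operators \<Psi> \<Phi>" for z
    using bP_op_operator[OF \<Psi>(1) \<Phi>(1) R] .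
  have linR: "linear_betw (R z) (topspace \<Psi>) (topspace \<Phi>)" for z
    using continuous_operatorsD(1)[OF op] .
  have T: "transpose_process \<Phi> R z f = (\<lambda>x. f (R z x))" if "f \<in> dual \<Phi>" for z f
    using that by (simp add: transpose_process_def)
  have mem: "transpose_process \<Phi> R z f \<in> dual \<Psi>" if f: "f \<in> dual \<Phi>" for z f
  proof (rule dualI[OF \<Psi>(1)])
    show "linear_betw (transpose_process \<Phi> R z f) (topspace \<Psi>) UNIV"
      using locally_convex_topology_subspace[OF \<Psi>(1)]
      by (simp add: linear_betw_def T f linear_betwD[OF linR] linear_betwD[OF dual_linear[OF f]])
    show "continuous_seminorm \<Psi> (\<lambda>x. \<bar>f (R z x)\<bar>)"
      by (rule continuous_operators_seminorm[OF op dual_seminorm[OF f]])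
  qed (use continuous_operatorsD(3)[OF op] linear_betw_zero[OF dual_linear[OF f]] in \<open>auto simp: T f\<close>)
  have "transpose_process \<Phi> R z \<in> continuous_operators (strong_dual \<Phi>) (strong_dual \<Psi>)" for z
    unfolding strong_dual_def[of \<Psi>]
  proof (rule Lb_continuous_operatorsI[OF dual_lct(1) \<Psi>(1) locally_convex_topology_euclideanreal])
    show "linear_betw (transpose_process \<Phi> R z) (topspace (strong_dual \<Phi>)) (dual \<Psi>)"
      using mem[where z = z] subspace_dual[OF \<Phi>(1)] subspace_dual[OF \<Psi>(1)]
      by (auto simp: linear_betw_def T subspace_add subspace_scale fun_eq_iff)
         (simp add: scaleR_fun_def)
    show "transpose_process \<Phi> R z f = 0" if "f \<notin> topspace (strong_dual \<Phi>)" for f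
      using that by (simp add: transpose_process_def)
    fix B q assume B: "bounded_in \<Psi> B" and q: "continuous_seminorm euclideanreal q"
    obtain P where P: "continuous_seminorm (strong_dual \<Phi>) P"
      "\<And>f y. f \<in> dual \<Phi> \<Longrightarrow> y \<in> R z ` B \<Longrightarrow> q (f y) \<le> P f"
      using Lb_uniform_seminorm[OF \<Phi>(1) locally_convex_topology_euclideanreal
          bounded_in_continuous_image[OF \<Psi>(1) \<Phi>(1) op B] q]
      unfolding strong_dual_def by blast
    then show "\<exists>p. continuous_seminorm (strong_dual \<Phi>) p \<and>
        (\<forall>f\<in>topspace (strong_dual \<Phi>). \<forall>x\<in>B. q (transpose_process \<Phi> R z f x) \<le> p f)"
      by (intro exI[of _ P]) (auto simp: T)
  qed
  moreover have "transpose_process \<Phi> R z = 0" if "z \<notin> ?Z" for z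
    using bP_opD(2)[OF R that] linear_betw_zero[OF dual_linear[where E = \<Phi>]]
    by (auto simp: transpose_process_def fun_eq_iff)
  moreover have "(\<lambda>z. g (transpose_process \<Phi> R z f)) \<in> borel_measurable (predictable_sigma M F)"
    if g: "g \<in> dual (strong_dual \<Psi>)" and f: "f \<in> dual \<Phi>" for g f
  proof -
    obtain p where p: "continuous_seminorm \<Psi> p" "\<forall>z\<in>?Z. \<forall>x\<in>topspace \<Psi>. \<bar>f (R z x)\<bar> \<le> p x"
      using bP_op_uniform[OF \<Psi>(1,2) \<Phi>(1,2) R dual_seminorm[OF f]] by blast
    obtain x t where x: "\<And>N::nat. x N \<in> topspace \<Psi>" and t: "t \<longlonglongrightarrow> 0"
      and le: "\<And>h N. h \<in> dual \<Psi> \<Longrightarrow> (\<forall>u\<in>topspace \<Psi>. \<bar>h u\<bar> \<le> p u) \<Longrightarrow> \<bar>g h - h (x N)\<bar> \<le> t N"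
      using nuclear_bidual_approximation[OF \<Psi>(1,3) g p(1)] by blast
    show ?thesis
    proof (rule borel_measurable_LIMSEQ_real)
      show "(\<lambda>z. f (R z (x N))) \<in> borel_measurable (predictable_sigma M F)" for N
        by (rule bP_opD(3)[OF R f x])
      fix z assume "z \<in> space (predictable_sigma M F)"
      then have z: "z \<in> ?Z" by simp
      have "\<bar>g (transpose_process \<Phi> R z f) - f (R z (x N))\<bar> \<le> t N" for N
        using le[OF mem[OF f, of z], of N] p(2) z by (simp add: T f)
      then have "(\<lambda>N. g (transpose_process \<Phi> R z f) - f (R z (x N))) \<longlonglongrightarrow> 0"
        by (intro Lim_null_comparison[OF _ t]) auto
      from tendsto_diff[OF tendsto_const[of "g (transpose_process \<Phi> R z f)"] this]
      show "(\<lambda>N. f (R z (x N))) \<longlonglongrightarrow> g (transpose_process \<Phi> R z f)"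
        by simp
    qed
  qed
  moreover have "\<exists>C. \<forall>f\<in>B. \<forall>z\<in>?Z. \<bar>g (transpose_process \<Phi> R z f)\<bar> \<le> C"
    if B: "bounded_in (strong_dual \<Phi>) B" and g: "g \<in> dual (strong_dual \<Psi>)" for B g
  proof -
    have BD: "B \<subseteq> dual \<Phi>"
      using B by (simp add: bounded_in_def)
    obtain p where p: "continuous_seminorm \<Phi> p" "\<forall>f\<in>B. \<forall>y\<in>topspace \<Phi>. \<bar>f y\<bar> \<le> p y"
      using strongly_bounded_equicontinuous[OF \<Phi>(1,3) B] by blast
    obtain r where r: "continuous_seminorm \<Psi> r" "\<forall>z\<in>?Z. \<forall>x\<in>topspace \<Psi>. p (R z x) \<le> r x"
      using bP_op_uniform[OF \<Psi>(1,2) \<Phi>(1,2) R p(1)] by blast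
    let ?H = "{transpose_process \<Phi> R z f | f z. f \<in> B \<and> z \<in> ?Z}"
    have "bounded_in (strong_dual \<Psi>) ?H"
    proof (rule equicontinuous_bounded[OF \<Psi>(1) r(1)])
      show "?H \<subseteq> dual \<Psi>"
        using mem BD by blast
      fix h x assume "h \<in> ?H" and x: "x \<in> topspace \<Psi>"
      then obtain f z where fz: "f \<in> B" "z \<in> ?Z" "h = transpose_process \<Phi> R z f"
        by blast
      then have "h x = f (R z x)"
        using BD by (simp add: T subset_iff)
      then have "\<bar>h x\<bar> \<le> p (R z x)"
        using p(2) linear_betwD(1)[OF linR x] fz(1) by simp
      also have "\<dots> \<le> r x"
        using r(2) fz(2) x by blast
      finally show "\<bar>h x\<bar> \<le> r x" .
    qed
    then obtain C where C: "\<forall>h\<in>?H. \<bar>g h\<bar> \<le> C"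
      using dual_bounded[OF dual_lct(2) g] by blast
    then have "\<bar>g (transpose_process \<Phi> R z f)\<bar> \<le> C" if "f \<in> B" "z \<in> ?Z" for f z
      using that by blast
    then show ?thesis
      by blast
  qed
  ultimately show ?thesis
    by (simp add: bP_op_def)
qed

lemma transpose_surj:
  assumes \<Psi>: "locally_convex_topology \<Psi>" "bornological \<Psi>" "quasi_complete \<Psi>"
    and \<Phi>: "locally_convex_space \<Phi>" "nuclear_space \<Phi>" "complete_lcs \<Phi>"
    and Q: "Q \<in> bP_op M F (strong_dual \<Phi>) (strong_dual \<Psi>)"
  shows "\<exists>R\<in>bP_op M F \<Psi> \<Phi>. transpose_process \<Phi> R = Q"
proof -
  let ?Z = "{0::real..} \<times> space M"
  have lct: "locally_convex_topology \<Phi>"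
    using \<Phi>(1) by (rule locally_convex_space_topology)
  note dual_lct = locally_convex_topology_strong_dual[OF lct] locally_convex_topology_strong_dual[OF \<Psi>(1)]
  have op: "Q z \<in> continuous_operators (strong_dual \<Phi>) (strong_dual \<Psi>)" for z
    using bP_op_operator[OF dual_lct Q] .
  have mem: "Q z f \<in> dual \<Psi>" if "f \<in> dual \<Phi>" for z f
    using linear_betwD(1)[OF continuous_operatorsD(1)[OF op], of f z] that by simp
  have "\<exists>A\<in>continuous_operators \<Psi> \<Phi>. \<forall>f\<in>dual \<Phi>. \<forall>x\<in>topspace \<Psi>. f (A x) = Q z f x" for z
    by (rule dual_operator_exists[OF \<Psi>(1,2) \<Phi> op])
  then obtain A where A: "\<And>z. A z \<in> continuous_operators \<Psi> \<Phi>"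
    "\<And>z f x. f \<in> dual \<Phi> \<Longrightarrow> x \<in> topspace \<Psi> \<Longrightarrow> f (A z x) = Q z f x"
    by metis
  define R where "R z = (if z \<in> ?Z then A z else 0)" for z
  have R0: "R z = 0" if "z \<notin> ?Z" for z
    using that by (auto simp: R_def)
  have RA: "R z \<in> continuous_operators \<Psi> \<Phi>" for z
    using A(1) subspace_0[OF subspace_continuous_operators[OF \<Psi>(1) lct]] by (simp add: R_def)
  have fR: "f (R z x) = Q z f x" if f: "f \<in> dual \<Phi>" for f z x
  proof (cases "z \<in> ?Z")
    case True
    show ?thesis
    proof (cases "x \<in> topspace \<Psi>")
      case True
      then show ?thesis
        using A(2)[OF f True] \<open>z \<in> ?Z\<close> by (simp add: R_def)
    next
      case False
      then show ?thesis
        using continuous_operatorsD(3)[OF RA False] continuous_operatorsD(3)[OF mem[OF f] False]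
          linear_betw_zero[OF dual_linear[OF f]] by simp
    qed
  next
    case False
    then show ?thesis
      using R0[OF False] bP_opD(2)[OF Q False] linear_betw_zero[OF dual_linear[OF f]] by simp
  qed
  have ev: "(\<lambda>h. if h \<in> dual \<Psi> then h x else 0) \<in> dual (strong_dual \<Psi>)" if "x \<in> topspace \<Psi>" for x
    by (rule evaluation_mem_bidual[OF \<Psi>(1) that])
  have "(\<lambda>z. f (R z x)) \<in> borel_measurable (predictable_sigma M F)"
    if f: "f \<in> dual \<Phi>" and x: "x \<in> topspace \<Psi>" for f x
    using bP_opD(3)[OF Q ev[OF x], of f] f by (simp add: fR mem)
  moreover have "\<exists>C. \<forall>x\<in>B. \<forall>z\<in>?Z. \<bar>f (R z x)\<bar> \<le> C" if B: "bounded_in \<Psi> B" and f: "f \<in> dual \<Phi>" for B f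
  proof -
    have "\<exists>K. \<forall>h\<in>(\<lambda>z. Q z f) ` ?Z. \<forall>x\<in>B. \<bar>h x\<bar> \<le> K"
    proof (rule quasi_complete_uniform_boundedness[OF \<Psi>(1,3) B])
      show "(\<lambda>z. Q z f) ` ?Z \<subseteq> dual \<Psi>"
        using mem[OF f] by blast
      show "\<exists>K. \<forall>h\<in>(\<lambda>z. Q z f) ` ?Z. \<bar>h x\<bar> \<le> K" if x: "x \<in> topspace \<Psi>" for x
        using bP_opD(4)[OF Q bounded_in_singleton[OF dual_lct(1), of f] ev[OF x]] f by (simp add: mem)
    qed
    then obtain K where "\<forall>h\<in>(\<lambda>z. Q z f) ` ?Z. \<forall>x\<in>B. \<bar>h x\<bar> \<le> K"
      by blast
    then have "\<forall>x\<in>B. \<forall>z\<in>?Z. \<bar>f (R z x)\<bar> \<le> K"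
      by (simp add: fR[OF f])
    then show ?thesis
      by blast
  qed
  ultimately have "R \<in> bP_op M F \<Psi> \<Phi>"
    using RA R0 by (simp add: bP_op_def)
  moreover have "transpose_process \<Phi> R = Q"
  proof (intro ext)
    show "transpose_process \<Phi> R z f x = Q z f x" for z f x
      using continuous_operatorsD(3)[OF op, of f z] by (simp add: transpose_process_def fR)
  qed
  ultimately show ?thesis
    by blast
qed

lemma tilde_transpose:
  assumes \<Psi>: "locally_convex_topology \<Psi>" and \<Phi>: "locally_convex_space \<Phi>" "nuclear_space \<Phi>"
    and R: "R \<in> bP_op M F \<Psi> \<Phi>"
  shows "tilde \<Psi> \<Phi> (transpose_process \<Phi> R) = (\<lambda>x z. R z x)"
proof -
  have "dual_operator \<Psi> \<Phi> (transpose_process \<Phi> R z) = R z" for z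
    using bP_op_operator[OF \<Psi> locally_convex_space_topology[OF \<Phi>(1)] R]
    by (rule dual_operator_eqI[OF \<Phi>]) (simp add: transpose_process_def)
  then show ?thesis
    by (simp add: tilde_def)
qed

section \<open>Linear isomorphisms\<close>

lemma linear_isomorphismI:
  assumes S: "subspace S" and add: "\<And>x y. x \<in> S \<Longrightarrow> y \<in> S \<Longrightarrow> f (x + y) = f x + f y"
    and scale: "\<And>c x. x \<in> S \<Longrightarrow> f (c *\<^sub>R x) = c *\<^sub>R f x"
    and bij: "inj_on f S" "f ` S = T"
  shows "linear_isomorphism f S T"
proof -
  have "subspace (f ` S)"
    unfolding subspace_def
  proof (intro conjI ballI allI)
    show "0 \<in> f ` S"
      using scale[of 0 0] subspace_0[OF S] by force
    show "x + y \<in> f ` S" if "x \<in> f ` S" "y \<in> f ` S" for x y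
      using that subspace_add[OF S] by (auto simp flip: add)
    show "c *\<^sub>R x \<in> f ` S" if "x \<in> f ` S" for x c
      using that subspace_scale[OF S] by (auto simp flip: scale)
  qed
  with assms show ?thesis
    by (auto simp: linear_isomorphism_def linear_betw_def bij_betw_def)
qed

lemma linear_isomorphism_trans:
  assumes "linear_isomorphism f S T" "linear_isomorphism g T U"
  shows "linear_isomorphism (\<lambda>x. g (f x)) S U"
  using assms bij_betw_trans[of f S T g U]
  by (auto simp: linear_isomorphism_def linear_betw_def o_def image_subset_iff)

lemma linear_isomorphism_sym:
  assumes "linear_isomorphism f S T"
  shows "linear_isomorphism (inv_into S f) T S"
proof -
  let ?g = "inv_into S f"
  have S: "subspace S" and T: "subspace T" and add: "\<And>x y. x \<in> S \<Longrightarrow> y \<in> S \<Longrightarrow> f (x + y) = f x + f y"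
    and scale: "\<And>c x. x \<in> S \<Longrightarrow> f (c *\<^sub>R x) = c *\<^sub>R f x" and bij: "bij_betw f S T"
    using assms by (auto simp: linear_isomorphism_def linear_betw_def)
  have g: "?g y \<in> S" "f (?g y) = y" if "y \<in> T" for y
    using bij that by (auto simp: bij_betw_def inv_into_into f_inv_into_f)
  have gf: "?g (f x) = x" if "x \<in> S" for x
    using bij that by (simp add: bij_betw_def)
  show ?thesis
  proof (rule linear_isomorphismI[OF T])
    show "?g (x + y) = ?g x + ?g y" if "x \<in> T" "y \<in> T" for x y
      using gf[of "?g x + ?g y"] g that subspace_add[OF S] add by simp
    show "?g (c *\<^sub>R x) = c *\<^sub>R ?g x" if "x \<in> T" for c x
      using gf[of "c *\<^sub>R ?g x"] g that subspace_scale[OF S] scale by simp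
    show "inj_on ?g T" "?g ` T = S"
      using bij_betw_inv_into[OF bij] by (auto simp: bij_betw_def)
  qed
qed

lemma linear_isomorphism_cong:
  assumes f: "linear_isomorphism f S T" and eq: "\<And>x. x \<in> S \<Longrightarrow> g x = f x"
  shows "linear_isomorphism g S T"
proof (rule linear_isomorphismI)
  have S: "subspace S"
    using f by (simp add: linear_isomorphism_def linear_betw_def)
  then show "subspace S" .
  show "g (x + y) = g x + g y" if "x \<in> S" "y \<in> S" for x y
    using f that subspace_add[OF S] by (simp add: eq linear_isomorphism_def linear_betw_def)
  show "g (c *\<^sub>R x) = c *\<^sub>R g x" if "x \<in> S" for c x
    using f that subspace_scale[OF S] by (simp add: eq linear_isomorphism_def linear_betw_def)
  show "inj_on g S" "g ` S = T"
    using f eq by (auto simp: linear_isomorphism_def bij_betw_def cong: inj_on_cong image_cong)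
qed

theorem corollary4p5:
  fixes M :: "'w measure" and F :: "real \<Rightarrow> 'w measure"
    and \<Psi> :: "'b::real_vector topology" and \<Phi> :: "'a::real_vector topology"
  assumes "stochastic_basis M F"
    and "locally_convex_space \<Psi>" "quasi_complete \<Psi>" "bornological \<Psi>" "nuclear_space \<Psi>"
    and "locally_convex_space \<Phi>" "complete_lcs \<Phi>" "barrelled \<Phi>" "nuclear_space \<Phi>"
  shows "linearly_isomorphic (continuous_operators \<Psi> (bP_vec M F \<Phi>))
           (continuous_operators \<Psi> (Lb (strong_dual \<Phi>) (bP M F)))
    \<and> linearly_isomorphic (continuous_operators \<Psi> (Lb (strong_dual \<Phi>) (bP M F)))
           (bP_op M F \<Psi> \<Phi>)
    \<and> linearly_isomorphic (bP_op M F \<Psi> \<Phi>) (bP_op M F (strong_dual \<Phi>) (strong_dual \<Psi>))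
    \<and> linear_isomorphism (tilde \<Psi> \<Phi>)
           (bP_op M F (strong_dual \<Phi>) (strong_dual \<Psi>)) (continuous_operators \<Psi> (bP_vec M F \<Phi>))"
proof -
  let ?S1 = "continuous_operators \<Psi> (bP_vec M F \<Phi>)"
    and ?S2 = "continuous_operators \<Psi> (Lb (strong_dual \<Phi>) (bP M F))"
    and ?S3 = "bP_op M F \<Psi> \<Phi>"
    and ?S4 = "bP_op M F (strong_dual \<Phi>) (strong_dual \<Psi>)"
  interpret stochastic_basis M F by fact
  have M: "space M \<noteq> {}"
    by (rule not_empty)
  have \<Psi>: "locally_convex_topology \<Psi>" and \<Phi>: "locally_convex_topology \<Phi>"
    using assms by (auto intro: locally_convex_space_topology)
  have bPv: "locally_convex_topology (bP_vec M F \<Phi>)"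
    using M \<Phi> assms(9) by (rule locally_convex_topology_bP_vec)
  have S1: "subspace ?S1"
    by (rule subspace_continuous_operators[OF \<Psi> bPv])
  have value1: "L x z \<in> topspace \<Phi>" if "L \<in> ?S1" for L x z
  proof (cases "x \<in> topspace \<Psi>")
    case True
    then show ?thesis
      using linear_betwD(1)[OF continuous_operatorsD(1)[OF that] True] bP_vec_value[OF \<Phi>] by simp
  next
    case False
    then show ?thesis
      using continuous_operatorsD(3)[OF that False] subspace_0[OF locally_convex_topology_subspace[OF \<Phi>]] by simp
  qed
  have flip: "linear_isomorphism (\<lambda>L z x. L x z) ?S1 ?S3"
  proof (rule linear_isomorphismI[OF S1])
    show "(\<lambda>L z x. L x z) ` ?S1 = ?S3"
    proof
      show "(\<lambda>L z x. L x z) ` ?S1 \<subseteq> ?S3"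
        using flip_mem_bP_op[OF M \<Psi> \<Phi> assms(9)] by blast
      show "?S3 \<subseteq> (\<lambda>L z x. L x z) ` ?S1"
        using flip_mem_continuous_operators[OF M \<Psi> assms(4) \<Phi> assms(9)]
        by (intro subsetI image_eqI[where f = "\<lambda>L z x. L x z", OF refl]) blast
    qed
  qed (auto simp: inj_on_def fun_eq_iff scaleR_fun_def)
  have flip': "linear_isomorphism (\<lambda>R x z. R z x) ?S3 ?S1"
  proof (rule linear_isomorphism_cong[OF linear_isomorphism_sym[OF flip]])
    fix R assume "R \<in> ?S3"
    then have "(\<lambda>x z. R z x) \<in> ?S1"
      by (rule flip_mem_continuous_operators[OF M \<Psi> assms(4) \<Phi> assms(9)])
    moreover have "inj_on (\<lambda>L z x. L x z) ?S1"
      using flip by (simp add: linear_isomorphism_def bij_betw_def)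
    ultimately show "(\<lambda>x z. R z x) = inv_into ?S1 (\<lambda>L z x. L x z) R"
      using inv_into_f_f[of "\<lambda>L z x. L x z" ?S1 "\<lambda>x z. R z x"] by simp
  qed
  have pairing: "linear_isomorphism (pairing_operator \<Phi>) ?S1 ?S2"
  proof (rule linear_isomorphismI[OF S1])
    show "pairing_operator \<Phi> (L + K) = pairing_operator \<Phi> L + pairing_operator \<Phi> K"
      if "L \<in> ?S1" "K \<in> ?S1" for L K
      using linear_betwD(2)[OF dual_linear value1[OF that(1)] value1[OF that(2)]]
      by (simp add: pairing_operator_def fun_eq_iff)
    show "pairing_operator \<Phi> (c *\<^sub>R L) = c *\<^sub>R pairing_operator \<Phi> L" if "L \<in> ?S1" for L c
      using linear_betwD(3)[OF dual_linear value1[OF that]]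
      by (simp add: pairing_operator_def fun_eq_iff scaleR_fun_def)
    show "inj_on (pairing_operator \<Phi>) ?S1"
    proof (rule inj_onI)
      fix L K assume LK: "L \<in> ?S1" "K \<in> ?S1" and eq: "pairing_operator \<Phi> L = pairing_operator \<Phi> K"
      have "f (L x z) = f (K x z)" if "f \<in> dual \<Phi>" for f x z
        using fun_cong[OF fun_cong[OF fun_cong[OF eq, of x], of f], of z] that
        by (simp add: pairing_operator_def)
      then have "L x z = K x z" for x z
        using nuclear_dual_separates[OF assms(6,9) value1[OF LK(1)] value1[OF LK(2)]] by blast
      then show "L = K"
        by blast
    qed
    show "pairing_operator \<Phi> ` ?S1 = ?S2"
      using pairing_mem_continuous_operators[OF M \<Psi> \<Phi> assms(9,8)]
        pairing_surj[OF M \<Psi> assms(6,9,7)] by blast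
  qed
  have transpose: "linear_isomorphism (transpose_process \<Phi>) ?S3 ?S4"
  proof (rule linear_isomorphismI)
    show "subspace ?S3"
      using flip by (simp add: linear_isomorphism_def linear_betw_def)
    have value3: "R z x \<in> topspace \<Phi>" if "R \<in> ?S3" for R x z
      using flip_mem_continuous_operators[OF M \<Psi> assms(4) \<Phi> assms(9) that] value1 by blast
    show "transpose_process \<Phi> (R + Q) = transpose_process \<Phi> R + transpose_process \<Phi> Q"
      if "R \<in> ?S3" "Q \<in> ?S3" for R Q
      using linear_betwD(2)[OF dual_linear value3[OF that(1)] value3[OF that(2)]]
      by (simp add: transpose_process_def fun_eq_iff)
    show "transpose_process \<Phi> (c *\<^sub>R R) = c *\<^sub>R transpose_process \<Phi> R" if "R \<in> ?S3" for R c
      using linear_betwD(3)[OF dual_linear value3[OF that]]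
      by (simp add: transpose_process_def fun_eq_iff scaleR_fun_def)
    show "inj_on (transpose_process \<Phi>) ?S3"
    proof (rule inj_onI)
      fix R Q assume "R \<in> ?S3" "Q \<in> ?S3" "transpose_process \<Phi> R = transpose_process \<Phi> Q"
      then have "(\<lambda>x z. R z x) = (\<lambda>x z. Q z x)"
        using tilde_transpose[OF \<Psi> assms(6,9)] by metis
      then show "R = Q"
        by (simp add: fun_eq_iff)
    qed
    show "transpose_process \<Phi> ` ?S3 = ?S4"
      using transpose_mem_bP_op[OF \<Psi> assms(4,5) \<Phi> assms(9,8)]
        transpose_surj[OF \<Psi> assms(4,3,6,9,7)] by blast
  qed
  have "linear_isomorphism (tilde \<Psi> \<Phi>) ?S4 ?S1"
  proof (rule linear_isomorphism_cong[OF linear_isomorphism_trans[OF linear_isomorphism_sym[OF transpose] flip']])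
    fix Q assume "Q \<in> ?S4"
    then have "inv_into ?S3 (transpose_process \<Phi>) Q \<in> ?S3"
      "transpose_process \<Phi> (inv_into ?S3 (transpose_process \<Phi>) Q) = Q"
      using transpose by (auto simp: linear_isomorphism_def bij_betw_def inv_into_into f_inv_into_f)
    then show "tilde \<Psi> \<Phi> Q = (\<lambda>x z. inv_into ?S3 (transpose_process \<Phi>) Q z x)"
      using tilde_transpose[OF \<Psi> assms(6,9)] by metis
  qed
  then show ?thesis
    using pairing linear_isomorphism_trans[OF linear_isomorphism_sym[OF pairing] flip] transpose
    unfolding linearly_isomorphic_def by blast
qed

end
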